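(* Let $n\ge2$ and let $i$ be an integer with $0<i<n$. Each $(n-i)^*$-intersection body $K$ in $\mathbb{R}^n$ is an $i$-intersection body. Specifically, if $\rho_K^i=R_{n-i}^*\nu$ with $\nu\in\mathcal{M}_+(G_{n,n-i})$, then $R_i\rho_K^i=R_{n-i,\perp}\mu$, where $\mu=R_i^*\nu^\perp$. Conversely, if $K$ is an $i$-intersection body, i.e. $R_i\rho_K^i=R_{n-i,\perp}\mu$ for some $\mu\in\mathcal{M}_+(S^{n-1})$, then $K$ is an $(n-i)^*$-intersection body provided that $\mu$ is represented in the form $\mu=R_i^*\nu^\perp$ for some $\nu\in\mathcal{M}_+(G_{n,n-i})$; and if the latter is true, then $\rho_K^i=R_{n-i}^*\nu$.
   Context: $S^{n-1}$ is the unit sphere in $\mathbb{R}^n$ with rotation-invariant measure of total mass $1$; $G_{n,k}$ ($1\le k\le n-1$) is the Grassmannian of $k$-dimensional linear subspaces of $\mathbb{R}^n$ with its normalized $SO(n)$-invariant measure. $\mathcal{M}_+(X)$ is the set of nonnegative finite Borel measures on $X$. Continuous functions on $S^{n-1}$ or $G_{n,k}$ are identified with measures via the normalized invariant measures. An origin-symmetric star body is a compact origin-symmetric set $K\subset\mathbb{R}^n$, star-shaped with respect to the origin, whose radial function $\rho_K(x)=\sup\{\lambda\ge0:\lambda x\in K\}$ is positive and continuous on $S^{n-1}$. All bodies $K$ here are origin-symmetric star bodies. Radon transforms: $(R_kf)(\xi)=\int_{S^{n-1}\cap\xi}f(\theta)\,d_\xi\theta$ for $\xi\in G_{n,k}$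 (invariant probability measure on $S^{n-1}\cap\xi$), and $(R_k^*\varphi)(\theta)=\int_{\xi\ni\theta}\varphi(\xi)\,d_\theta\xi$ (invariant probability measure on $\{\xi\in G_{n,k}:\xi\ni\theta\}$). For a finite measure $\nu$ on $G_{n,k}$, $R_k^*\nu$ is the measure on $S^{n-1}$ defined by $(R_k^*\nu,f)=(\nu,R_kf)$, $f\in C(S^{n-1})$. Also $(R_{n-i,\perp}f)(\xi)=(R_{n-i}f)(\xi^\perp)$ for $\xi\in G_{n,i}$, and for a finite measure $\mu$ on $S^{n-1}$, $R_{n-i,\perp}\mu$ is the measure on $G_{n,i}$ defined by $(R_{n-i,\perp}\mu,\varphi)=(\mu,R_{n-i}^*\varphi^\perp)$ for $\varphi\in C(G_{n,i})$, where $\varphi^\perp(\eta)=\varphi(\eta^\perp)$, $\eta\in G_{n,n-i}$. For $\nu\in\mathcal{M}_+(G_{n,n-i})$ the measure $\nu^\perp\in\mathcal{M}_+(G_{n,i})$ is defined by $(\nu^\perp,\varphi)=(\nu,\varphi^\perp)$, $\varphi\in C(G_{n,i})$. Definitions. For $1\le k\le n-1$, $K$ is a $k^*$-intersection body if there is $\nu\in\mathcal{M}_+(G_{n,k})$ with $\rho_K^{n-k}=R_k^*\nu$ (so $K$ is an $(n-i)^*$-intersection body iff $\rho_K^i=R_{n-i}^*\nu$ for some $\nu\in\mathcal{M}_+(G_{n,n-i})$). $K$ is an $i$-intersection body if there is $\mu\in\mathcal{M}_+(S^{n-1})$ with $R_i\rho_K^i=R_{n-i,\perp}\mu$. *)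

theory Defs
  imports "HOL-Probability.Probability"
begin

section \<open>Borel measures on topological spaces\<close>

definition borel_of :: "'a topology \<Rightarrow> 'a measure" where
  "borel_of T = sigma (topspace T) {U. openin T U}"

text \<open>The class of nonnegative finite Borel measures, written M with subscript + in the literature.\<close>

definition finite_borel_measures :: "'a topology \<Rightarrow> 'a measure set" where
  "finite_borel_measures T = {M. sets M = sets (borel_of T) \<and> finite_measure M}"

text \<open>The unique \<open>G\<close>-invariant Borel probability measure; it is used only for compact spaces on
  which a compact group acts transitively by homeomorphisms, where it exists and is unique.\<close>

definition invariant_prob_measure :: "'a topology \<Rightarrow> ('a \<Rightarrow> 'a) set \<Rightarrow> 'a measure" where
  "invariant_prob_measure T G =
     (THE M. sets M = sets (borel_of T) \<and> prob_space M \<and> (\<forall>g\<in>G. distr M M g = M))"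

text \<open>The finite Borel measure \<open>M\<close> with \<open>(M, f) = L f\<close> for all continuous \<open>f\<close>.  It is used only for
  positive linear functionals on the continuous functions of a compact metrizable space.\<close>

definition measure_of_functional :: "'a topology \<Rightarrow> (('a \<Rightarrow> real) \<Rightarrow> real) \<Rightarrow> 'a measure" where
  "measure_of_functional T L =
     (THE M. M \<in> finite_borel_measures T \<and>
        (\<forall>f. continuous_map T euclideanreal f \<longrightarrow> (\<integral>x. f x \<partial>M) = L f))"

text \<open>A nonnegative continuous function, identified with a measure via the reference measure \<open>M\<close>.\<close>

definition fun_measure :: "'a measure \<Rightarrow> ('a \<Rightarrow> real) \<Rightarrow> 'a measure" where
  "fun_measure M f = density M (\<lambda>x. ennreal (f x))"

section \<open>Spheres and Grassmannians\<close>

text \<open>Throughout, \<open>n = CARD('n)\<close>.\<close>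

definition sphere_top :: "(real^'n) topology" where
  "sphere_top = top_of_set (sphere 0 1)"

definition sphere_measure :: "(real^'n) measure" where
  "sphere_measure = invariant_prob_measure sphere_top {(*v) A | A. rotation_matrix A}"

text \<open>The Grassmannian carries its usual topology: a subspace is identified with the matrix of the
  orthogonal projection onto it.\<close>

definition grassmannian :: "nat \<Rightarrow> (real^'n) set topology" where
  "grassmannian k =
     pullback_topology {\<xi>. subspace \<xi> \<and> dim \<xi> = k} (\<lambda>\<xi>. matrix (closest_point \<xi>)) euclidean"

definition grassmannian_measure :: "nat \<Rightarrow> (real^'n) set measure" where
  "grassmannian_measure k =
     invariant_prob_measure (grassmannian k) {(`) ((*v) A) | A. rotation_matrix A}"

text \<open>The invariant probability measures on the unit sphere of the subspace \<open>\<xi>\<close> and on the set of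
  \<open>k\<close>-dimensional subspaces containing \<open>\<theta>\<close>: invariance is under the stabilizer of \<open>\<xi>\<close>, respectively
  \<open>\<theta>\<close>, in \<open>SO(n)\<close>.  For \<open>0 < dim \<xi> < n\<close> the stabilizer of \<open>\<xi>\<close> acts on \<open>\<xi>\<close> as the full orthogonal
  group, so the action is transitive also when \<open>dim \<xi> = 1\<close>.\<close>

definition subsphere_measure :: "(real^'n) set \<Rightarrow> (real^'n) measure" where
  "subsphere_measure \<xi> =
     invariant_prob_measure (subtopology sphere_top \<xi>)
       {(*v) A | A. rotation_matrix A \<and> (*v) A ` \<xi> = \<xi>}"

definition subgrassmannian_measure :: "nat \<Rightarrow> real^'n \<Rightarrow> (real^'n) set measure" where
  "subgrassmannian_measure k \<theta> =
     invariant_prob_measure (subtopology (grassmannian k) {\<xi>. \<theta> \<in> \<xi>})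
       {(`) ((*v) A) | A. rotation_matrix A \<and> A *v \<theta> = \<theta>}"

section \<open>Radon transforms\<close>

text \<open>\<open>R\<^sub>k f\<close> is the restriction of \<open>radon f\<close> to the \<open>k\<close>-dimensional subspaces.\<close>

definition radon :: "(real^'n \<Rightarrow> real) \<Rightarrow> (real^'n) set \<Rightarrow> real" where
  "radon f \<xi> = (\<integral>\<theta>. f \<theta> \<partial>subsphere_measure \<xi>)"

definition radon_dual :: "nat \<Rightarrow> ((real^'n) set \<Rightarrow> real) \<Rightarrow> real^'n \<Rightarrow> real" where
  "radon_dual k \<phi> \<theta> = (\<integral>\<xi>. \<phi> \<xi> \<partial>subgrassmannian_measure k \<theta>)"

text \<open>\<open>R\<^sub>k\<^sup>* \<nu>\<close> for a measure \<open>\<nu>\<close> on \<open>G\<^sub>n\<^sub>,\<^sub>k\<close>; the dimension \<open>k\<close> is determined by \<open>\<nu>\<close>.\<close>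

definition radon_dual_measure :: "(real^'n) set measure \<Rightarrow> (real^'n) measure" where
  "radon_dual_measure \<nu> = measure_of_functional sphere_top (\<lambda>f. \<integral>\<xi>. radon f \<xi> \<partial>\<nu>)"

text \<open>\<open>\<nu>\<^sup>\<bottom>\<close> as a measure on \<open>G\<^sub>n\<^sub>,\<^sub>i\<close>, for a measure \<open>\<nu>\<close> on \<open>G\<^sub>n\<^sub>,\<^sub>n\<^sub>-\<^sub>i\<close>.\<close>

definition perp_measure :: "nat \<Rightarrow> (real^'n) set measure \<Rightarrow> (real^'n) set measure" where
  "perp_measure i \<nu> = measure_of_functional (grassmannian i) (\<lambda>\<phi>. \<integral>\<eta>. \<phi> (\<eta>\<^sup>\<bottom>) \<partial>\<nu>)"

text \<open>\<open>R\<^sub>n\<^sub>-\<^sub>i\<^sub>,\<^sub>\<bottom> \<mu>\<close>, a measure on \<open>G\<^sub>n\<^sub>,\<^sub>i\<close>, for a measure \<open>\<mu>\<close> on the sphere.  The numerical parameter is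
  the dimension \<open>i\<close> of the resulting Grassmannian, not the subscript \<open>n - i\<close>.\<close>

definition radon_perp_measure :: "nat \<Rightarrow> (real^'n) measure \<Rightarrow> (real^'n) set measure" where
  "radon_perp_measure i \<mu> =
     measure_of_functional (grassmannian i)
       (\<lambda>\<phi>. \<integral>\<theta>. radon_dual (CARD('n) - i) (\<lambda>\<eta>. \<phi> (\<eta>\<^sup>\<bottom>)) \<theta> \<partial>\<mu>)"

section \<open>Star bodies and intersection bodies\<close>

definition radial_function :: "(real^'n) set \<Rightarrow> real^'n \<Rightarrow> real" where
  "radial_function K x = Sup {t. 0 \<le> t \<and> t *\<^sub>R x \<in> K}"

definition sym_star_body :: "(real^'n) set \<Rightarrow> bool" where
  "sym_star_body K \<longleftrightarrow>
     compact K \<and> (\<forall>x\<in>K. - x \<in> K) \<and> 0 \<in> K \<and> (\<forall>x\<in>K. closed_segment 0 x \<subseteq> K) \<and>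
     (\<forall>\<theta>\<in>sphere 0 1. 0 < radial_function K \<theta>) \<and>
     continuous_on (sphere 0 1) (radial_function K)"

definition radial_power_measure :: "nat \<Rightarrow> (real^'n) set \<Rightarrow> (real^'n) measure" where
  "radial_power_measure j K = fun_measure sphere_measure (\<lambda>\<theta>. radial_function K \<theta> ^ j)"

definition radon_radial_power_measure :: "nat \<Rightarrow> (real^'n) set \<Rightarrow> (real^'n) set measure" where
  "radon_radial_power_measure i K =
     fun_measure (grassmannian_measure i) (radon (\<lambda>\<theta>. radial_function K \<theta> ^ i))"

definition star_intersection_body :: "nat \<Rightarrow> (real^'n) set \<Rightarrow> bool" where
  "star_intersection_body k K \<longleftrightarrow>
     sym_star_body K \<and>
     (\<exists>\<nu>\<in>finite_borel_measures (grassmannian k).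
        radial_power_measure (CARD('n) - k) K = radon_dual_measure \<nu>)"

definition intersection_body :: "nat \<Rightarrow> (real^'n) set \<Rightarrow> bool" where
  "intersection_body i K \<longleftrightarrow>
     sym_star_body K \<and>
     (\<exists>\<mu>\<in>finite_borel_measures sphere_top.
        radon_radial_power_measure i K = radon_perp_measure i \<mu>)"

end

theory Submission
  imports Defs
begin

text \<open>Let \<open>\<rho>\<close> be the radial function of \<open>K\<close>.  Both assertions compare, for continuous \<open>\<phi>\<close> on
  \<open>G\<^sub>n\<^sub>,\<^sub>i\<close>, the numbers \<open>(R\<^sub>i \<rho>\<^sup>i, \<phi>)\<close> and \<open>(R\<^sub>n\<^sub>-\<^sub>i\<^sub>,\<^sub>\<bottom> \<mu>, \<phi>)\<close>, where \<open>\<mu> = R\<^sub>i\<^sup>* \<nu>\<^sup>\<bottom>\<close>.  By duality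
  (\<open>radon_duality\<close>) the first is \<open>(\<rho>\<^sup>i, R\<^sub>i\<^sup>* \<phi>)\<close>.  The second is \<open>(\<nu>\<^sup>\<bottom>, R\<^sub>i R\<^sub>n\<^sub>-\<^sub>i\<^sup>* \<phi>\<^sup>\<bottom>)\<close>, and the
  pointwise identity \<open>(R\<^sub>i R\<^sub>n\<^sub>-\<^sub>i\<^sup>* \<phi>\<^sup>\<bottom>)(\<eta>\<^sup>\<bottom>) = (R\<^sub>n\<^sub>-\<^sub>i R\<^sub>i\<^sup>* \<phi>)(\<eta>)\<close> (\<open>radon_intertwining\<close>) turns it into
  \<open>(R\<^sub>n\<^sub>-\<^sub>i\<^sup>* \<nu>, R\<^sub>i\<^sup>* \<phi>)\<close>.  So \<open>\<rho>\<^sup>i = R\<^sub>n\<^sub>-\<^sub>i\<^sup>* \<nu>\<close> at once gives \<open>R\<^sub>i \<rho>\<^sup>i = R\<^sub>n\<^sub>-\<^sub>i\<^sub>,\<^sub>\<bottom> \<mu>\<close>, and the converse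
  holds because an even measure on the sphere is determined by its integrals over the functions
  \<open>R\<^sub>i\<^sup>* \<phi>\<close> (\<open>even_measure_eq_if_same_radon_dual_integrals\<close>).

  The intertwining identity is a symmetry statement.  With \<open>\<zeta> = \<eta>\<^sup>\<bottom>\<close>, the two sides average \<open>\<phi>(\<xi>)\<close>
  over the following random subspaces \<open>\<xi>\<close>: either choose a unit vector \<open>\<theta>\<close> orthogonal to \<open>\<zeta>\<close> and then
  \<open>\<xi>\<close> through \<open>\<theta>\<close>, or choose a unit vector \<open>\<theta>\<close> in \<open>\<zeta>\<close> and then \<open>\<xi>\<close> orthogonal to \<open>\<theta>\<close>.  If \<open>\<zeta>\<close> is chosen
  at random as well, the two joint laws of \<open>(\<xi>, \<zeta>)\<close> arise from each other by exchanging the two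
  entries.  They are invariant under the orthogonal group, and any two subspaces of equal dimension
  are exchanged by some orthogonal matrix (\<open>subspaces_exchangeable\<close>); hence an invariant law on pairs is
  symmetric, the joint laws agree, and continuity gives the identity for every \<open>\<zeta>\<close>.

  For the injectivity take \<open>\<phi>(\<xi>) = dist(x, \<xi>)\<^sup>2\<^sup>m\<close>.  The stabilizer of \<open>\<theta>\<close> in the orthogonal group acts
  transitively on the unit vectors orthogonal to \<open>\<theta>\<close>, so \<open>R\<^sub>i\<^sup>* \<phi> (\<theta>) = c (\<bar>x\<bar>\<^sup>2 - (x \<bullet> \<theta>)\<^sup>2)\<^sup>m\<close> with a constant \<open>c > 0\<close> that
  depends only on \<open>m\<close>.  These functions determine the integrals of all even powers of \<open>x \<bullet> \<theta>\<close>; the odd powers integrate to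
  \<open>0\<close> by evenness.  Summing the exponential series yields the integrals of \<open>exp (x \<bullet> \<theta>)\<close>, and the
  linear span of these exponentials is an algebra that is dense by the Stone-Weierstrass theorem.

  The transforms are defined through the unique invariant probability measures.  Uniqueness
  (\<open>invariant_measure_unique\<close>) uses only that the group acts transitively by isometries, so that all balls
  of one radius have the same measure.  Existence comes from explicit formulas: Haar measure on
  the orthogonal group is built from random reflections, and the other measures are images of Haar
  measure or of Lebesgue measure on the unit ball.  The same formulas make the transforms
  measurable and represent the functionals that define the transforms of measures.\<close>


section \<open>Borel measures on pullback topologies\<close>

lemma space_borel_of [simp]: "space (borel_of T) = topspace T"
  unfolding borel_of_def by (intro space_measure_of) (auto dest: openin_subset)

lemma sets_borel_of: "sets (borel_of T) = sigma_sets (topspace T) {U. openin T U}"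
  unfolding borel_of_def by (intro sets_measure_of) (auto dest: openin_subset)

lemma topspace_pullback_euclidean [simp]: "topspace (pullback_topology S e euclidean) = S"
  by (simp add: topspace_pullback_topology)

lemma sets_borel_of_pullback:
  "sets (borel_of (pullback_topology S e euclidean)) = sets (vimage_algebra S e borel)"
proof -
  have "vimage_algebra S e borel = sigma S {e -` A \<inter> S | A. A \<in> {U. open U}}"
    unfolding borel_def by (intro vimage_algebra_sigma) auto
  then show ?thesis
    by (simp add: borel_of_def openin_pullback_topology conj_commute)
qed

lemma measurable_into_pullback:
  assumes "f \<in> space M \<rightarrow> S" "(\<lambda>x. e (f x)) \<in> borel_measurable M"
  shows "f \<in> measurable M (borel_of (pullback_topology S e euclidean))"
proof -
  have "f \<in> measurable M (vimage_algebra S e borel)"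
    using assms by (intro measurable_vimage_algebra2) auto
  then show ?thesis
    by (simp add: measurable_cong_sets[OF refl sets_borel_of_pullback])
qed

lemma measurable_pullback_map:
  "e \<in> borel_measurable (borel_of (pullback_topology S e euclidean))"
  by (subst measurable_cong_sets[OF sets_borel_of_pullback refl]) (rule measurable_vimage_algebra1, auto)

lemma continuous_map_borel_measurable:
  assumes "continuous_map T euclidean f"
  shows "f \<in> borel_measurable (borel_of T)"
proof (rule borel_measurableI)
  fix U :: "'b set" assume "open U"
  then have "openin T {x \<in> topspace T. f x \<in> U}"
    using assms openin_continuous_map_preimage by fastforce
  moreover have "f -` U \<inter> space (borel_of T) = {x \<in> topspace T. f x \<in> U}" by auto
  ultimately show "f -` U \<inter> space (borel_of T) \<in> sets (borel_of T)"
    by (auto simp: sets_borel_of)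
qed

lemma continuous_map_from_pullback:
  assumes "continuous_on UNIV f"
  shows "continuous_map (pullback_topology S e euclidean) euclidean (\<lambda>x. f (e x))"
  using continuous_map_pullback[of euclidean euclidean f S e] assms by (simp add: o_def)

text \<open>The continuous functions \<open>max 0 (1 - j dist(e x, C))\<close> decrease to the indicator of the preimage of a
  closed set \<open>C\<close>, and these preimages generate the Borel sets.\<close>

lemma finite_measure_eq_if_same_integrals:
  fixes e :: "'a \<Rightarrow> 'b::metric_space" and S
  defines "T \<equiv> pullback_topology S e euclidean"
  assumes M: "M \<in> finite_borel_measures T" and N: "N \<in> finite_borel_measures T"
    and eq: "\<And>f. continuous_map T euclideanreal f \<Longrightarrow> (\<integral>x. f x \<partial>M) = (\<integral>x. f x \<partial>N)"
  shows "M = N"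
proof -
  define E where "E = {e -` C \<inter> S | C. closed C}"
  have sT: "sets (borel_of T) = sigma_sets S E"
  proof -
    have "vimage_algebra S e borel = sigma S {e -` A \<inter> S | A. A \<in> Collect closed}"
      unfolding borel_eq_closed by (intro vimage_algebra_sigma) auto
    then show ?thesis unfolding T_def sets_borel_of_pullback E_def by (auto intro!: sets_measure_of)
  qed
  have sM: "sets M = sets (borel_of T)" and sN: "sets N = sets (borel_of T)"
    and fM: "finite_measure M" and fN: "finite_measure N"
    using M N by (auto simp: finite_borel_measures_def)
  have spM: "space M = S" and spN: "space N = S"
    using sets_eq_imp_space_eq[OF sM] sets_eq_imp_space_eq[OF sN] by (auto simp: T_def)
  have key: "(\<lambda>j. \<integral>x. max 0 (1 - real j * infdist (e x) C) \<partial>M) \<longlonglongrightarrow> measure M (e -` C \<inter> S)"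
    if C: "closed C" "C \<noteq> {}" and sM: "sets M = sets (borel_of T)" and fM: "finite_measure M" for C M
  proof -
    interpret finite_measure M by fact
    have spM: "space M = S" using sets_eq_imp_space_eq[OF sM] by (auto simp: T_def)
    have eM: "e \<in> borel_measurable M"
      using measurable_pullback_map[of e S] sM by (simp add: T_def cong: measurable_cong_sets)
    have CM: "e -` C \<inter> S \<in> sets M"
      using measurable_sets[OF eM borel_closed[OF C(1)]] by (simp add: spM)
    have "(\<lambda>j. \<integral>x. max 0 (1 - real j * infdist (e x) C) \<partial>M) \<longlonglongrightarrow> (\<integral>x. indicator (e -` C \<inter> S) x \<partial>M)"
    proof (rule integral_dominated_convergence[where w = "\<lambda>_. 1"])
      have "(\<lambda>x. infdist x C) \<in> borel_measurable borel"
        by (intro borel_measurable_continuous_onI continuous_intros)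
      then have m: "(\<lambda>x. infdist (e x) C) \<in> borel_measurable M"
        using measurable_compose[OF eM] by blast
      show "(\<lambda>x. max 0 (1 - real j * infdist (e x) C)) \<in> borel_measurable M" for j
        using m by measurable
      show "AE x in M. norm (max 0 (1 - real j * infdist (e x) C)) \<le> 1" for j
        by (auto simp: infdist_nonneg)
      show "AE x in M. (\<lambda>j. max 0 (1 - real j * infdist (e x) C)) \<longlonglongrightarrow> indicator (e -` C \<inter> S) x"
      proof (intro AE_I2)
        fix x assume x: "x \<in> space M"
        show "(\<lambda>j. max 0 (1 - real j * infdist (e x) C)) \<longlonglongrightarrow> indicator (e -` C \<inter> S) x"
        proof (cases "e x \<in> C")
          case True then show ?thesis using x spM by simp
        next
          case False
          then have pos: "infdist (e x) C > 0" using infdist_pos_not_in_closed C by blast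
          obtain k :: nat where k: "real k * infdist (e x) C > 1"
            using reals_Archimedean3[OF pos] by blast
          have "eventually (\<lambda>j. max 0 (1 - real j * infdist (e x) C) = 0) sequentially"
          proof (rule eventually_sequentiallyI[of k])
            fix j assume "k \<le> j"
            then have "real k * infdist (e x) C \<le> real j * infdist (e x) C"
              using pos by (intro mult_right_mono) auto
            then show "max 0 (1 - real j * infdist (e x) C) = 0" using k by linarith
          qed
          then show ?thesis using False by (simp add: tendsto_eventually)
        qed
      qed
    qed (use CM in auto)
    then show ?thesis using CM by simp
  qed
  show ?thesis
  proof (rule measure_eqI_generator_eq[where E = E and \<Omega> = S and A = "\<lambda>_. S"])
    show "Int_stable E"
      unfolding Int_stable_def E_def
    proof safe
      fix C D :: "'b set" assume "closed C" "closed D"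
      then show "\<exists>X. e -` C \<inter> S \<inter> (e -` D \<inter> S) = e -` X \<inter> S \<and> closed X"
        by (intro exI[of _ "C \<inter> D"]) auto
    qed
    show "E \<subseteq> Pow S" by (auto simp: E_def)
    show "sets M = sigma_sets S E" "sets N = sigma_sets S E" using sM sN sT by auto
    show "range (\<lambda>_. S) \<subseteq> E" by (auto simp: E_def intro!: exI[of _ UNIV])
    show "(\<Union>i::nat. S) = S" by simp
    show "emeasure M S \<noteq> \<infinity>" using finite_measure.emeasure_finite[OF fM] by simp
  next
    fix X assume "X \<in> E"
    then obtain C where C: "closed C" "X = e -` C \<inter> S" by (auto simp: E_def)
    show "emeasure M X = emeasure N X"
    proof (cases "C = {}")
      case False
      have c: "continuous_map T euclideanreal (\<lambda>x. max 0 (1 - real j * infdist (e x) C))" for j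
        unfolding T_def by (intro continuous_map_from_pullback) (intro continuous_intros)
      have "measure M X = measure N X"
        using LIMSEQ_unique[OF key[OF C(1) False sM fM]] key[OF C(1) False sN fN] eq[OF c] C(2) by simp
      then show ?thesis
        using fM fN by (simp add: finite_measure.emeasure_eq_measure)
    qed (use C in simp)
  qed
qed

section \<open>Uniqueness of invariant measures\<close>

text \<open>The distance on \<open>S\<close> is the one pulled back along \<open>e\<close>: a Grassmannian is a set of sets, which has a
  metric only through its projection matrices.\<close>

definition isometric_transitive :: "'a set \<Rightarrow> ('a \<Rightarrow> 'b::metric_space) \<Rightarrow> ('a \<Rightarrow> 'a) set \<Rightarrow> bool" where
  "isometric_transitive S e G \<longleftrightarrow>
     (\<forall>g\<in>G. g \<in> S \<rightarrow> S \<and> (\<forall>x\<in>S. \<forall>y\<in>S. dist (e (g x)) (e (g y)) = dist (e x) (e y))) \<and>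
     (\<forall>x\<in>S. \<forall>y\<in>S. \<exists>g\<in>G. g x = y)"

lemma isometric_transitive_measurable:
  fixes e :: "'a \<Rightarrow> 'b::metric_space"
  assumes it: "isometric_transitive S e G" and g: "g \<in> G"
  defines "M \<equiv> borel_of (pullback_topology S e euclidean)"
  shows "g \<in> measurable M M"
proof -
  have gS: "g \<in> S \<rightarrow> S" and iso: "\<And>x y. x \<in> S \<Longrightarrow> y \<in> S \<Longrightarrow> dist (e (g x)) (e (g y)) = dist (e x) (e y)"
    using it g unfolding isometric_transitive_def by blast+
  have space_M: "space M = S" by (simp add: M_def)
  have "(\<lambda>x. e (g x)) \<in> borel_measurable M"
  proof (rule borel_measurableI)
    fix V :: "'b set" assume V: "open V"
    define W where "W = \<Union>{ball (e x) r | x r. x \<in> S \<and> ball (e (g x)) r \<subseteq> V}"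
    have "open W" unfolding W_def by auto
    moreover have "e (g y) \<in> V \<longleftrightarrow> e y \<in> W" if y: "y \<in> S" for y
    proof
      assume "e (g y) \<in> V"
      then obtain r where "r > 0" "ball (e (g y)) r \<subseteq> V" using V open_contains_ball by blast
      then show "e y \<in> W" using y unfolding W_def
        by (auto intro!: exI[of _ "ball (e y) r"])
    next
      assume "e y \<in> W"
      then obtain x r where x: "x \<in> S" "ball (e (g x)) r \<subseteq> V" "e y \<in> ball (e x) r"
        unfolding W_def by blast
      then have "e (g y) \<in> ball (e (g x)) r" using iso[of x y] y by simp
      then show "e (g y) \<in> V" using x by blast
    qed
    then have "(\<lambda>x. e (g x)) -` V \<inter> space M = e -` W \<inter> space M"
      by (auto simp: space_M)
    ultimately show "(\<lambda>x. e (g x)) -` V \<inter> space M \<in> sets M"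
      using measurable_sets[OF measurable_pullback_map[of e S, folded M_def] borel_open] by simp
  qed
  then show "g \<in> measurable M M"
    using gS unfolding M_def by (intro measurable_into_pullback) (auto simp: space_M)
qed

locale invariant_measure =
  fixes S :: "'a set" and e :: "'a \<Rightarrow> 'b::{metric_space, second_countable_topology}"
    and G :: "('a \<Rightarrow> 'a) set" and M :: "'a measure"
  assumes it: "isometric_transitive S e G"
    and sets_M: "sets M = sets (borel_of (pullback_topology S e euclidean))"
    and prob: "prob_space M"
    and inv: "g \<in> G \<Longrightarrow> distr M M g = M"
begin

sublocale prob_space M by (rule prob)

lemma space_M: "space M = S"
  using sets_eq_imp_space_eq[OF sets_M] by simp

lemma e_measurable [measurable]: "e \<in> borel_measurable M"
  using measurable_pullback_map[of e S] sets_M by (simp cong: measurable_cong_sets)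

definition mball :: "'a \<Rightarrow> real \<Rightarrow> 'a set" where
  "mball x r = {y \<in> S. dist (e x) (e y) < r}"

lemma mball_sets [measurable]: "mball x r \<in> sets M"
proof -
  have "{y \<in> space M. dist (e x) (e y) < r} \<in> sets M" by measurable
  then show ?thesis by (simp add: mball_def space_M)
qed

lemma g_measurable: "g \<in> G \<Longrightarrow> g \<in> measurable M M"
  using isometric_transitive_measurable[OF it]
  by (simp add: measurable_cong_sets[OF sets_M sets_M])

lemma mball_const:
  assumes "x \<in> S" "y \<in> S"
  shows "emeasure M (mball x r) = emeasure M (mball y r)"
proof -
  obtain g where g: "g \<in> G" "g x = y" using it assms unfolding isometric_transitive_def by blast
  have gS: "g \<in> S \<rightarrow> S" and iso: "\<And>x y. x \<in> S \<Longrightarrow> y \<in> S \<Longrightarrow> dist (e (g x)) (e (g y)) = dist (e x) (e y)"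
    using it g unfolding isometric_transitive_def by blast+
  have "emeasure M (mball y r) = emeasure (distr M M g) (mball y r)" using inv[OF g(1)] by simp
  also have "\<dots> = emeasure M (g -` mball y r \<inter> space M)"
    using g_measurable[OF g(1)] by (intro emeasure_distr) auto
  also have "g -` mball y r \<inter> space M = mball x r"
    using gS iso assms g(2) by (auto simp: mball_def space_M)
  finally show ?thesis by simp
qed

text \<open>If one ball of radius \<open>r\<close> were a null set, all would be, and countably many of them cover \<open>S\<close>.\<close>

lemma mball_pos:
  assumes "x \<in> S" "r > 0"
  shows "emeasure M (mball x r) > 0"
proof (rule ccontr)
  assume "\<not> ?thesis"
  then have null: "mball y r \<in> null_sets M" if "y \<in> S" for y
    using mball_const[OF assms(1) that, of r] by (intro null_setsI) auto
  define F where "F = (\<lambda>y. ball (e y) r) ` S"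
  obtain F' where F': "F' \<subseteq> F" "countable F'" "\<Union>F' = \<Union>F"
    using Lindelof[of F] by (auto simp: F_def)
  have "(\<Union>B\<in>F'. e -` B \<inter> S) \<in> null_sets M"
  proof (rule null_sets_UN'[OF F'(2)])
    fix B assume "B \<in> F'"
    then obtain y where "y \<in> S" "B = ball (e y) r" using F' by (auto simp: F_def)
    then have "e -` B \<inter> S = mball y r" by (auto simp: mball_def)
    then show "e -` B \<inter> S \<in> null_sets M" using null \<open>y \<in> S\<close> by simp
  qed
  moreover have "(\<Union>B\<in>F'. e -` B \<inter> S) = e -` (\<Union>F) \<inter> S"
    unfolding F'(3)[symmetric] by auto
  moreover have "e -` (\<Union>F) \<inter> S = space M"
    using assms(2) by (force simp: F_def space_M)
  ultimately show False using emeasure_space_1 by (auto simp: null_sets_def)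
qed

end

text \<open>A Lebesgue density argument.  For \<open>x\<close> in the preimage \<open>U\<close> of \<open>V\<close>, the fraction of the ball around \<open>x\<close>
  that lies in \<open>U\<close>, measured by \<open>N\<close>, is \<open>1\<close> as soon as the radius is small.  Fatou's lemma bounds
  \<open>M U\<close> by the limit of the \<open>M\<close>-integrals over \<open>U\<close> of these fractions, and exchanging the order of integration
  bounds each integral by \<open>N U\<close>, because an \<open>M\<close>-ball is at most as large as an \<open>N\<close>-ball.\<close>

lemma open_measure_le_if_balls_le:
  fixes e :: "'a \<Rightarrow> 'b::{metric_space, second_countable_topology}"
  assumes "sigma_finite_measure M" and "sigma_finite_measure N"
    and spM: "space M = S" and spN: "space N = S"
    and eM [measurable]: "e \<in> borel_measurable M" and eN [measurable]: "e \<in> borel_measurable N"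
    and r0: "\<And>k::nat. r k > 0" and rlim: "r \<longlonglongrightarrow> 0"
    and n0: "\<And>k. n k > 0" "\<And>k. n k \<noteq> (\<infinity>::ennreal)"
    and leM: "\<And>k x. x \<in> S \<Longrightarrow> emeasure M {y \<in> S. dist (e x) (e y) < r k} \<le> n k"
    and eqN: "\<And>k x. x \<in> S \<Longrightarrow> emeasure N {y \<in> S. dist (e x) (e y) < r k} = n k"
    and V: "open V"
  shows "emeasure M (e -` V \<inter> S) \<le> emeasure N (e -` V \<inter> S)"
proof -
  interpret M: sigma_finite_measure M by fact
  interpret N: sigma_finite_measure N by fact
  interpret P: pair_sigma_finite M N ..
  define mb where "mb x \<rho> = {y \<in> S. dist (e x) (e y) < \<rho>}" for x \<rho>
  have mbM [measurable]: "mb x \<rho> \<in> sets M" for x \<rho>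
  proof -
    have "{y \<in> space M. dist (e x) (e y) < \<rho>} \<in> sets M" by measurable
    then show ?thesis by (simp add: mb_def spM)
  qed
  have mbN [measurable]: "mb x \<rho> \<in> sets N" for x \<rho>
  proof -
    have "{y \<in> space N. dist (e x) (e y) < \<rho>} \<in> sets N" by measurable
    then show ?thesis by (simp add: mb_def spN)
  qed
  define U where "U = e -` V \<inter> S"
  have UM [measurable]: "U \<in> sets M" and UN [measurable]: "U \<in> sets N"
    using measurable_sets[OF eM borel_open[OF V]] measurable_sets[OF eN borel_open[OF V]]
    by (auto simp: U_def spM spN)
  define K where "K k x y = (indicator U x * indicator U y * indicator {z. dist (fst z) (snd z) < r k} (e x, e y) :: ennreal)" for k x y
  have Km: "(\<lambda>(x, y). K k x y) \<in> borel_measurable (M \<Otimes>\<^sub>M N)" for k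
  proof -
    have "{z::'b\<times>'b. dist (fst z) (snd z) < r k} \<in> sets borel"
      by (intro borel_open open_Collect_less continuous_intros)
    then have [measurable]: "{z::'b\<times>'b. dist (fst z) (snd z) < r k} \<in> sets (borel \<Otimes>\<^sub>M borel)"
      unfolding borel_prod .
    show ?thesis unfolding K_def split_beta by measurable
  qed
  have inner: "(\<integral>\<^sup>+x. K k x y \<partial>M) \<le> n k * indicator U y" if y: "y \<in> S" for k y
  proof -
    have "(\<integral>\<^sup>+x. K k x y \<partial>M) \<le> (\<integral>\<^sup>+x. indicator U y * indicator (mb y (r k)) x \<partial>M)"
      by (intro nn_integral_mono) (auto simp: K_def U_def mb_def spM indicator_def dist_commute)
    also have "\<dots> = indicator U y * emeasure M (mb y (r k))"
      by (subst nn_integral_cmult) auto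
    also have "\<dots> \<le> indicator U y * n k"
      using leM[OF y, of k] by (intro mult_left_mono) (auto simp: mb_def)
    finally show ?thesis by (simp add: mult.commute)
  qed
  \<comment> \<open>the order of integration is exchanged, and the inner \<open>M\<close>-integral is bounded by the measure of an \<open>M\<close>-ball\<close>
  have outer: "(\<integral>\<^sup>+x. (\<integral>\<^sup>+y. K k x y \<partial>N) / n k \<partial>M) \<le> emeasure N U" for k
  proof -
    have m: "(\<lambda>x. \<integral>\<^sup>+y. K k x y \<partial>N) \<in> borel_measurable M"
      using N.borel_measurable_nn_integral[OF Km] by simp
    have "(\<integral>\<^sup>+x. (\<integral>\<^sup>+y. K k x y \<partial>N) \<partial>M) = (\<integral>\<^sup>+y. (\<integral>\<^sup>+x. K k x y \<partial>M) \<partial>N)"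
      using P.Fubini'[OF Km] by simp
    also have "\<dots> \<le> (\<integral>\<^sup>+y. n k * indicator U y \<partial>N)"
      using inner by (intro nn_integral_mono) (auto simp: spN)
    also have "\<dots> = n k * emeasure N U" by (subst nn_integral_cmult) auto
    finally have "(\<integral>\<^sup>+x. (\<integral>\<^sup>+y. K k x y \<partial>N) \<partial>M) \<le> n k * emeasure N U" .
    then have "(\<integral>\<^sup>+x. (\<integral>\<^sup>+y. K k x y \<partial>N) \<partial>M) / n k \<le> n k * emeasure N U / n k"
      by (rule divide_right_mono_ennreal)
    also have "n k * emeasure N U / n k = emeasure N U"
      using n0[of k] by (metis ennreal_mult_divide_eq infinity_ennreal_def mult.commute less_numeral_extra(3))
    finally show ?thesis using m by (simp add: nn_integral_divide)
  qed
  \<comment> \<open>a small ball around a point of the open set \<open>U\<close> lies in \<open>U\<close>, so that the quotient is eventually \<open>1\<close>\<close>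
  have lim: "indicator U x \<le> liminf (\<lambda>k. (\<integral>\<^sup>+y. K k x y \<partial>N) / n k)" if x: "x \<in> S" for x
  proof (cases "x \<in> U")
    case True
    then obtain d where d: "d > 0" "ball (e x) d \<subseteq> V"
      using V open_contains_ball[of V] unfolding U_def by blast
    have "eventually (\<lambda>k. r k < d) sequentially" using rlim d(1) by (rule order_tendstoD)
    then have "eventually (\<lambda>k. 1 \<le> (\<integral>\<^sup>+y. K k x y \<partial>N) / n k) sequentially"
    proof eventually_elim
      case (elim k)
      have "(\<integral>\<^sup>+y. K k x y \<partial>N) = (\<integral>\<^sup>+y. indicator (mb x (r k)) y \<partial>N)"
      proof (intro nn_integral_cong)
        fix y assume "y \<in> space N"
        then show "K k x y = indicator (mb x (r k)) y"
          using True d(2) elim by (auto simp: K_def U_def mb_def spN indicator_def subset_eq)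
      qed
      also have "\<dots> = n k" using eqN[OF x, of k] by (simp add: mb_def[symmetric])
      finally show ?case using n0[of k] by (simp add: ennreal_divide_self top.not_eq_extremum)
    qed
    then have "1 \<le> liminf (\<lambda>k. (\<integral>\<^sup>+y. K k x y \<partial>N) / n k)" by (rule Liminf_bounded)
    then show ?thesis using True by simp
  qed simp
  have "emeasure M U = (\<integral>\<^sup>+x. indicator U x \<partial>M)" by simp
  also have "\<dots> \<le> (\<integral>\<^sup>+x. liminf (\<lambda>k. (\<integral>\<^sup>+y. K k x y \<partial>N) / n k) \<partial>M)"
    using lim by (intro nn_integral_mono) (auto simp: spM)
  also have "\<dots> \<le> liminf (\<lambda>k. \<integral>\<^sup>+x. (\<integral>\<^sup>+y. K k x y \<partial>N) / n k \<partial>M)"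
    using N.borel_measurable_nn_integral[OF Km] by (intro nn_integral_liminf) auto
  also have "\<dots> \<le> liminf (\<lambda>k. emeasure N U)"
    using outer by (intro Liminf_mono) auto
  also have "\<dots> = emeasure N U" by (simp add: Liminf_const)
  finally show ?thesis by (simp add: U_def)
qed

lemma open_measure_le_if_frequent_ball_le:
  fixes e :: "'a \<Rightarrow> 'b::{metric_space, second_countable_topology}"
  assumes "invariant_measure S e G M" and "invariant_measure S e G N"
    and x0: "x0 \<in> S"
    and inf: "infinite {j::nat. emeasure M {y \<in> S. dist (e x0) (e y) < 1 / real (Suc j)}
                         \<le> emeasure N {y \<in> S. dist (e x0) (e y) < 1 / real (Suc j)}}"
    and V: "open V"
  shows "emeasure M (e -` V \<inter> S) \<le> emeasure N (e -` V \<inter> S)"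
proof -
  interpret M: invariant_measure S e G M by (rule assms(1))
  interpret N: invariant_measure S e G N by (rule assms(2))
  obtain s :: "nat \<Rightarrow> nat" where s: "strict_mono s"
    and le: "\<And>k. emeasure M (M.mball x0 (1 / real (Suc (s k)))) \<le> emeasure N (N.mball x0 (1 / real (Suc (s k))))"
    using infinite_enumerate[OF inf] by (auto simp: M.mball_def N.mball_def)
  define r where "r k = 1 / real (Suc (s k))" for k
  have rlim: "r \<longlonglongrightarrow> 0"
    using LIMSEQ_subseq_LIMSEQ[OF LIMSEQ_inverse_real_of_nat s]
    by (simp add: r_def[abs_def] o_def inverse_eq_divide)
  show ?thesis
  proof (rule open_measure_le_if_balls_le[where r = r and n = "\<lambda>k. emeasure N (N.mball x0 (r k))", OF _ _ M.space_M N.space_M])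
    show "sigma_finite_measure M" "sigma_finite_measure N" ..
    show r0: "r k > 0" for k by (simp add: r_def)
    show "emeasure N (N.mball x0 (r k)) > 0" for k using N.mball_pos[OF x0 r0] .
    show "emeasure M {y \<in> S. dist (e x) (e y) < r k} \<le> emeasure N (N.mball x0 (r k))" if "x \<in> S" for k x
      using le[of k] M.mball_const[OF that x0, of "r k"] by (simp add: r_def M.mball_def N.mball_def)
    show "emeasure N {y \<in> S. dist (e x) (e y) < r k} = emeasure N (N.mball x0 (r k))" if "x \<in> S" for k x
      using N.mball_const[OF that x0, of "r k"] by (simp add: N.mball_def)
  qed (use rlim V in auto)
qed

text \<open>For probability measures an inequality on open sets reverses on closed sets, and an open set is an
  increasing union of closed sets.\<close>

lemma invariant_measure_eq_if_open_le:
  fixes e :: "'a \<Rightarrow> 'b::{metric_space, second_countable_topology}"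
  assumes "invariant_measure S e G M" and "invariant_measure S e G N"
    and le: "\<And>V. open V \<Longrightarrow> emeasure M (e -` V \<inter> S) \<le> emeasure N (e -` V \<inter> S)"
  shows "M = N"
proof -
  interpret M: invariant_measure S e G M by fact
  interpret N: invariant_measure S e G N by fact
  have sub: "emeasure N (e -` V \<inter> S) \<le> emeasure M (e -` V \<inter> S)" if V: "open V" for V
  proof -
    obtain C :: "nat \<Rightarrow> 'b set" where C: "\<And>n. closed (C n)" "\<And>n. C n \<subseteq> V" "incseq C" "\<Union>(range C) = V"
    proof (cases "V = UNIV")
      case True
      show thesis by (rule that[of "\<lambda>_. UNIV"]) (auto simp: True)
    next
      case False
      define C where "C n = {x. 1 / real (Suc n) \<le> infdist x (- V)}" for n
      show thesis
      proof (rule that[of C])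
        show "closed (C n)" for n
          unfolding C_def by (intro closed_Collect_le continuous_intros)
        show "C n \<subseteq> V" for n
        proof
          fix x assume "x \<in> C n"
          then have "0 < infdist x (- V)" by (simp add: C_def) (smt (verit) divide_pos_pos of_nat_0_le_iff)
          then show "x \<in> V" by (metis ComplI infdist_zero less_irrefl)
        qed
        then have "\<Union>(range C) \<subseteq> V" by blast
        moreover have "V \<subseteq> \<Union>(range C)"
        proof
          fix x assume "x \<in> V"
          then have "0 < infdist x (- V)" using V False
            by (intro infdist_pos_not_in_closed) auto
          then obtain n where "inverse (real (Suc n)) < infdist x (- V)" using reals_Archimedean by blast
          then show "x \<in> \<Union>(range C)" by (auto simp: C_def inverse_eq_divide intro!: exI[of _ n])
        qed
        ultimately show "\<Union>(range C) = V" by blast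
        show "incseq C"
          unfolding C_def incseq_def by (auto elim!: order_trans[rotated] intro!: divide_left_mono)
      qed
    qed
    have meas: "e -` C n \<inter> S \<in> sets M" "e -` C n \<inter> S \<in> sets N" for n
      using measurable_sets[OF M.e_measurable borel_closed[OF C(1)]]
        measurable_sets[OF N.e_measurable borel_closed[OF C(1)]] by (auto simp: M.space_M N.space_M)
    have CN: "emeasure N (e -` C n \<inter> S) \<le> emeasure M (e -` C n \<inter> S)" for n
    proof -
      have "space M - e -` C n \<inter> S = e -` (- C n) \<inter> S" "space N - e -` C n \<inter> S = e -` (- C n) \<inter> S"
        by (auto simp: M.space_M N.space_M)
      then have "measure M (e -` (- C n) \<inter> S) = 1 - measure M (e -` C n \<inter> S)"
        "measure N (e -` (- C n) \<inter> S) = 1 - measure N (e -` C n \<inter> S)"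
        using M.prob_compl[OF meas(1)[of n]] N.prob_compl[OF meas(2)[of n]] by simp_all
      then have "measure N (e -` C n \<inter> S) \<le> measure M (e -` C n \<inter> S)"
        using le[of "- C n"] C(1)[of n]
        by (simp add: M.emeasure_eq_measure N.emeasure_eq_measure open_Compl)
      then show ?thesis by (simp add: M.emeasure_eq_measure N.emeasure_eq_measure)
    qed
    have "e -` V \<inter> S = (\<Union>n. e -` C n \<inter> S)" using C(4) by auto
    also have "emeasure N \<dots> = (SUP n. emeasure N (e -` C n \<inter> S))"
      using meas C(3) by (intro SUP_emeasure_incseq[symmetric]) (auto simp: incseq_def subset_eq)
    also have "\<dots> \<le> emeasure M (e -` V \<inter> S)"
    proof (rule SUP_least)
      fix n
      have "e -` V \<inter> S \<in> sets M"
        using measurable_sets[OF M.e_measurable borel_open[OF V]] by (simp add: M.space_M)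
      then show "emeasure N (e -` C n \<inter> S) \<le> emeasure M (e -` V \<inter> S)"
        using CN[of n] C(2)[of n] by (intro order_trans[OF CN] emeasure_mono) auto
    qed
    finally show ?thesis .
  qed
  show ?thesis
  proof (rule measure_eqI_generator_eq[where E = "{U. openin (pullback_topology S e euclidean) U}" and \<Omega> = S and A = "\<lambda>_. S"])
    show "Int_stable {U. openin (pullback_topology S e euclidean) U}"
      by (auto simp: Int_stable_def)
    show "{U. openin (pullback_topology S e euclidean) U} \<subseteq> Pow S"
      using openin_subset[of "pullback_topology S e euclidean"] by auto
    show "sets M = sigma_sets S {U. openin (pullback_topology S e euclidean) U}"
      "sets N = sigma_sets S {U. openin (pullback_topology S e euclidean) U}"
      using M.sets_M N.sets_M by (simp_all add: sets_borel_of)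
    show "range (\<lambda>_. S) \<subseteq> {U. openin (pullback_topology S e euclidean) U}"
      by (auto simp: openin_pullback_topology intro!: exI[of _ UNIV])
  next
    fix X assume "X \<in> {U. openin (pullback_topology S e euclidean) U}"
    then show "emeasure M X = emeasure N X"
      using le sub by (auto simp: openin_pullback_topology intro!: antisym)
  qed auto
qed

text \<open>Among the radii \<open>1 / Suc j\<close>, either infinitely many have \<open>M\<close>-balls at most as large as the \<open>N\<close>-balls
  or infinitely many have the converse; a density argument along these radii compares the
  measures on open sets, and total mass \<open>1\<close> does the rest.  No Haar measure is involved, so the result also
  serves to prove that Haar measure is right invariant.\<close>

theorem invariant_measure_unique:
  assumes M: "invariant_measure S e G M" and N: "invariant_measure S e G N"
  shows "M = N"
proof -
  interpret M: invariant_measure S e G M by fact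
  interpret N: invariant_measure S e G N by fact
  obtain x0 where x0: "x0 \<in> S" using M.not_empty by (auto simp: M.space_M)
  define m where "m M j = emeasure M {y \<in> S. dist (e x0) (e y) < 1 / real (Suc j)}" for M j
  have "{j. m M j \<le> m N j} \<union> {j. m N j \<le> m M j} = UNIV" by auto
  then have "infinite {j. m M j \<le> m N j} \<or> infinite {j. m N j \<le> m M j}"
    by (metis finite_Un infinite_UNIV_nat)
  then show ?thesis
  proof
    assume i: "infinite {j. m M j \<le> m N j}"
    show ?thesis
      using invariant_measure_eq_if_open_le[OF M N open_measure_le_if_frequent_ball_le[OF M N x0 i[unfolded m_def]]] .
  next
    assume i: "infinite {j. m N j \<le> m M j}"
    show ?thesis
      using invariant_measure_eq_if_open_le[OF N M open_measure_le_if_frequent_ball_le[OF N M x0 i[unfolded m_def]]] by simp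
  qed
qed

text \<open>The pattern by which all invariant measures below arise: push a probability measure forward along a
  map that intertwines each \<open>g\<close> with a symmetry of the source.  Almost everywhere
  suffices, since normalizing a projected vector fails on a null set.\<close>

lemma invariant_measure_distr:
  fixes e :: "'a \<Rightarrow> 'b::{metric_space, second_countable_topology}" and S
  defines "B \<equiv> borel_of (pullback_topology S e euclidean)"
  assumes it: "isometric_transitive S e G" and P: "prob_space P" and T: "T \<in> measurable P B"
    and eq: "\<And>g. g \<in> G \<Longrightarrow> \<exists>a\<in>measurable P P. distr P P a = P \<and> (AE x in P. T (a x) = g (T x))"
  shows "invariant_measure S e G (distr P B T)"
proof (rule invariant_measure.intro)
  show "prob_space (distr P B T)" using P T by (rule prob_space.prob_space_distr)
  show "sets (distr P B T) = sets (borel_of (pullback_topology S e euclidean))" by (simp add: B_def)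
  fix g assume g: "g \<in> G"
  then obtain a where a: "a \<in> measurable P P" "distr P P a = P" "AE x in P. T (a x) = g (T x)"
    using eq by blast
  have gm: "g \<in> measurable B B"
    using isometric_transitive_measurable[OF it g] by (simp add: B_def)
  have "distr (distr P B T) (distr P B T) g = distr (distr P B T) B g"
    by (rule distr_cong) auto
  also have "\<dots> = distr P B (\<lambda>x. g (T x))"
    by (simp add: distr_distr gm T o_def)
  also have "\<dots> = distr P B (\<lambda>x. T (a x))"
    using a T gm by (intro distr_cong_AE) (auto intro: measurable_compose elim: eventually_mono)
  also have "\<dots> = distr (distr P P a) B T"
    by (subst distr_distr[OF T a(1)]) (simp add: o_def)
  finally show "distr (distr P B T) (distr P B T) g = distr P B T" using a(2) by simp
qed (rule it)

lemma invariant_prob_measure_eqI: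
  assumes "invariant_measure S e G M" and T: "T = pullback_topology S e euclidean"
  shows "invariant_prob_measure T G = M"
  unfolding invariant_prob_measure_def
proof (rule the_equality)
  interpret invariant_measure S e G M by fact
  show "sets M = sets (borel_of T) \<and> prob_space M \<and> (\<forall>g\<in>G. distr M M g = M)"
    using sets_M prob inv unfolding T by blast
  fix N assume "sets N = sets (borel_of T) \<and> prob_space N \<and> (\<forall>g\<in>G. distr N N g = N)"
  then have "invariant_measure S e G N" unfolding invariant_measure_def using it T by blast
  then show "N = M" using invariant_measure_unique assms by blast
qed

section \<open>Orthogonal matrices, orthogonal projections and reflections\<close>

subsection \<open>Orthogonal matrices\<close>

lemma orthogonal_matrix_inner:
  fixes A :: "real^'n^'n"
  assumes "orthogonal_matrix A"
  shows "(A *v x) \<bullet> (A *v y) = x \<bullet> y"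
  using assms by (metis orthogonal_matrix dot_lmul_matrix matrix_vector_mul_assoc matrix_vector_mul_lid transpose_matrix_vector transpose_transpose)

lemma orthogonal_matrix_norm:
  fixes A :: "real^'n^'n"
  assumes "orthogonal_matrix A"
  shows "norm (A *v x) = norm x"
  using orthogonal_matrix_inner[OF assms] by (simp add: norm_eq_sqrt_inner)

lemma orthogonal_matrix_cancel:
  fixes A :: "real^'n^'n"
  assumes "orthogonal_matrix A"
  shows "transpose A *v (A *v x) = x" "A *v (transpose A *v x) = x"
    "transpose A ** (A ** X) = X" "A ** (transpose A ** X) = X"
  using assms
  by (simp_all add: orthogonal_matrix_def matrix_vector_mul_assoc matrix_mul_assoc del: transpose_matrix_vector)

lemma orthogonal_matrixI_norm:
  fixes A :: "real^'n^'n"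
  assumes "\<And>x. norm (A *v x) = norm x"
  shows "orthogonal_matrix A"
proof -
  have "orthogonal_transformation ((*v) A)"
    using assms by (simp add: orthogonal_transformation matrix_vector_mul_linear)
  then show ?thesis by (simp add: orthogonal_transformation_matrix)
qed

lemma norm_matrix_eq_rows:
  fixes X :: "real^'n^'m"
  shows "(norm X)\<^sup>2 = (\<Sum>i\<in>UNIV. (norm (X $ i))\<^sup>2)"
  by (simp add: power2_norm_eq_inner inner_vec_def)

lemma norm_transpose_matrix:
  fixes X :: "real^'n^'m"
  shows "norm (transpose X) = norm X"
proof -
  have "(norm (transpose X))\<^sup>2 = (norm X)\<^sup>2"
    by (simp add: power2_norm_eq_inner inner_vec_def transpose_def) (rule sum.swap)
  then show ?thesis by simp
qed

lemma norm_orthogonal_matrix_mult_left: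
  fixes A X :: "real^'n^'n"
  assumes "orthogonal_matrix A"
  shows "norm (A ** X) = norm X"
proof -
  have row: "transpose (A ** X) $ i = A *v (transpose X $ i)" for i
    by (simp add: vec_eq_iff transpose_def matrix_matrix_mult_def matrix_vector_mult_def)
  have "(norm (transpose (A ** X)))\<^sup>2 = (norm (transpose X))\<^sup>2"
    unfolding norm_matrix_eq_rows row orthogonal_matrix_norm[OF assms] ..
  then show ?thesis by (simp add: norm_transpose_matrix)
qed

lemma norm_orthogonal_matrix_mult_right:
  fixes A X :: "real^'n^'n"
  assumes "orthogonal_matrix A"
  shows "norm (X ** A) = norm X"
  using norm_orthogonal_matrix_mult_left[of "transpose A" "transpose X"] assms
  by (metis matrix_transpose_mul norm_transpose_matrix orthogonal_matrix_transpose)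

lemma matrix_mult_diff_distrib:
  fixes A B C :: "real^'n^'n"
  shows "A ** (B - C) = A ** B - A ** C" "(B - C) ** A = B ** A - C ** A"
  by (simp_all add: vec_eq_iff matrix_matrix_mult_def sum_subtractf algebra_simps)

lemma orthogonal_matrix_conj_dist:
  fixes A X Y :: "real^'n^'n"
  assumes "orthogonal_matrix A"
  shows "dist (A ** X ** transpose A) (A ** Y ** transpose A) = dist X Y"
proof -
  have "A ** X ** transpose A - A ** Y ** transpose A = A ** (X - Y) ** transpose A"
    by (simp add: matrix_mult_diff_distrib)
  then show ?thesis
    using assms by (simp add: dist_norm norm_orthogonal_matrix_mult_left norm_orthogonal_matrix_mult_right)
qed

lemma inj_orthogonal_matrix:
  fixes A :: "real^'n^'n"
  assumes "orthogonal_matrix A"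
  shows "inj ((*v) A)"
  by (metis assms injI orthogonal_matrix_cancel(1))

lemma subspace_orthogonal_image:
  fixes A :: "real^'n^'n"
  shows "subspace \<xi> \<Longrightarrow> subspace ((*v) A ` \<xi>)"
  by (rule linear_subspace_image) auto

lemma dim_orthogonal_image:
  fixes A :: "real^'n^'n"
  assumes "orthogonal_matrix A"
  shows "dim ((*v) A ` \<xi>) = dim \<xi>"
  using dim_image_eq[OF matrix_vector_mul_linear] inj_orthogonal_matrix[OF assms] by (metis inj_on_subset subset_UNIV)

lemma orthogonal_image_eq_if_subset:
  fixes A :: "real^'n^'n"
  assumes "orthogonal_matrix A" "subspace \<xi>" "subspace \<zeta>" "dim \<xi> = dim \<zeta>" "\<And>x. x \<in> \<xi> \<Longrightarrow> A *v x \<in> \<zeta>"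
  shows "(*v) A ` \<xi> = \<zeta>"
  using assms by (intro subspace_dim_equal) (auto simp: subspace_orthogonal_image dim_orthogonal_image)

lemma image_matrix_mult: "(*v) (A ** B) ` \<xi> = (*v) A ` (*v) B ` \<xi>"
  by (auto simp: image_image matrix_vector_mul_assoc)

subsection \<open>Orthogonal projections\<close>

abbreviation proj_matrix :: "(real^'n) set \<Rightarrow> real^'n^'n" where
  "proj_matrix \<xi> \<equiv> matrix (closest_point \<xi>)"

text \<open>Makes the metric definition of the projection, on which the topology of the Grassmannian rests,
  accessible to linear algebra.\<close>

lemma closest_point_subspace_iff:
  fixes \<xi> :: "'a::euclidean_space set"
  assumes "subspace \<xi>"
  shows "closest_point \<xi> x = y \<longleftrightarrow> y \<in> \<xi> \<and> (\<forall>z\<in>\<xi>. (x - y) \<bullet> z = 0)"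
proof -
  obtain p q where p: "p \<in> \<xi>" and q: "\<And>w. w \<in> \<xi> \<Longrightarrow> q \<bullet> w = 0" and x: "x = p + q"
    using orthogonal_subspace_decomp_exists[of \<xi> x] assms by (metis orthogonal_def span_eq_iff)
  have cp: "closest_point \<xi> x = p"
  proof (rule closest_point_unique[symmetric])
    show "\<forall>z\<in>\<xi>. dist x p \<le> dist x z"
    proof
      fix z assume z: "z \<in> \<xi>"
      then have "q \<bullet> (p - z) = 0" using q p assms by (simp add: subspace_diff)
      then have "norm (q + (p - z)) ^ 2 = norm q ^ 2 + norm (p - z) ^ 2"
        by (simp add: power2_norm_eq_inner inner_add_left inner_add_right inner_commute)
      then have "norm q \<le> norm (q + (p - z))"
        by (metis le_add_same_cancel1 norm_ge_zero power2_le_imp_le zero_le_power2)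
      then show "dist x p \<le> dist x z" by (simp add: dist_norm x algebra_simps)
    qed
  qed (use p assms in \<open>auto simp: subspace_imp_convex closed_subspace\<close>)
  show ?thesis
  proof
    assume "closest_point \<xi> x = y"
    then show "y \<in> \<xi> \<and> (\<forall>z\<in>\<xi>. (x - y) \<bullet> z = 0)" using cp p q x by auto
  next
    assume y: "y \<in> \<xi> \<and> (\<forall>z\<in>\<xi>. (x - y) \<bullet> z = 0)"
    then have "y - p \<in> \<xi>" using p assms by (simp add: subspace_diff)
    then have "q \<bullet> (y - p) = 0" "(x - y) \<bullet> (y - p) = 0" using y q by auto
    then have "(y - p) \<bullet> (y - p) = 0" by (simp add: x algebra_simps)
    then show "closest_point \<xi> x = y" using cp by simp
  qed
qed

lemma closest_point_in_subspace:
  fixes \<xi> :: "'a::euclidean_space set"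
  assumes "subspace \<xi>"
  shows "closest_point \<xi> x \<in> \<xi>"
  using closest_point_subspace_iff[OF assms] by blast

lemma inner_closest_point_subspace:
  fixes \<xi> :: "'a::euclidean_space set"
  assumes "subspace \<xi>" "z \<in> \<xi>"
  shows "closest_point \<xi> x \<bullet> z = x \<bullet> z"
  using closest_point_subspace_iff[OF assms(1), of x "closest_point \<xi> x"] assms(2)
  by (simp add: inner_diff_left)

lemma linear_closest_point:
  fixes \<xi> :: "'a::euclidean_space set"
  assumes "subspace \<xi>"
  shows "linear (closest_point \<xi>)"
proof
  fix x y :: 'a and c :: real
  show "closest_point \<xi> (x + y) = closest_point \<xi> x + closest_point \<xi> y"
    unfolding closest_point_subspace_iff[OF assms] using assms
    by (auto simp: subspace_add closest_point_in_subspace inner_closest_point_subspace inner_diff_left inner_add_left)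
  show "closest_point \<xi> (c *\<^sub>R x) = c *\<^sub>R closest_point \<xi> x"
    unfolding closest_point_subspace_iff[OF assms] using assms
    by (auto simp: subspace_scale closest_point_in_subspace inner_closest_point_subspace inner_diff_left)
qed

lemma proj_matrix_mult:
  assumes "subspace \<xi>"
  shows "proj_matrix \<xi> *v x = closest_point \<xi> x"
  using linear_closest_point[OF assms] matrix_works[of "closest_point \<xi>" x] by (simp add: linear_matrix_vector_mul_eq)

lemma closest_point_subspace_self_iff:
  fixes \<xi> :: "'a::euclidean_space set"
  assumes "subspace \<xi>"
  shows "closest_point \<xi> x = x \<longleftrightarrow> x \<in> \<xi>"
  using closest_point_subspace_iff[OF assms, of x x] by auto

lemma matrix_eqI_mult: "(\<And>x. A *v x = B *v x) \<Longrightarrow> A = (B :: real^'n^'m)"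
  by (simp add: matrix_eq)

text \<open>The action on subspaces becomes conjugation of matrices, an isometry for the Euclidean norm of
  matrix entries.\<close>

lemma proj_matrix_orthogonal_image:
  fixes A :: "real^'n^'n"
  assumes A: "orthogonal_matrix A" and \<xi>: "subspace \<xi>"
  shows "proj_matrix ((*v) A ` \<xi>) = A ** proj_matrix \<xi> ** transpose A"
proof (rule matrix_eqI_mult)
  fix x
  have "closest_point ((*v) A ` \<xi>) x = A *v closest_point \<xi> (transpose A *v x)"
    unfolding closest_point_subspace_iff[OF subspace_orthogonal_image[OF \<xi>]]
  proof safe
    show "A *v closest_point \<xi> (transpose A *v x) \<in> (*v) A ` \<xi>"
      using closest_point_in_subspace[OF \<xi>] by blast
    fix z assume z: "z \<in> \<xi>"
    have "x \<bullet> (A *v z) = (transpose A *v x) \<bullet> z"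
      by (metis A orthogonal_matrix_cancel(2) orthogonal_matrix_inner)
    then show "(x - A *v closest_point \<xi> (transpose A *v x)) \<bullet> (A *v z) = 0"
      using z A \<xi> by (simp add: inner_diff_left orthogonal_matrix_inner inner_closest_point_subspace)
  qed
  then show "proj_matrix ((*v) A ` \<xi>) *v x = A ** proj_matrix \<xi> ** transpose A *v x"
    using \<xi> by (simp add: proj_matrix_mult subspace_orthogonal_image matrix_vector_mul_assoc[symmetric])
qed

lemma proj_matrix_orthogonal_comp:
  fixes \<xi> :: "(real^'n) set"
  assumes \<xi>: "subspace \<xi>"
  shows "proj_matrix (\<xi>\<^sup>\<bottom>) = mat 1 - proj_matrix \<xi>"
proof (rule matrix_eqI_mult)
  fix x
  have "closest_point (\<xi>\<^sup>\<bottom>) x = x - closest_point \<xi> x"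
    unfolding closest_point_subspace_iff[OF subspace_orthogonal_comp]
    using \<xi> inner_closest_point_subspace[OF \<xi>] closest_point_in_subspace[OF \<xi>]
    by (auto simp: orthogonal_comp_def orthogonal_def inner_diff_left inner_diff_right)
      (metis inner_commute)
  then show "proj_matrix (\<xi>\<^sup>\<bottom>) *v x = (mat 1 - proj_matrix \<xi>) *v x"
    using \<xi> by (simp add: proj_matrix_mult subspace_orthogonal_comp matrix_vector_mult_diff_rdistrib)
qed

lemma dim_orthogonal_comp:
  fixes \<xi> :: "(real^'n) set"
  assumes "subspace \<xi>"
  shows "dim (\<xi>\<^sup>\<bottom>) = CARD('n) - dim \<xi>"
proof -
  have "\<xi>\<^sup>\<bottom> = {y \<in> UNIV. \<forall>x\<in>\<xi>. orthogonal x y}" by (auto simp: orthogonal_comp_def)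
  then have "dim (\<xi>\<^sup>\<bottom>) + dim \<xi> = CARD('n)"
    using dim_subspace_orthogonal_to_vectors[OF assms, of UNIV] by simp
  then show ?thesis by simp
qed

lemma orthogonal_comp_orthogonal_image:
  fixes A :: "real^'n^'n"
  assumes A: "orthogonal_matrix A"
  shows "((*v) A ` \<xi>)\<^sup>\<bottom> = (*v) A ` (\<xi>\<^sup>\<bottom>)"
proof safe
  fix x assume x: "x \<in> ((*v) A ` \<xi>)\<^sup>\<bottom>"
  have "transpose A *v x \<in> \<xi>\<^sup>\<bottom>"
    unfolding orthogonal_comp_def orthogonal_def
  proof safe
    fix y assume "y \<in> \<xi>"
    then have "(A *v y) \<bullet> x = 0" using x by (auto simp: orthogonal_comp_def orthogonal_def)
    then show "y \<bullet> (transpose A *v x) = 0"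
      by (metis A orthogonal_matrix_cancel(2) orthogonal_matrix_inner)
  qed
  then show "x \<in> (*v) A ` (\<xi>\<^sup>\<bottom>)" using orthogonal_matrix_cancel(2)[OF A, of x] by (metis imageI)
next
  fix x assume "x \<in> \<xi>\<^sup>\<bottom>"
  then show "A *v x \<in> ((*v) A ` \<xi>)\<^sup>\<bottom>"
    by (auto simp: orthogonal_comp_def orthogonal_def orthogonal_matrix_inner[OF A])
qed

subsection \<open>Reflections\<close>

text \<open>The matrix of the reflection in the hyperplane orthogonal to \<open>v\<close>.  For \<open>v = 0\<close> the quotient is \<open>0\<close> and
  the matrix is the identity, so that \<open>householder (u - v)\<close> moves \<open>u\<close> to \<open>v\<close> also if \<open>u = v\<close>.\<close>

definition householder :: "real^'n \<Rightarrow> real^'n^'n" where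
  "householder v = (\<chi> i j. (if i = j then 1 else 0) - 2 * (v $ i * v $ j) / (v \<bullet> v))"

lemma householder_mult: "householder v *v x = x - (2 * (v \<bullet> x) / (v \<bullet> v)) *\<^sub>R v"
proof -
  have "(householder v *v x) $ i = (x - (2 * (v \<bullet> x) / (v \<bullet> v)) *\<^sub>R v) $ i" for i
  proof -
    have "(householder v *v x) $ i = (\<Sum>j\<in>UNIV. (if i = j then x $ j else 0) - (2 / (v \<bullet> v) * v $ i) * (v $ j * x $ j))"
      by (auto simp: householder_def matrix_vector_mult_def algebra_simps intro!: sum.cong)
    also have "\<dots> = x $ i - (2 / (v \<bullet> v) * v $ i) * (\<Sum>j\<in>UNIV. v $ j * x $ j)"
      by (simp add: sum_subtractf sum_distrib_left)
    also have "(\<Sum>j\<in>UNIV. v $ j * x $ j) = v \<bullet> x" by (simp add: inner_vec_def)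
    finally show ?thesis by simp
  qed
  then show ?thesis by (simp add: vec_eq_iff)
qed

lemma orthogonal_householder: "orthogonal_matrix (householder v)"
proof (rule orthogonal_matrixI_norm)
  fix x
  have "(householder v *v x) \<bullet> (householder v *v x) = x \<bullet> x"
  proof (cases "v = 0")
    case False
    then have "v \<bullet> v \<noteq> 0" by simp
    then show ?thesis
      by (simp add: householder_mult inner_diff_left inner_diff_right inner_commute field_simps)
  qed (simp add: householder_mult)
  then show "norm (householder v *v x) = norm x" by (simp add: norm_eq_sqrt_inner)
qed

lemma householder_fix: "v \<bullet> x = 0 \<Longrightarrow> householder v *v x = x"
  by (simp add: householder_mult)

lemma householder_swap:
  assumes "norm u = norm v"
  shows "householder (u - v) *v u = v" "householder (u - v) *v v = u"
proof -
  have uv: "u \<bullet> u = v \<bullet> v" using assms by (simp add: norm_eq)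
  have "householder (u - v) *v u = v \<and> householder (u - v) *v v = u"
  proof (cases "u = v")
    case False
    then have nz: "(u - v) \<bullet> (u - v) \<noteq> 0" by simp
    have e: "(u - v) \<bullet> (u - v) = 2 * ((u - v) \<bullet> u)" "(u - v) \<bullet> (u - v) = - 2 * ((u - v) \<bullet> v)"
      using uv by (simp_all add: inner_diff_left inner_diff_right inner_commute)
    have "2 * ((u - v) \<bullet> u) / ((u - v) \<bullet> (u - v)) = 1" using nz e(1) by (metis divide_self)
    moreover have "2 * ((u - v) \<bullet> v) / ((u - v) \<bullet> (u - v)) = - 1"
    proof -
      have "2 * ((u - v) \<bullet> v) = - ((u - v) \<bullet> (u - v))" using e(2) by linarith
      then show ?thesis using nz by (metis divide_minus_left divide_self)
    qed
    ultimately have "householder (u - v) *v u = u - 1 *\<^sub>R (u - v)" "householder (u - v) *v v = v - (- 1) *\<^sub>R (u - v)"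
      unfolding householder_mult by metis+
    then show ?thesis by simp
  qed (simp add: householder_mult)
  then show "householder (u - v) *v u = v" "householder (u - v) *v v = u" by auto
qed

text \<open>This equivariance is the reason for using reflections to move one unit vector to another: the
  reflection depends on the two vectors measurably and compatibly with the orthogonal group.\<close>

lemma householder_conj:
  assumes A: "orthogonal_matrix A"
  shows "householder (A *v v) ** A = A ** householder v"
  by (rule matrix_eqI_mult)
    (simp add: matrix_vector_mul_assoc[symmetric] householder_mult orthogonal_matrix_inner[OF A]
      matrix_vector_mult_diff_distrib matrix_vector_mult_scaleR)

lemma householder_involution: "householder v ** householder v = mat 1"
proof (rule matrix_eqI_mult)
  fix x
  have t: "v \<bullet> v = 0 \<Longrightarrow> v = 0" by simp
  show "householder v ** householder v *v x = mat 1 *v x"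
    by (cases "v = 0") (auto simp: matrix_vector_mul_assoc[symmetric] householder_mult inner_diff_right
        field_simps scaleR_left_diff_distrib[symmetric] scaleR_diff_right)
qed

lemma det_householder:
  assumes "v \<noteq> 0"
  shows "det (householder v) = - 1"
proof -
  obtain k :: 'a where True by blast
  obtain A where A: "orthogonal_matrix A" "A *v axis k 1 = v /\<^sub>R norm v"
    using orthogonal_matrix_exists_basis[of "v /\<^sub>R norm v" k] assms by auto
  have "householder (v /\<^sub>R norm v) = householder v"
    by (rule matrix_eqI_mult) (use assms in \<open>simp add: householder_mult\<close>)
  then have "householder v ** A = A ** householder (axis k 1)"
    using householder_conj[OF A(1), of "axis k 1"] A(2) by simp
  then have "det (householder v) * det A = det A * det (householder (axis k (1::real)))"
    by (metis det_mul)
  moreover have "det A \<noteq> 0" using det_orthogonal_matrix[OF A(1)] by auto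
  ultimately have "det (householder v) = det (householder (axis k (1::real)))" by simp
  also have "\<dots> = (\<Prod>i\<in>UNIV. householder (axis k (1::real)) $ i $ i)"
    by (rule det_diagonal) (auto simp: householder_def axis_def)
  also have "\<dots> = (\<Prod>i\<in>UNIV. if i = k then - 1 else 1)"
    by (intro prod.cong) (auto simp: householder_def axis_def inner_axis_axis[unfolded axis_def])
  also have "\<dots> = - 1" by (simp add: prod.delta)
  finally show ?thesis .
qed

text \<open>Orthogonal matrices are easier to construct than rotations; a reflection that does no
  harm repairs the determinant.\<close>

lemma rotation_or_reflected:
  assumes "orthogonal_matrix A" "v \<noteq> 0"
  shows "rotation_matrix A \<or> rotation_matrix (A ** householder v)"
  using assms det_orthogonal_matrix[OF assms(1)]
  by (auto simp: rotation_matrix_def det_mul det_householder orthogonal_matrix_mul orthogonal_householder)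

subsection \<open>Exchanging two subspaces\<close>

text \<open>A unit vector of \<open>\<xi>\<close> that maximizes the inner product with \<open>y\<close> is, up to a factor, the projection of \<open>y\<close>
  to \<open>\<xi>\<close>, which differs from \<open>y\<close> by a vector orthogonal to \<open>\<xi>\<close>.\<close>

lemma principal_vector_orthogonal:
  fixes \<xi> :: "'a::euclidean_space set"
  assumes \<xi>: "subspace \<xi>" and x: "x \<in> \<xi>" "norm x = 1"
    and max: "\<And>u. u \<in> \<xi> \<Longrightarrow> norm u = 1 \<Longrightarrow> u \<bullet> y \<le> x \<bullet> y"
    and z: "z \<in> \<xi>" "x \<bullet> z = 0"
  shows "y \<bullet> z = 0"
proof (cases "closest_point \<xi> y = 0")
  case True
  then show ?thesis using inner_closest_point_subspace[OF \<xi> z(1), of y] by simp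
next
  case False
  define p where "p = closest_point \<xi> y"
  have pi: "p \<in> \<xi>" and p: "u \<bullet> p = u \<bullet> y" if "u \<in> \<xi>" for u
    using closest_point_in_subspace[OF \<xi>] inner_closest_point_subspace[OF \<xi> that]
    by (auto simp: p_def inner_commute)
  have pxi: "p \<in> \<xi>" using pi x by blast
  have "norm p = (p /\<^sub>R norm p) \<bullet> p"
    using False by (simp add: p_def dot_square_norm power2_eq_square)
  also have "\<dots> \<le> x \<bullet> p"
    using max[of "p /\<^sub>R norm p"] p[of "p /\<^sub>R norm p"] p[OF x(1)] pxi \<xi> False
    by (simp add: subspace_scale p_def)
  finally have "x \<bullet> p = norm x * norm p" using norm_cauchy_schwarz[of x p] x(2) by simp
  then have "p = norm p *\<^sub>R x" using x(2) norm_cauchy_schwarz_eq[of x p] by simp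
  then have "z \<bullet> p = 0" using z(2) by (metis inner_commute inner_scaleR_right mult_zero_right)
  then show ?thesis using p[OF z(1)] by (simp add: inner_commute)
qed

lemma unit_vector_in_subspace:
  fixes \<eta> :: "'a::euclidean_space set"
  assumes "subspace \<eta>" "0 < dim \<eta>"
  shows "\<exists>u\<in>\<eta>. norm u = 1"
proof -
  have "\<not> \<eta> \<subseteq> {0}" using assms by (metis dim_eq_0 not_gr_zero)
  then obtain w where w: "w \<in> \<eta>" "w \<noteq> 0" by blast
  then show ?thesis
    using assms by (intro bexI[of _ "w /\<^sub>R norm w"]) (auto simp: subspace_scale)
qed

text \<open>Induction along principal vectors.  Unit vectors \<open>x \<in> \<xi>\<close> and \<open>y \<in> \<zeta>\<close> with maximal inner product are both
  orthogonal to the remaining parts \<open>\<xi>' = \<xi> \<inter> x\<^sup>\<bottom>\<close> and \<open>\<zeta>' = \<zeta> \<inter> y\<^sup>\<bottom>\<close>.  The exchange of these parts given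
  by induction fixes \<open>x\<close> and \<open>y\<close>, and the reflection that exchanges \<open>x\<close> and \<open>y\<close> fixes \<open>\<xi>'\<close> and \<open>\<zeta>'\<close>; their product is
  the required matrix.  The clause on fixed vectors is what makes the induction work, and it later
  gives exchanges that fix a common vector of both subspaces.\<close>

lemma subspaces_exchangeable:
  fixes \<xi> \<zeta> :: "(real^'n) set"
  assumes "subspace \<xi>" "subspace \<zeta>" "dim \<xi> = k" "dim \<zeta> = k"
  shows "\<exists>A. orthogonal_matrix A \<and> (*v) A ` \<xi> = \<zeta> \<and> (*v) A ` \<zeta> = \<xi> \<and>
           (\<forall>x. (\<forall>y\<in>\<xi>. x \<bullet> y = 0) \<longrightarrow> (\<forall>y\<in>\<zeta>. x \<bullet> y = 0) \<longrightarrow> A *v x = x)"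
  using assms
proof (induction k arbitrary: \<xi> \<zeta>)
  case 0
  then have "\<xi> = {0}" "\<zeta> = {0}" using subspace_0 by (auto simp: dim_eq_0)
  then show ?case by (intro exI[of _ "mat 1"]) (auto simp: orthogonal_matrix_id)
next
  case (Suc k)
  define P where "P = (sphere 0 1 \<inter> \<xi>) \<times> (sphere 0 1 \<inter> \<zeta>)"
  have ex: "\<exists>u. u \<in> sphere 0 1 \<inter> \<eta>" if "subspace \<eta>" "dim \<eta> = Suc k" for \<eta> :: "(real^'n) set"
    using unit_vector_in_subspace[of \<eta>] that by auto
  have "compact P"
    unfolding P_def using Suc.prems by (intro compact_Times compact_Int_closed) (auto simp: closed_subspace)
  moreover have "P \<noteq> {}" using ex[OF Suc.prems(1,3)] ex[OF Suc.prems(2,4)] unfolding P_def by blast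
  moreover have "continuous_on P (\<lambda>p. fst p \<bullet> snd p)" by (intro continuous_intros)
  ultimately have "\<exists>p\<in>P. \<forall>q\<in>P. fst q \<bullet> snd q \<le> fst p \<bullet> snd p"
    by (rule continuous_attains_sup)
  then obtain p where p: "p \<in> P" and pmax: "\<And>q. q \<in> P \<Longrightarrow> fst q \<bullet> snd q \<le> fst p \<bullet> snd p"
    by blast
  obtain x y where xy: "p = (x, y)" by (cases p)
  have x: "x \<in> \<xi>" "norm x = 1" and y: "y \<in> \<zeta>" "norm y = 1" using p xy by (auto simp: P_def)
  have max1: "u \<bullet> y \<le> x \<bullet> y" if "u \<in> \<xi>" "norm u = 1" for u
    using pmax[of "(u, y)"] that y by (simp add: P_def xy)
  have max2: "u \<bullet> x \<le> y \<bullet> x" if "u \<in> \<zeta>" "norm u = 1" for u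
    using pmax[of "(x, u)"] that x by (simp add: P_def xy inner_commute)
  have o1: "y \<bullet> z = 0" if "z \<in> \<xi>" "x \<bullet> z = 0" for z
    using principal_vector_orthogonal[OF Suc.prems(1) x max1 that] .
  have o2: "x \<bullet> z = 0" if "z \<in> \<zeta>" "y \<bullet> z = 0" for z
    using principal_vector_orthogonal[OF Suc.prems(2) y max2 that] .
  define \<xi>' where "\<xi>' = {z \<in> \<xi>. \<forall>w\<in>span {x}. orthogonal w z}"
  define \<zeta>' where "\<zeta>' = {z \<in> \<zeta>. \<forall>w\<in>span {y}. orthogonal w z}"
  have xi': "z \<in> \<xi>' \<longleftrightarrow> z \<in> \<xi> \<and> x \<bullet> z = 0" for z
    by (auto simp: \<xi>'_def orthogonal_def span_singleton)
  have zeta': "z \<in> \<zeta>' \<longleftrightarrow> z \<in> \<zeta> \<and> y \<bullet> z = 0" for z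
    by (auto simp: \<zeta>'_def orthogonal_def span_singleton)
  have sub: "subspace \<xi>'" "subspace \<zeta>'"
    using Suc.prems(1,2) unfolding subspace_def by (auto simp: xi' zeta' inner_add_right)
  have d1: "dim (span {x}) = 1" "dim (span {y}) = 1"
    using x(2) y(2) by (auto simp: dim_span) 
  have "dim \<xi>' = k" "dim \<zeta>' = k"
    using dim_subspace_orthogonal_to_vectors[of "span {x}" \<xi>] dim_subspace_orthogonal_to_vectors[of "span {y}" \<zeta>]
      Suc.prems x y d1 by (auto simp: \<xi>'_def \<zeta>'_def span_minimal)
  from Suc.IH[OF sub this] obtain B where B: "orthogonal_matrix B" "(*v) B ` \<xi>' = \<zeta>'" "(*v) B ` \<zeta>' = \<xi>'"
    and Bfix: "\<And>x. (\<forall>y\<in>\<xi>'. x \<bullet> y = 0) \<Longrightarrow> (\<forall>y\<in>\<zeta>'. x \<bullet> y = 0) \<Longrightarrow> B *v x = x" by blast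
  define A where "A = householder (x - y) ** B"
  have A: "orthogonal_matrix A" by (simp add: A_def B orthogonal_matrix_mul orthogonal_householder)
  have Bx: "B *v x = x" by (rule Bfix) (auto simp: xi' zeta' o2)
  have By: "B *v y = y" by (rule Bfix) (auto simp: xi' zeta' o1)
  have Axy: "A *v x = y" "A *v y = x"
    using householder_swap[of x y] x y by (simp_all add: A_def matrix_vector_mul_assoc[symmetric] Bx By)
  have A': "A *v z = B *v z" if "z \<in> \<xi>' \<or> z \<in> \<zeta>'" for z
  proof -
    have "B *v z \<in> \<xi>' \<or> B *v z \<in> \<zeta>'" using that B by blast
    then have "(x - y) \<bullet> (B *v z) = 0" by (auto simp: xi' zeta' o1 o2 inner_diff_left)
    then show ?thesis by (simp add: A_def matrix_vector_mul_assoc[symmetric] householder_fix)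
  qed
  have "A *v z \<in> \<zeta>" if z: "z \<in> \<xi>" for z
  proof -
    have "z - (x \<bullet> z) *\<^sub>R x \<in> \<xi>'"
      using z x Suc.prems(1) by (simp add: xi' subspace_diff subspace_scale inner_diff_right dot_square_norm)
    then have "A *v (z - (x \<bullet> z) *\<^sub>R x) \<in> \<zeta>" using A' B(2) zeta' by auto
    then have "A *v z - (x \<bullet> z) *\<^sub>R y \<in> \<zeta>"
      by (simp add: matrix_vector_mult_diff_distrib matrix_vector_mult_scaleR Axy)
    then show ?thesis using y(1) Suc.prems(2) by (metis diff_add_cancel subspace_add subspace_scale)
  qed
  then have 1: "(*v) A ` \<xi> = \<zeta>" using A Suc.prems by (intro orthogonal_image_eq_if_subset) auto
  have "A *v z \<in> \<xi>" if z: "z \<in> \<zeta>" for z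
  proof -
    have "z - (y \<bullet> z) *\<^sub>R y \<in> \<zeta>'"
      using z y Suc.prems(2) by (simp add: zeta' subspace_diff subspace_scale inner_diff_right dot_square_norm)
    then have "A *v (z - (y \<bullet> z) *\<^sub>R y) \<in> \<xi>" using A' B(3) xi' by auto
    then have "A *v z - (y \<bullet> z) *\<^sub>R x \<in> \<xi>"
      by (simp add: matrix_vector_mult_diff_distrib matrix_vector_mult_scaleR Axy)
    then show ?thesis using x(1) Suc.prems(1) by (metis diff_add_cancel subspace_add subspace_scale)
  qed
  then have 2: "(*v) A ` \<zeta> = \<xi>" using A Suc.prems by (intro orthogonal_image_eq_if_subset) auto
  have "A *v w = w" if "\<forall>z\<in>\<xi>. w \<bullet> z = 0" "\<forall>z\<in>\<zeta>. w \<bullet> z = 0" for w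
  proof -
    have "B *v w = w" by (rule Bfix) (use that xi' zeta' in auto)
    moreover have "w \<bullet> x = 0" "w \<bullet> y = 0" using that x y by auto
    then have "(x - y) \<bullet> w = 0" by (metis diff_self inner_commute inner_diff_right)
    ultimately show ?thesis by (simp add: A_def matrix_vector_mul_assoc[symmetric] householder_fix)
  qed
  then show ?case using A 1 2 by blast
qed

section \<open>Haar measure on the orthogonal group\<close>

subsection \<open>Borel measurability of matrix operations\<close>

lemma borel_measurable_vec_lambda [measurable (raw)]:
  fixes f :: "'i::finite \<Rightarrow> 'a \<Rightarrow> 'b::euclidean_space"
  assumes "\<And>i. f i \<in> borel_measurable M"
  shows "(\<lambda>x. \<chi> i. f i x) \<in> borel_measurable M"
proof -
  have eq: "(\<lambda>x. \<chi> i. f i x) = (\<lambda>x. \<Sum>i\<in>UNIV. axis i (f i x))"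
    by (simp add: fun_eq_iff vec_eq_iff axis_def sum.delta if_distrib cong: if_cong)
  have "(\<lambda>x. axis i (f i x)) \<in> borel_measurable M" for i
  proof -
    have "continuous_on UNIV (\<lambda>y::'b. \<chi> j. if j = i then y else 0)"
    proof (intro continuous_on_vec_lambda)
      show "continuous_on UNIV (\<lambda>y::'b. if j = i then y else 0)" for j :: 'i
        by (cases "j = i") (simp_all add: continuous_on_id)
    qed
    then have "(axis i :: 'b \<Rightarrow> 'b^'i) \<in> borel_measurable borel"
      unfolding axis_def[abs_def] by (rule borel_measurable_continuous_onI)
    then show ?thesis using assms by (rule measurable_compose[rotated])
  qed
  then show ?thesis unfolding eq by simp
qed

lemma borel_measurable_vec_nth [measurable (raw)]:
  fixes f :: "'a \<Rightarrow> 'b::euclidean_space^'i"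
  assumes "f \<in> borel_measurable M"
  shows "(\<lambda>x. f x $ i) \<in> borel_measurable M"
proof -
  have "(\<lambda>y::'b^'i. y $ i) \<in> borel_measurable borel"
    by (intro borel_measurable_continuous_onI continuous_intros)
  then show ?thesis using assms by (rule measurable_compose[rotated])
qed

lemma borel_measurable_matrix_mult [measurable (raw)]:
  fixes f g :: "'a \<Rightarrow> real^'n^'n"
  assumes [measurable]: "f \<in> borel_measurable M" "g \<in> borel_measurable M"
  shows "(\<lambda>x. f x ** g x) \<in> borel_measurable M"
  unfolding matrix_matrix_mult_def by measurable

lemma borel_measurable_matrix_vector_mult [measurable (raw)]:
  fixes f :: "'a \<Rightarrow> real^'n^'n"
  assumes [measurable]: "f \<in> borel_measurable M" "g \<in> borel_measurable M"
  shows "(\<lambda>x. f x *v g x) \<in> borel_measurable M"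
  unfolding matrix_vector_mult_def by measurable

lemma borel_measurable_transpose [measurable (raw)]:
  fixes f :: "'a \<Rightarrow> real^'n^'n"
  assumes [measurable]: "f \<in> borel_measurable M"
  shows "(\<lambda>x. transpose (f x)) \<in> borel_measurable M"
  unfolding transpose_def by measurable

lemma borel_measurable_householder [measurable (raw)]:
  fixes f :: "'a \<Rightarrow> real^'n"
  assumes [measurable]: "f \<in> borel_measurable M"
  shows "(\<lambda>x. householder (f x)) \<in> borel_measurable M"
  unfolding householder_def by measurable

subsection \<open>The uniform measure on the unit ball\<close>

text \<open>The image measure gives every ball its Lebesgue measure, and measures that agree on small balls
  agree on open sets.\<close>

lemma distr_lborel_orthogonal:
  fixes A :: "real^'n^'n"
  assumes A: "orthogonal_matrix A"
  shows "distr lborel borel ((*v) A) = lborel"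
proof -
  define M where "M = distr lborel borel ((*v) A)"
  have meas: "(*v) A \<in> borel_measurable lborel" by measurable
  have sM: "sets M = sets borel" "space M = UNIV" by (simp_all add: M_def)
  have ball: "emeasure M (ball x r) = emeasure lborel (ball (0::real^'n) r)" if "r \<ge> 0" for x :: "real^'n" and r
  proof -
    have "dist x (A *v y) = dist (transpose A *v x) y" for y
      by (metis A dist_norm matrix_vector_mult_diff_distrib orthogonal_matrix_cancel(2) orthogonal_matrix_norm)
    then have "(*v) A -` ball x r = ball (transpose A *v x) r" by (simp add: set_eq_iff)
    then show ?thesis using that meas by (simp add: M_def emeasure_distr emeasure_ball)
  qed
  have sfM: "sigma_finite_measure M"
  proof
    show "\<exists>F. countable F \<and> F \<subseteq> sets M \<and> \<Union>F = space M \<and> (\<forall>a\<in>F. emeasure M a \<noteq> \<infinity>)"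
      by (rule exI[of _ "range (\<lambda>n::nat. ball 0 (real n))"])
        (auto simp: sM ball emeasure_ball real_arch_simple intro: reals_Archimedean2)
  qed
  define r where "r k = 1 / real (Suc k)" for k
  have r: "r k > 0" "r \<longlonglongrightarrow> 0" for k
    using LIMSEQ_inverse_real_of_nat by (simp_all add: r_def[abs_def] inverse_eq_divide)
  have n: "emeasure lborel (ball (0::real^'n) (r k)) > 0" "emeasure lborel (ball (0::real^'n) (r k)) \<noteq> \<infinity>" for k
    using r(1)[of k] by (auto simp: emeasure_ball unit_ball_vol_pos)
  have bl: "{y \<in> UNIV. dist x y < \<rho>} = ball x \<rho>" for x :: "real^'n" and \<rho> by auto
  have lball: "emeasure lborel (ball x (r k)) = emeasure lborel (ball (0::real^'n) (r k))" for x :: "real^'n" and k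
    using r(1)[of k] by (simp add: emeasure_ball)
  have mball: "emeasure M (ball x (r k)) = emeasure lborel (ball (0::real^'n) (r k))" for x :: "real^'n" and k
    using r(1)[of k] by (simp add: ball)
  have id: "(\<lambda>x. x) \<in> borel_measurable M" by (simp add: sM measurable_def)
  have le: "emeasure M' V \<le> emeasure N' V"
    if "sigma_finite_measure M'" "sigma_finite_measure N'" "space M' = UNIV" "space N' = UNIV"
      "(\<lambda>x. x) \<in> borel_measurable M'" "(\<lambda>x. x) \<in> borel_measurable N'"
      and b: "\<And>x k. emeasure M' (ball x (r k)) = emeasure lborel (ball (0::real^'n) (r k))"
        "\<And>x k. emeasure N' (ball x (r k)) = emeasure lborel (ball (0::real^'n) (r k))"
      and V: "open V" for M' N' :: "(real^'n) measure" and V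
  proof -
    have "emeasure M' ((\<lambda>x. x) -` V \<inter> UNIV) \<le> emeasure N' ((\<lambda>x. x) -` V \<inter> UNIV)"
      by (rule open_measure_le_if_balls_le[OF that(1-6) r(1) r(2) n(1) n(2) _ _ V]; simp only: bl b order_refl)
    then show ?thesis by simp
  qed
  have open_eq: "emeasure M V = emeasure lborel V" if V: "open V" for V :: "(real^'n) set"
    by (intro antisym le sfM lborel.sigma_finite_measure_axioms id mball lball V) (simp_all add: sM)
  have "M = lborel"
  proof (rule measure_eqI_generator_eq[where E = "{U. open U}" and \<Omega> = UNIV and A = "\<lambda>n. ball 0 (real n)"])
    show "sets M = sigma_sets UNIV {U. open U}" "sets lborel = sigma_sets UNIV {U::(real^'n) set. open U}"
      by (simp_all add: sM borel_def)
    show "(\<Union>i. ball 0 (real i)) = (UNIV :: (real^'n) set)"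
      by (auto intro: reals_Archimedean2)
    show "emeasure M (ball 0 (real i)) \<noteq> \<infinity>" for i by (simp add: ball emeasure_ball)
  qed (use open_eq in \<open>auto simp: Int_stable_def\<close>)
  then show ?thesis by (simp add: M_def)
qed

definition ball_measure :: "(real^'n) measure" where
  "ball_measure = uniform_measure lborel (ball 0 1)"

lemma unit_ball_emeasure: "emeasure lborel (ball (0::real^'n) 1) \<noteq> 0" "emeasure lborel (ball (0::real^'n) 1) \<noteq> \<infinity>"
proof -
  have "unit_ball_vol (real CARD('n)) \<noteq> 0" by (metis unit_ball_vol_pos less_irrefl of_nat_0_le_iff)
  then show "emeasure lborel (ball (0::real^'n) 1) \<noteq> 0" "emeasure lborel (ball (0::real^'n) 1) \<noteq> \<infinity>"
    by (simp_all add: emeasure_ball)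
qed

interpretation ball_measure: prob_space ball_measure
  unfolding ball_measure_def by (intro prob_space_uniform_measure unit_ball_emeasure)

lemma sets_ball_measure [simp, measurable_cong]: "sets ball_measure = sets borel"
  and space_ball_measure [simp]: "space ball_measure = UNIV"
  by (simp_all add: ball_measure_def)

lemma distr_ball_measure_orthogonal:
  assumes A: "orthogonal_matrix A"
  shows "distr ball_measure borel ((*v) A) = ball_measure"
proof (rule measure_eqI)
  fix B assume "B \<in> sets (distr ball_measure borel ((*v) A))"
  then have B [measurable]: "B \<in> sets borel" by simp
  have m: "(*v) A \<in> borel_measurable borel" by measurable
  have v: "(*v) A -` ball 0 1 = ball 0 1" by (auto simp: orthogonal_matrix_norm[OF A])
  have pre: "(*v) A -` B \<in> sets borel" using measurable_sets[OF m B] by simp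
  have "emeasure (distr ball_measure borel ((*v) A)) B = emeasure ball_measure ((*v) A -` B)"
    using m by (subst emeasure_distr) (auto cong: measurable_cong_sets)
  also have "\<dots> = emeasure lborel (ball 0 1 \<inter> (*v) A -` B) / emeasure lborel (ball (0::real^'a) 1)"
    unfolding ball_measure_def using pre by (subst emeasure_uniform_measure) auto
  also have "ball 0 1 \<inter> (*v) A -` B = (*v) A -` (ball 0 1 \<inter> B)" using v by blast
  also have "emeasure lborel \<dots> = emeasure (distr lborel borel ((*v) A)) (ball 0 1 \<inter> B)"
    using m by (subst emeasure_distr) (auto cong: measurable_cong_sets)
  also have "\<dots> / emeasure lborel (ball (0::real^'a) 1) = emeasure ball_measure B"
    unfolding ball_measure_def distr_lborel_orthogonal[OF A] by (subst emeasure_uniform_measure) auto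
  finally show "emeasure (distr ball_measure borel ((*v) A)) B = emeasure ball_measure B" .
qed simp

lemma AE_ball_measure_negligible:
  fixes N :: "(real^'n) set"
  assumes "negligible N" "N \<in> sets borel"
  shows "AE x in ball_measure. x \<notin> N"
proof -
  have "N \<in> null_sets lborel"
    using assms negligible_iff_null_sets null_sets_completion_iff by (metis sets_lborel)
  then have "AE x in lborel. x \<notin> N" by (rule AE_not_in)
  then show ?thesis unfolding ball_measure_def by (intro AE_uniform_measureI) auto
qed

subsection \<open>Existence\<close>

definition axis_stabilizer :: "'n set \<Rightarrow> (real^'n^'n) set" where
  "axis_stabilizer I = {A. orthogonal_matrix A \<and> (\<forall>j\<in>I. A *v axis j 1 = axis j 1)}"

lemma axis_stabilizer_mult: "a \<in> axis_stabilizer I \<Longrightarrow> b \<in> axis_stabilizer I \<Longrightarrow> a ** b \<in> axis_stabilizer I"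
  by (auto simp: axis_stabilizer_def orthogonal_matrix_mul matrix_vector_mul_assoc[symmetric])

lemma continuous_on_matrix_mult:
  fixes f g :: "'a::topological_space \<Rightarrow> real^'n^'n"
  assumes "continuous_on S f" "continuous_on S g"
  shows "continuous_on S (\<lambda>x. f x ** g x)"
  unfolding matrix_matrix_mult_def using assms by (intro continuous_on_vec_lambda continuous_intros)

lemma continuous_on_matrix_vector_mult:
  fixes f :: "'a::topological_space \<Rightarrow> real^'n^'n"
  assumes "continuous_on S f" "continuous_on S g"
  shows "continuous_on S (\<lambda>x. f x *v g x)"
  unfolding matrix_vector_mult_def using assms by (intro continuous_on_vec_lambda continuous_intros)

lemma continuous_on_transpose:
  fixes f :: "'a::topological_space \<Rightarrow> real^'n^'n"
  assumes "continuous_on S f"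
  shows "continuous_on S (\<lambda>x. transpose (f x))"
  unfolding transpose_def using assms by (intro continuous_on_vec_lambda continuous_intros)

lemma closed_orthogonal_matrices: "closed {A::real^'n^'n. orthogonal_matrix A}"
  unfolding orthogonal_matrix
  by (intro closed_Collect_eq continuous_on_matrix_mult continuous_on_transpose continuous_intros)

lemma closed_axis_stabilizer: "closed (axis_stabilizer (I :: 'n::finite set))"
proof -
  have "axis_stabilizer I = {A. orthogonal_matrix A} \<inter> (\<Inter>j\<in>I. {A. A *v axis j 1 = axis j 1})"
    by (auto simp: axis_stabilizer_def)
  then show ?thesis
    by (auto intro!: closed_Int closed_orthogonal_matrices closed_INT closed_Collect_eq
        continuous_on_matrix_vector_mult continuous_intros)
qed

text \<open>The subgroup algorithm.  Let \<open>I\<close> be the complement of the index set and \<open>j \<notin> I\<close>.  An element of the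
  stabilizer of the axes in \<open>I\<close> is determined by the image \<open>s\<close> of the \<open>j\<close>-th axis vector, a unit vector orthogonal to the axes in \<open>I\<close>,
  together with an element of the smaller stabilizer of \<open>insert j I\<close>.  So take \<open>s\<close> uniform (a normalized projection of a
  uniform point of the ball), the reflection \<open>h\<close> that moves the axis vector to \<open>s\<close>, and multiply by an
  invariant random element of the smaller stabilizer.  Left multiplication by \<open>a\<close> turns \<open>s\<close> into \<open>a s\<close> and
  changes the second factor by left multiplication with an element of the smaller stabilizer.\<close>

lemma axis_stabilizer_haar_exists:
  fixes J :: "'n::finite set"
  shows "\<exists>L::(real^'n^'n) measure. prob_space L \<and> sets L = sets borel \<and> (AE A in L. A \<in> axis_stabilizer (- J)) \<and>
           (\<forall>a\<in>axis_stabilizer (- J). distr L borel ((**) a) = L)"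
  using finite[of J]
proof (induction J rule: finite_induct)
  case empty
  have one: "A = mat 1" if "A \<in> axis_stabilizer UNIV" for A :: "real^'n^'n"
  proof -
    have "A $ i $ j = (A *v axis j 1) $ i" for i j
      by (simp add: matrix_vector_mult_basis column_def)
    also have "(A *v axis j 1) $ i = mat 1 $ i $ j" for i j
      using that by (simp add: axis_stabilizer_def mat_def axis_def)
    finally show ?thesis by (simp add: vec_eq_iff)
  qed
  then have "distr (return borel (mat 1)) borel ((**) A) = return borel (mat 1)" if A: "A \<in> axis_stabilizer UNIV" for A :: "real^'n^'n"
  proof -
    show ?thesis unfolding one[OF A] by (subst distr_return) auto
  qed
  moreover have "AE A in return borel (mat 1). A \<in> axis_stabilizer (UNIV :: 'n set)"
    using borel_closed[OF closed_axis_stabilizer[of UNIV]]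
    by (subst AE_return) (simp_all add: pred_def, simp add: axis_stabilizer_def orthogonal_matrix_id)
  ultimately show ?case
    by (intro exI[of _ "return borel (mat 1)"]) (auto simp: prob_space_return)
next
  case (insert j J)
  define I where "I = - insert j J"
  have jI: "j \<notin> I" and mJ: "- J = insert j I" using insert.hyps by (auto simp: I_def)
  obtain L0 :: "(real^'n^'n) measure" where L0: "prob_space L0" and sL0 [simp, measurable_cong]: "sets L0 = sets borel"
    and AE0: "AE A in L0. A \<in> axis_stabilizer (insert j I)"
    and inv0: "\<And>a. a \<in> axis_stabilizer (insert j I) \<Longrightarrow> distr L0 borel ((**) a) = L0"
    using insert.IH unfolding mJ by blast
  have spL0: "space L0 = UNIV" using sets_eq_imp_space_eq[OF sL0] by simp
  interpret L0: prob_space L0 by fact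
  interpret P: pair_prob_space ball_measure L0 ..
  define pr :: "real^'n \<Rightarrow> real^'n" where "pr x = (\<chi> l. if l \<in> I then 0 else x $ l)" for x
  define s where "s x = pr x /\<^sub>R norm (pr x)" for x
  define h where "h x = householder (s x - axis j 1)" for x
  define L where "L = distr (ball_measure \<Otimes>\<^sub>M L0) borel (\<lambda>(x, A). h x ** A)"
  have [measurable]: "pr \<in> borel_measurable borel" unfolding pr_def[abs_def] by measurable
  have [measurable]: "s \<in> borel_measurable borel" unfolding s_def[abs_def] by measurable
  have hm [measurable]: "h \<in> borel_measurable borel" unfolding h_def[abs_def] by measurable
  have hAm: "(\<lambda>(x, A). h x ** A) \<in> borel_measurable (ball_measure \<Otimes>\<^sub>M L0)"
    by measurable
  have sI: "s x \<bullet> axis l 1 = 0" if "l \<in> I" for x l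
    using that by (simp add: s_def pr_def inner_axis)
  have hI: "h x *v axis l 1 = axis l 1" if "l \<in> I" for x l
    unfolding h_def using that jI
    by (intro householder_fix) (auto simp: inner_diff_left sI inner_axis_axis)
  have h_stab: "h x \<in> axis_stabilizer I" for x
    using hI by (auto simp: axis_stabilizer_def h_def orthogonal_householder)
  have sub: "axis_stabilizer (insert j I) \<subseteq> axis_stabilizer I" by (auto simp: axis_stabilizer_def)
  have pr_eq: "pr x = x - (\<Sum>l\<in>I. (x \<bullet> axis l 1) *\<^sub>R axis l 1)" for x
  proof -
    have "(\<Sum>l\<in>I. (x \<bullet> axis l 1) *\<^sub>R axis l 1) $ i = (if i \<in> I then x $ i else 0)" for i
      by (simp add: inner_axis) (simp add: axis_def if_distrib sum.delta cong: if_cong)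
    then show ?thesis by (simp add: vec_eq_iff pr_def)
  qed
  \<comment> \<open>\<open>a\<close> fixes the axes in \<open>I\<close>, hence commutes with the projection to their orthogonal complement\<close>
  have s_equiv: "s (a *v x) = a *v s x" if a: "a \<in> axis_stabilizer I" for a x
  proof -
    have ao: "orthogonal_matrix a" and al: "\<And>l. l \<in> I \<Longrightarrow> a *v axis l 1 = axis l 1"
      using a by (auto simp: axis_stabilizer_def)
    have "(a *v x) \<bullet> axis l 1 = x \<bullet> axis l 1" if "l \<in> I" for l
      using orthogonal_matrix_inner[OF ao, of x "axis l 1"] al[OF that] by simp
    then have "pr (a *v x) = a *v x - (\<Sum>l\<in>I. (x \<bullet> axis l 1) *\<^sub>R axis l 1)" by (simp add: pr_eq)
    also have "\<dots> = a *v pr x"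
      by (simp add: pr_eq matrix_vector_mult_diff_distrib linear_sum[OF matrix_vector_mul_linear]
          matrix_vector_mult_scaleR al)
    finally show ?thesis
      by (simp add: s_def orthogonal_matrix_norm[OF ao] matrix_vector_mult_scaleR)
  qed
  have AEs: "AE x in ball_measure. norm (s x) = 1"
  proof -
    have "negligible {x::real^'n. x $ j = 0}"
      using negligible_standard_hyperplane[of "axis j 1 :: real^'n" 0] by (simp add: inner_axis axis_in_Basis_iff)
    moreover have "{x::real^'n. x $ j = 0} \<in> sets borel"
      by (intro borel_closed closed_Collect_eq continuous_intros)
    ultimately have "AE x in ball_measure. x \<notin> {x::real^'n. x $ j = 0}" by (rule AE_ball_measure_negligible)
    then show ?thesis
    proof eventually_elim
      case (elim x)
      then have "pr x \<noteq> 0" using jI by (auto simp: pr_def vec_eq_iff)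
      then show ?case by (simp add: s_def)
    qed
  qed
  \<comment> \<open>reflections are involutions, so this is the factor \<open>b\<close> with \<open>a (h x) = h (a x) b\<close>\<close>
  have b_stab: "h (a *v x) ** a ** h x \<in> axis_stabilizer (insert j I)"
    if a: "a \<in> axis_stabilizer I" and x: "norm (s x) = 1" for a x
  proof -
    have ao: "orthogonal_matrix a" using a by (auto simp: axis_stabilizer_def)
    have "h x *v axis j 1 = s x" using householder_swap(2)[of "s x" "axis j 1"] x by (simp add: h_def)
    moreover have "h (a *v x) *v s (a *v x) = axis j 1"
      using householder_swap(1)[of "s (a *v x)" "axis j 1"] x ao
      by (simp add: h_def s_equiv[OF a] orthogonal_matrix_norm)
    ultimately have "(h (a *v x) ** a ** h x) *v axis j 1 = axis j 1"
      by (simp add: matrix_vector_mul_assoc[symmetric] s_equiv[OF a])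
    moreover have "h (a *v x) ** a ** h x \<in> axis_stabilizer I"
      by (intro axis_stabilizer_mult h_stab a)
    ultimately show ?thesis by (auto simp: axis_stabilizer_def)
  qed
  have nnL: "(\<integral>\<^sup>+A. f A \<partial>L) = (\<integral>\<^sup>+x. \<integral>\<^sup>+A. f (h x ** A) \<partial>L0 \<partial>ball_measure)"
    if f [measurable]: "f \<in> borel_measurable borel" for f
  proof -
    have "(\<integral>\<^sup>+A. f A \<partial>L) = (\<integral>\<^sup>+z. f (h (fst z) ** snd z) \<partial>(ball_measure \<Otimes>\<^sub>M L0))"
      unfolding L_def by (subst nn_integral_distr[OF hAm]) (auto simp: split_beta)
    also have "\<dots> = (\<integral>\<^sup>+x. \<integral>\<^sup>+A. f (h x ** A) \<partial>L0 \<partial>ball_measure)"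
      by (subst L0.nn_integral_fst[symmetric]) auto
    finally show ?thesis .
  qed
  have "distr L borel ((**) a) = L" if a: "a \<in> axis_stabilizer I" for a
  proof (rule measure_eqI)
    have ao: "orthogonal_matrix a" using a by (auto simp: axis_stabilizer_def)
    fix B assume "B \<in> sets (distr L borel ((**) a))"
    then have B [measurable]: "B \<in> sets borel" by simp
    define \<Phi> where "\<Phi> x = (\<integral>\<^sup>+A. indicator B (h x ** A) \<partial>L0)" for x
    have Pm [measurable]: "\<Phi> \<in> borel_measurable borel"
      unfolding \<Phi>_def[abs_def] by measurable
    have "emeasure (distr L borel ((**) a)) B = (\<integral>\<^sup>+A. indicator B A \<partial>distr L borel ((**) a))" by simp
    also have "\<dots> = (\<integral>\<^sup>+A. indicator B (a ** A) \<partial>L)"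
      by (subst nn_integral_distr) (auto simp: L_def)
    also have "\<dots> = (\<integral>\<^sup>+x. \<integral>\<^sup>+A. indicator B (a ** (h x ** A)) \<partial>L0 \<partial>ball_measure)"
      by (subst nnL) auto
    also have "\<dots> = (\<integral>\<^sup>+x. \<Phi> (a *v x) \<partial>ball_measure)"
    proof (rule nn_integral_cong_AE)
      show "AE x in ball_measure. (\<integral>\<^sup>+A. indicator B (a ** (h x ** A)) \<partial>L0) = \<Phi> (a *v x)"
        using AEs
      proof eventually_elim
        case (elim x)
        define b where "b = h (a *v x) ** a ** h x"
        have b: "b \<in> axis_stabilizer (insert j I)" using b_stab[OF a elim] by (simp add: b_def)
        have hh: "h (a *v x) ** (h (a *v x) ** X) = X" for X
          by (simp add: matrix_mul_assoc h_def householder_involution)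
        have "a ** (h x ** A) = h (a *v x) ** (b ** A)" for A :: "real^'n^'n"
          by (simp add: b_def matrix_mul_assoc[symmetric] hh)
        then have "(\<integral>\<^sup>+A. indicator B (a ** (h x ** A)) \<partial>L0) = (\<integral>\<^sup>+A. indicator B (h (a *v x) ** (b ** A)) \<partial>L0)"
          by simp
        also have "\<dots> = (\<integral>\<^sup>+A. indicator B (h (a *v x) ** A) \<partial>distr L0 borel ((**) b))"
          by (subst nn_integral_distr) auto
        finally show ?case by (simp add: inv0[OF b] \<Phi>_def)
      qed
    qed
    also have "\<dots> = (\<integral>\<^sup>+x. \<Phi> x \<partial>distr ball_measure borel ((*v) a))"
      by (subst nn_integral_distr) auto
    also have "\<dots> = (\<integral>\<^sup>+A. indicator B A \<partial>L)"
      unfolding distr_ball_measure_orthogonal[OF ao] \<Phi>_def by (subst nnL) auto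
    also have "\<dots> = emeasure L B" by (simp add: L_def)
    finally show "emeasure (distr L borel ((**) a)) B = emeasure L B" .
  qed (simp add: L_def)
  moreover have "AE A in L. A \<in> axis_stabilizer I"
  proof -
    have cl: "axis_stabilizer I \<in> sets borel" using closed_axis_stabilizer by (rule borel_closed)
    have "AE z in ball_measure \<Otimes>\<^sub>M L0. h (fst z) ** snd z \<in> axis_stabilizer I"
    proof (rule P.AE_pair_measure)
      have m: "(\<lambda>z. h (fst z) ** snd z) \<in> borel_measurable (ball_measure \<Otimes>\<^sub>M L0)" by measurable
      show "{z \<in> space (ball_measure \<Otimes>\<^sub>M L0). h (fst z) ** snd z \<in> axis_stabilizer I} \<in> sets (ball_measure \<Otimes>\<^sub>M L0)"
        using measurable_sets[OF m cl] by (simp add: vimage_def Int_def conj_commute)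
      show "AE x in ball_measure. AE A in L0. h (fst (x, A)) ** snd (x, A) \<in> axis_stabilizer I"
      proof (rule AE_I2)
        fix x :: "real^'n"
        show "AE A in L0. h (fst (x, A)) ** snd (x, A) \<in> axis_stabilizer I"
          using AE0
        proof eventually_elim
          case (elim A)
          then have "A \<in> axis_stabilizer I" using sub by blast
          then show ?case using axis_stabilizer_mult[OF h_stab[of x]] by simp
        qed
      qed
    qed
    then show ?thesis unfolding L_def using cl
      by (subst AE_distr_iff[OF hAm]) (auto simp: split_beta)
  qed
  moreover have "prob_space L" unfolding L_def by (rule P.prob_space_distr[OF hAm])
  moreover have "sets L = sets borel" by (simp add: L_def)
  ultimately show ?case unfolding I_def by blast
qed


abbreviation orthogonal_group :: "(real^'n^'n) set" where
  "orthogonal_group \<equiv> {A. orthogonal_matrix A}"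

lemma haar_exists:
  "\<exists>M::(real^'n^'n) measure. prob_space M \<and> sets M = sets (restrict_space borel orthogonal_group) \<and>
     (\<forall>a\<in>orthogonal_group. distr M M ((**) a) = M)"
proof -
  obtain L :: "(real^'n^'n) measure" where L: "prob_space L" and sL [simp, measurable_cong]: "sets L = sets borel"
    and AE: "AE A in L. A \<in> axis_stabilizer {}"
    and inv: "\<And>a. a \<in> axis_stabilizer {} \<Longrightarrow> distr L borel ((**) a) = L"
    using axis_stabilizer_haar_exists[of UNIV] by auto
  have spL: "space L = UNIV" using sets_eq_imp_space_eq[OF sL] by simp
  interpret L: prob_space L by fact
  have st: "axis_stabilizer {} = (orthogonal_group :: (real^'n^'n) set)" by (simp add: axis_stabilizer_def)
  have O: "orthogonal_group \<in> sets L" by (simp add: closed_orthogonal_matrices borel_closed)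
  define M where "M = restrict_space L orthogonal_group"
  have sM: "sets M = sets (restrict_space borel orthogonal_group)"
    unfolding M_def by (rule sets_restrict_space_cong) simp
  have spM: "space M = orthogonal_group" by (simp add: M_def space_restrict_space spL)
  have eM: "emeasure M X = emeasure L X" if "X \<subseteq> orthogonal_group" "X \<in> sets borel" for X
    unfolding M_def by (rule emeasure_restrict_space) (use that O in \<open>auto simp: spL\<close>)
  have "prob_space M"
  proof
    have "emeasure L orthogonal_group = 1"
      using AE O by (intro L.emeasure_eq_1_AE) (auto simp: st)
    then show "emeasure M (space M) = 1" using O by (simp add: spM eM)
  qed
  moreover have "distr M M ((**) a) = M" if a: "a \<in> orthogonal_group" for a
  proof (rule measure_eqI)
    fix X assume "X \<in> sets (distr M M ((**) a))"
    then have X: "X \<in> sets M" by simp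
    then have XB: "X \<in> sets borel" "X \<subseteq> orthogonal_group"
      unfolding sM using sets_restrict_space_iff[of "orthogonal_group" "borel :: (real^'n^'n) measure"] O by auto
    have m: "(**) a \<in> measurable borel (borel :: (real^'n^'n) measure)" by measurable
    have mM: "(**) a \<in> measurable M M"
    proof -
      have "(**) a \<in> borel_measurable M"
        unfolding M_def using m by (intro measurable_restrict_space1) (simp add: measurable_cong_sets[OF sL refl])
      then have "(**) a \<in> measurable M (restrict_space borel orthogonal_group)"
        using a by (intro measurable_restrict_space2) (auto simp: spM orthogonal_matrix_mul)
      then show ?thesis by (simp add: measurable_cong_sets[OF refl sM])
    qed
    have pre: "(**) a -` X \<in> sets borel" using measurable_sets[OF m XB(1)] by simp
    have pO: "(**) a -` X \<subseteq> orthogonal_group"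
    proof
      fix Y assume "Y \<in> (**) a -` X"
      then have "orthogonal_matrix (a ** Y)" using XB(2) by auto
      then have "orthogonal_matrix (transpose a ** (a ** Y))" using a
        by (intro orthogonal_matrix_mul[of "transpose a"]) auto
      moreover have "transpose a ** (a ** Y) = Y" using a orthogonal_matrix_cancel(3)[of a Y] by simp
      ultimately show "Y \<in> orthogonal_group" by simp
    qed
    have "emeasure (distr M M ((**) a)) X = emeasure M ((**) a -` X)"
      using mM X pO by (subst emeasure_distr) (auto simp: spM Int_absorb2)
    also have "\<dots> = emeasure L ((**) a -` X)" using eM[OF pO pre] .
    also have "\<dots> = emeasure (distr L borel ((**) a)) X"
      using XB m by (subst emeasure_distr) (auto simp: spL)
    also have "\<dots> = emeasure L X" using inv[of a] a by (simp add: st)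
    finally show "emeasure (distr M M ((**) a)) X = emeasure M X" using eM XB by simp
  qed simp
  ultimately show ?thesis using sM by blast
qed

definition haar :: "(real^'n^'n) measure" where
  "haar = (SOME M. prob_space M \<and> sets M = sets (restrict_space borel orthogonal_group) \<and>
     (\<forall>a\<in>orthogonal_group. distr M M ((**) a) = M))"

lemma
  shows prob_space_haar: "prob_space haar"
    and sets_haar: "sets haar = sets (restrict_space borel orthogonal_group)"
    and haar_left: "orthogonal_matrix a \<Longrightarrow> distr haar haar ((**) a) = haar"
  using someI_ex[OF haar_exists, folded haar_def] by auto

interpretation haar: prob_space haar by (rule prob_space_haar)

lemma space_haar [simp]: "space haar = orthogonal_group"
  using sets_eq_imp_space_eq[OF sets_haar] by (simp add: space_restrict_space)

lemma haar_borel [measurable]: "(\<lambda>g. g) \<in> borel_measurable haar"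
  by (subst measurable_cong_sets[OF sets_haar refl]) (rule measurable_restrict_space1, simp)

lemma measurable_into_haar:
  assumes "f \<in> borel_measurable M" "\<And>x. x \<in> space M \<Longrightarrow> orthogonal_matrix (f x)"
  shows "f \<in> measurable M haar"
  by (subst measurable_cong_sets[OF refl sets_haar]) (use assms in \<open>auto intro!: measurable_restrict_space2\<close>)

lemma sets_borel_of_pullback_id:
  "sets (borel_of (pullback_topology S (\<lambda>x. x) euclidean)) = sets (restrict_space borel S)"
  unfolding sets_borel_of_pullback restrict_space_eq_vimage_algebra' by (simp add: sets_vimage_algebra)

lemma invariant_measure_haar:
  "invariant_measure orthogonal_group (\<lambda>x. x) {(**) a | a. orthogonal_matrix a} haar"
proof
  have "\<exists>g\<in>{(**) a | a. orthogonal_matrix a}. g x = y"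
    if "orthogonal_matrix x" "orthogonal_matrix y" for x y :: "real^'n^'n"
  proof (rule bexI[of _ "(**) (y ** transpose x)"])
    show "y ** transpose x ** x = y"
      using that by (simp add: matrix_mul_assoc[symmetric] orthogonal_matrix)
    have "orthogonal_matrix (y ** transpose x)" using that by (intro orthogonal_matrix_mul) auto
    then show "(**) (y ** transpose x) \<in> {(**) a | a. orthogonal_matrix a}" by blast
  qed
  moreover have "dist (a ** x) (a ** y) = dist x y" if "orthogonal_matrix a" for a x y :: "real^'n^'n"
    by (metis dist_norm matrix_mult_diff_distrib(1) norm_orthogonal_matrix_mult_left that)
  ultimately show "isometric_transitive orthogonal_group (\<lambda>x. x) {(**) a | a. orthogonal_matrix (a::real^'n^'n)}"
    unfolding isometric_transitive_def by (auto simp: orthogonal_matrix_mul)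
  show "sets haar = sets (borel_of (pullback_topology orthogonal_group (\<lambda>x. x) euclidean))"
    by (simp add: sets_haar sets_borel_of_pullback_id)
qed (auto simp: haar_left haar.prob_space_axioms)

lemma haar_mult_measurable:
  assumes "orthogonal_matrix a"
  shows "(**) a \<in> measurable haar haar" "(\<lambda>g. g ** a) \<in> measurable haar haar"
  by (rule measurable_into_haar; use assms in \<open>auto intro: orthogonal_matrix_mul\<close>)+

text \<open>A right translate of Haar measure is again left invariant.\<close>

lemma haar_right:
  fixes b :: "real^'n^'n"
  assumes b: "orthogonal_matrix b"
  shows "distr haar haar (\<lambda>g. g ** b) = haar"
proof (rule invariant_measure_unique)
  note m = haar_mult_measurable
  show "invariant_measure orthogonal_group (\<lambda>x. x) {(**) a | a. orthogonal_matrix a} (distr haar haar (\<lambda>g. g ** b))"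
  proof (rule invariant_measure.intro)
    show "isometric_transitive orthogonal_group (\<lambda>x. x) {(**) a | a. orthogonal_matrix (a::real^'n^'n)}"
      and "sets (distr haar haar (\<lambda>g. g ** b)) = sets (borel_of (pullback_topology orthogonal_group (\<lambda>x. x) euclidean))"
      using invariant_measure_haar[where 'a='n] unfolding invariant_measure_def by auto
    show "prob_space (distr haar haar (\<lambda>g. g ** b))" by (rule haar.prob_space_distr[OF m(2)[OF b]])
    fix g :: "real^'n^'n \<Rightarrow> real^'n^'n" assume "g \<in> {(**) a | a. orthogonal_matrix a}"
    then obtain a where a: "orthogonal_matrix a" "g = (**) a" by blast
    have "distr (distr haar haar (\<lambda>g. g ** b)) haar ((**) a) = distr (distr haar haar ((**) a)) haar (\<lambda>g. g ** b)"
      by (simp add: distr_distr m a b o_def matrix_mul_assoc)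
    then show "distr (distr haar haar (\<lambda>g. g ** b)) (distr haar haar (\<lambda>g. g ** b)) g = distr haar haar (\<lambda>g. g ** b)"
      using a by (simp add: haar_left cong: distr_cong)
  qed
qed (rule invariant_measure_haar)

lemma integral_haar_left:
  fixes f :: "real^'n^'n \<Rightarrow> real"
  assumes "orthogonal_matrix a" and f: "f \<in> borel_measurable haar"
  shows "(\<integral>g. f (a ** g) \<partial>haar) = (\<integral>g. f g \<partial>haar)"
  using integral_distr[OF haar_mult_measurable(1)[OF assms(1)] f] by (simp add: haar_left assms)

lemma integral_haar_right:
  fixes f :: "real^'n^'n \<Rightarrow> real"
  assumes "orthogonal_matrix a" and f: "f \<in> borel_measurable haar"
  shows "(\<integral>g. f (g ** a) \<partial>haar) = (\<integral>g. f g \<partial>haar)"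
  using integral_distr[OF haar_mult_measurable(2)[OF assms(1)] f] by (simp add: haar_right assms)

text \<open>Haar measure charges every nonempty relatively open set.\<close>

lemma haar_integral_0_continuous:
  fixes f :: "real^'n^'n \<Rightarrow> real"
  assumes f: "continuous_on orthogonal_group f" and nn: "\<And>g. orthogonal_matrix g \<Longrightarrow> 0 \<le> f g"
    and int: "integrable haar f" and 0: "(\<integral>g. f g \<partial>haar) = 0" and a: "orthogonal_matrix a"
  shows "f a = 0"
proof (rule ccontr)
  assume "f a \<noteq> 0"
  interpret I: invariant_measure orthogonal_group "\<lambda>x. x" "{(**) a | a. orthogonal_matrix (a::real^'n^'n)}" haar
    by (rule invariant_measure_haar)
  have pos: "f a > 0" using nn[OF a] \<open>f a \<noteq> 0\<close> by simp
  then obtain d where d: "d > 0" "\<And>g. orthogonal_matrix g \<Longrightarrow> dist g a < d \<Longrightarrow> dist (f g) (f a) < f a"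
    using f a unfolding continuous_on_iff by (metis mem_Collect_eq)
  have "AE g in haar. f g = 0"
    using 0 nn int by (subst (asm) integral_nonneg_eq_0_iff_AE) auto
  then have "AE g in haar. g \<notin> I.mball a d"
  proof eventually_elim
    case (elim g)
    then show ?case using d(2)[of g] by (auto simp: I.mball_def dist_commute dist_real_def)
  qed
  then have "emeasure haar (I.mball a d) = 0"
    using I.mball_sets[of a d] AE_iff_null_sets by blast
  then show False using I.mball_pos[of a d] a d(1) by auto
qed

section \<open>The invariant measures on spheres and Grassmannians\<close>

subsection \<open>Pullback presentations\<close>

lemma sphere_top_eq_pullback: "sphere_top = pullback_topology (sphere 0 1) (\<lambda>x. x) euclidean"
  by (auto simp: sphere_top_def topology_eq openin_pullback_topology openin_subtopology)

lemma subtopology_pullback: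
  "subtopology (pullback_topology S e T) X = pullback_topology (S \<inter> X) e T"
  by (auto simp: topology_eq openin_pullback_topology openin_subtopology Int_assoc)

definition Gr :: "nat \<Rightarrow> (real^'n) set set" where
  "Gr k = {\<xi>. subspace \<xi> \<and> dim \<xi> = k}"

lemma grassmannian_eq_pullback: "grassmannian k = pullback_topology (Gr k) proj_matrix euclidean"
  by (simp add: grassmannian_def Gr_def)

lemma topspace_grassmannian [simp]: "topspace (grassmannian k) = Gr k"
  by (simp add: grassmannian_eq_pullback)

lemma topspace_sphere_top [simp]: "topspace sphere_top = sphere 0 1"
  by (simp add: sphere_top_def)

lemma sets_borel_of_sphere: "sets (borel_of sphere_top) = sets (restrict_space borel (sphere 0 1))"
  unfolding sphere_top_eq_pullback by (rule sets_borel_of_pullback_id)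

lemma sphere_borel: "(\<lambda>x. x) \<in> borel_measurable (borel_of sphere_top)"
  unfolding sphere_top_eq_pullback by (rule measurable_pullback_map)

lemma proj_matrix_borel [measurable]: "proj_matrix \<in> borel_measurable (borel_of (grassmannian k))"
  unfolding grassmannian_eq_pullback by (rule measurable_pullback_map)

lemma measurable_into_grassmannian:
  assumes "\<And>x. x \<in> space M \<Longrightarrow> f x \<in> Gr k" "(\<lambda>x. proj_matrix (f x)) \<in> borel_measurable M"
  shows "f \<in> measurable M (borel_of (grassmannian k))"
  unfolding grassmannian_eq_pullback using assms by (intro measurable_into_pullback) auto

lemma measurable_into_sphere:
  assumes "\<And>x. x \<in> space M \<Longrightarrow> norm (f x) = 1" "f \<in> borel_measurable M"
  shows "f \<in> measurable M (borel_of sphere_top)"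
  unfolding sphere_top_eq_pullback using assms by (intro measurable_into_pullback) auto

lemma subtopology_measurable:
  assumes "f \<in> borel_measurable (borel_of (pullback_topology S e euclidean))"
  shows "f \<in> borel_measurable (borel_of (subtopology (pullback_topology S e euclidean) X))"
proof -
  have "(\<lambda>x. x) \<in> measurable (borel_of (pullback_topology (S \<inter> X) e euclidean)) (borel_of (pullback_topology S e euclidean))"
    by (intro measurable_into_pullback measurable_pullback_map) auto
  from measurable_compose[OF this assms] show ?thesis by (simp add: subtopology_pullback)
qed

lemma Gr_orthogonal_image: "orthogonal_matrix A \<Longrightarrow> \<xi> \<in> Gr k \<Longrightarrow> (*v) A ` \<xi> \<in> Gr k"
  by (simp add: Gr_def subspace_orthogonal_image dim_orthogonal_image)

lemma Gr_orthogonal_comp: "\<eta> \<in> Gr k \<Longrightarrow> \<eta>\<^sup>\<bottom> \<in> Gr (CARD('n) - k)" for \<eta> :: "(real^'n) set"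
  by (simp add: Gr_def subspace_orthogonal_comp dim_orthogonal_comp)

subsection \<open>Transitivity of the rotation groups\<close>

text \<open>A proper subspace is fixed pointwise by the reflection in a vector orthogonal to it, which allows
  passing from orthogonal matrices to rotations without changing the effect on the subspace.\<close>

lemma rotation_agreeing_on_subspace:
  fixes \<xi> :: "(real^'n) set"
  assumes A: "orthogonal_matrix A" and \<xi>: "subspace \<xi>" "dim \<xi> < CARD('n)"
  shows "\<exists>B. rotation_matrix B \<and> (\<forall>x\<in>\<xi>. B *v x = A *v x)"
proof -
  obtain v where v: "v \<noteq> 0" "\<And>y. y \<in> span \<xi> \<Longrightarrow> orthogonal v y"
    using orthogonal_to_subspace_exists[of \<xi>] \<xi> by auto
  have "(A ** householder v) *v x = A *v x" if "x \<in> \<xi>" for x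
    using v(2)[OF span_base[OF that]]
    by (simp add: matrix_vector_mul_assoc[symmetric] householder_fix orthogonal_def)
  then show ?thesis using rotation_or_reflected[OF A v(1)] by blast
qed

lemma orthogonal_matrix_dist:
  fixes A :: "real^'n^'n"
  assumes "orthogonal_matrix A"
  shows "dist (A *v x) (A *v y) = dist x y"
  by (metis assms dist_norm matrix_vector_mult_diff_distrib orthogonal_matrix_norm)

lemma isometric_transitive_sphere:
  assumes "CARD('n) \<ge> 2"
  shows "isometric_transitive (sphere (0::real^'n) 1) (\<lambda>x. x) {(*v) A | A. rotation_matrix A}"
proof -
  have "\<exists>A. rotation_matrix A \<and> A *v x = y" if "norm x = 1" "norm y = 1" for x y :: "real^'n"
  proof -
    have "dim (span {x}) < CARD('n)" using assms by (simp add: dim_span dim_singleton)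
    then obtain B where "rotation_matrix B" "\<And>z. z \<in> span {x} \<Longrightarrow> B *v z = householder (x - y) *v z"
      using rotation_agreeing_on_subspace[OF orthogonal_householder, of "span {x}" "x - y"] by auto
    then show ?thesis
      using householder_swap(1)[of x y] that span_base[of x "{x}"] by (intro exI[of _ B]) auto
  qed
  moreover have "orthogonal_matrix A" if "rotation_matrix A" for A :: "real^'n^'n"
    using that by (simp add: rotation_matrix_def)
  ultimately show ?thesis
    unfolding isometric_transitive_def
    by (auto simp: orthogonal_matrix_norm orthogonal_matrix_dist) blast
qed

lemma isometric_transitive_subsphere:
  fixes \<xi> :: "(real^'n) set"
  assumes \<xi>: "subspace \<xi>" "dim \<xi> < CARD('n)"
  shows "isometric_transitive (sphere 0 1 \<inter> \<xi>) (\<lambda>x. x) {(*v) A | A. rotation_matrix A \<and> (*v) A ` \<xi> = \<xi>}"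
proof -
  have "\<exists>A. rotation_matrix A \<and> (*v) A ` \<xi> = \<xi> \<and> A *v x = y"
    if xy: "norm x = 1" "norm y = 1" "x \<in> \<xi>" "y \<in> \<xi>" for x y :: "real^'n"
  proof -
    have "householder (x - y) *v z \<in> \<xi>" if "z \<in> \<xi>" for z
      using that xy \<xi> by (simp add: householder_mult subspace_diff subspace_scale)
    then have im: "(*v) (householder (x - y)) ` \<xi> = \<xi>"
      using \<xi> by (intro orthogonal_image_eq_if_subset orthogonal_householder) auto
    obtain B where B: "rotation_matrix B" "\<And>z. z \<in> \<xi> \<Longrightarrow> B *v z = householder (x - y) *v z"
      using rotation_agreeing_on_subspace[OF orthogonal_householder \<xi>, of "x - y"] by blast
    then have "(*v) B ` \<xi> = \<xi>" using im by (metis (no_types, lifting) image_cong)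
    moreover have "B *v x = y" using householder_swap(1)[of x y] B(2)[OF xy(3)] xy by simp
    ultimately show ?thesis using B(1) by blast
  qed
  moreover have "A *v x \<in> \<xi>" if "(*v) A ` \<xi> = \<xi>" "x \<in> \<xi>" for A :: "real^'n^'n" and x
    using that by blast
  moreover have "orthogonal_matrix A" if "rotation_matrix A" for A :: "real^'n^'n"
    using that by (simp add: rotation_matrix_def)
  ultimately show ?thesis
    unfolding isometric_transitive_def
    by (auto simp: orthogonal_matrix_norm orthogonal_matrix_dist) blast
qed

lemma dist_proj_matrix_orthogonal_image:
  assumes "orthogonal_matrix A" "\<xi> \<in> Gr k" "\<zeta> \<in> Gr k"
  shows "dist (proj_matrix ((*v) A ` \<xi>)) (proj_matrix ((*v) A ` \<zeta>)) = dist (proj_matrix \<xi>) (proj_matrix \<zeta>)"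
  using assms by (simp add: Gr_def proj_matrix_orthogonal_image orthogonal_matrix_conj_dist)

lemma rotation_between_subspaces:
  fixes \<xi> \<zeta> :: "(real^'n) set"
  assumes "\<xi> \<in> Gr k" "\<zeta> \<in> Gr k" "k < CARD('n)"
  shows "\<exists>A. rotation_matrix A \<and> (*v) A ` \<xi> = \<zeta>"
proof -
  obtain A where A: "orthogonal_matrix A" "(*v) A ` \<xi> = \<zeta>"
    using subspaces_exchangeable[of \<xi> \<zeta> k] assms by (auto simp: Gr_def)
  obtain B where "rotation_matrix B" "\<And>x. x \<in> \<xi> \<Longrightarrow> B *v x = A *v x"
    using rotation_agreeing_on_subspace[OF A(1), of \<xi>] assms by (auto simp: Gr_def)
  then show ?thesis using A(2) by (metis (no_types, lifting) image_cong)
qed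

lemma isometric_transitive_grassmannian:
  assumes "k < CARD('n)"
  shows "isometric_transitive (Gr k :: (real^'n) set set) proj_matrix {(`) ((*v) A) | A. rotation_matrix A}"
  unfolding isometric_transitive_def
proof (intro conjI ballI)
  fix g :: "(real^'n) set \<Rightarrow> (real^'n) set" assume "g \<in> {(`) ((*v) A) | A. rotation_matrix A}"
  then obtain A where A: "orthogonal_matrix A" "g = (`) ((*v) A)" by (auto simp: rotation_matrix_def)
  show "g \<in> Gr k \<rightarrow> Gr k" using A by (auto simp: Gr_orthogonal_image)
  show "dist (proj_matrix (g \<xi>)) (proj_matrix (g \<zeta>)) = dist (proj_matrix \<xi>) (proj_matrix \<zeta>)"
    if "\<xi> \<in> Gr k" "\<zeta> \<in> Gr k" for \<xi> \<zeta>
    unfolding A(2) using dist_proj_matrix_orthogonal_image[OF A(1) that] .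
next
  show "\<exists>g\<in>{(`) ((*v) A) | A. rotation_matrix A}. g \<xi> = \<zeta>" if "\<xi> \<in> Gr k" "\<zeta> \<in> Gr k" for \<xi> \<zeta> :: "(real^'n) set"
    using rotation_between_subspaces[OF that assms] by blast
qed

text \<open>The orthogonal complements of \<open>\<theta>\<close> in the two subspaces are exchanged by a matrix that fixes everything orthogonal to
  both of them, in particular \<open>\<theta>\<close>.\<close>

lemma rotation_between_subspaces_fixing:
  fixes \<xi> \<zeta> :: "(real^'n) set"
  assumes \<xi>: "\<xi> \<in> Gr k" and \<zeta>: "\<zeta> \<in> Gr k" and k: "k < CARD('n)"
    and \<theta>: "\<theta> \<in> \<xi>" "\<theta> \<in> \<zeta>"
  shows "\<exists>A. rotation_matrix A \<and> A *v \<theta> = \<theta> \<and> (*v) A ` \<xi> = \<zeta>"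
proof -
  define D where "D \<eta> = {z \<in> \<eta>. \<forall>w\<in>span {\<theta>}. orthogonal w z}" for \<eta> :: "(real^'n) set"
  have D: "z \<in> D \<eta> \<longleftrightarrow> z \<in> \<eta> \<and> \<theta> \<bullet> z = 0" for z \<eta>
    by (auto simp: D_def orthogonal_def span_singleton)
  have sD: "subspace (D \<eta>)" if "subspace \<eta>" for \<eta>
    using that unfolding subspace_def by (auto simp: D inner_add_right)
  have s: "subspace \<xi>" "subspace \<zeta>" "dim \<xi> = k" "dim \<zeta> = k" using \<xi> \<zeta> by (auto simp: Gr_def)
  have dD: "dim (D \<xi>) = k - dim (span {\<theta>})" "dim (D \<zeta>) = k - dim (span {\<theta>})"
    using dim_subspace_orthogonal_to_vectors[of "span {\<theta>}" \<xi>] dim_subspace_orthogonal_to_vectors[of "span {\<theta>}" \<zeta>]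
      s \<theta> by (auto simp: D_def span_minimal)
  obtain A where A: "orthogonal_matrix A" "(*v) A ` (D \<xi>) = D \<zeta>"
    and fix_A: "\<And>x. (\<forall>y\<in>D \<xi>. x \<bullet> y = 0) \<Longrightarrow> (\<forall>y\<in>D \<zeta>. x \<bullet> y = 0) \<Longrightarrow> A *v x = x"
    using subspaces_exchangeable[OF sD sD dD] s by blast
  have A\<theta>: "A *v \<theta> = \<theta>" by (rule fix_A) (auto simp: D)
  have A\<xi>: "A *v z \<in> \<zeta>" if z: "z \<in> \<xi>" for z
  proof -
    define c where "c = (\<theta> \<bullet> z) / (\<theta> \<bullet> \<theta>)"
    have "z - c *\<^sub>R \<theta> \<in> D \<xi>"
      using z \<theta> s by (cases "\<theta> = 0") (auto simp: D c_def subspace_diff subspace_scale inner_diff_right)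
    then have "A *v (z - c *\<^sub>R \<theta>) \<in> \<zeta>" using A(2) D by blast
    then have "A *v z - c *\<^sub>R \<theta> \<in> \<zeta>"
      by (simp add: matrix_vector_mult_diff_distrib matrix_vector_mult_scaleR A\<theta>)
    then show ?thesis using \<theta>(2) s by (metis diff_add_cancel subspace_add subspace_scale)
  qed
  have im: "(*v) A ` \<xi> = \<zeta>" using A(1) s A\<xi> by (intro orthogonal_image_eq_if_subset) auto
  obtain B where B: "rotation_matrix B" "\<And>x. x \<in> \<xi> \<Longrightarrow> B *v x = A *v x"
    using rotation_agreeing_on_subspace[OF A(1), of \<xi>] s k by auto
  then have "(*v) B ` \<xi> = \<zeta>" using im by (metis (no_types, lifting) image_cong)
  then show ?thesis using B \<theta>(1) A\<theta> by auto
qed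

lemma isometric_transitive_subgrassmannian:
  assumes "k < CARD('n)"
  shows "isometric_transitive (Gr k \<inter> {\<xi>. \<theta> \<in> \<xi>}) proj_matrix
           {(`) ((*v) A) | A. rotation_matrix A \<and> A *v \<theta> = (\<theta> :: real^'n)}"
  unfolding isometric_transitive_def
proof (intro conjI ballI)
  fix g :: "(real^'n) set \<Rightarrow> (real^'n) set" assume "g \<in> {(`) ((*v) A) | A. rotation_matrix A \<and> A *v \<theta> = \<theta>}"
  then obtain A where A: "orthogonal_matrix A" "A *v \<theta> = \<theta>" "g = (`) ((*v) A)" by (auto simp: rotation_matrix_def)
  have "\<theta> \<in> (*v) A ` \<xi>" if "\<theta> \<in> \<xi>" for \<xi> using that A(2) by (metis image_eqI)
  then show "g \<in> Gr k \<inter> {\<xi>. \<theta> \<in> \<xi>} \<rightarrow> Gr k \<inter> {\<xi>. \<theta> \<in> \<xi>}" using A by (auto simp: Gr_orthogonal_image)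
  show "dist (proj_matrix (g \<xi>)) (proj_matrix (g \<zeta>)) = dist (proj_matrix \<xi>) (proj_matrix \<zeta>)"
    if "\<xi> \<in> Gr k \<inter> {\<xi>. \<theta> \<in> \<xi>}" "\<zeta> \<in> Gr k \<inter> {\<xi>. \<theta> \<in> \<xi>}" for \<xi> \<zeta>
    unfolding A(3) using dist_proj_matrix_orthogonal_image[OF A(1)] that by blast
next
  show "\<exists>g\<in>{(`) ((*v) A) | A. rotation_matrix A \<and> A *v \<theta> = \<theta>}. g \<xi> = \<zeta>"
    if "\<xi> \<in> Gr k \<inter> {\<xi>. \<theta> \<in> \<xi>}" "\<zeta> \<in> Gr k \<inter> {\<xi>. \<theta> \<in> \<xi>}" for \<xi> \<zeta>
    using rotation_between_subspaces_fixing[of \<xi> k \<zeta> \<theta>] that assms by blast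
qed

subsection \<open>Invariant measures as images of Haar measure\<close>

text \<open>A random subspace through \<open>\<theta>\<close> in terms of a random orthogonal matrix \<open>g\<close>: the random subspace \<open>g \<xi>\<^sub>0\<close>
  contains \<open>g e\<close> if \<open>e \<in> \<xi>\<^sub>0\<close>, and a reflection moves \<open>g e\<close> to \<open>\<theta>\<close>.\<close>

definition subspace_through :: "real^'n \<Rightarrow> (real^'n) set \<Rightarrow> real^'n \<Rightarrow> real^'n^'n \<Rightarrow> (real^'n) set" where
  "subspace_through e \<xi>\<^sub>0 \<theta> g = (*v) (householder (g *v e - \<theta>) ** g) ` \<xi>\<^sub>0"

text \<open>A reference flag, from which spheres and Grassmannians are obtained as orbits.\<close>

locale flag_base =
  fixes e :: "real^'n" and \<xi>\<^sub>0 :: "(real^'n) set"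
  assumes norm_e: "norm e = 1" and e_in: "e \<in> \<xi>\<^sub>0"
    and subspace_base: "subspace \<xi>\<^sub>0" and dim_base: "dim \<xi>\<^sub>0 < CARD('n)"
begin

lemma base_Gr: "\<xi>\<^sub>0 \<in> Gr (dim \<xi>\<^sub>0)" by (simp add: Gr_def subspace_base)

lemma dim_base_pos: "0 < dim \<xi>\<^sub>0"
  using e_in norm_e dim_eq_0[of \<xi>\<^sub>0] by (metis gr0I norm_zero singletonD subsetD zero_neq_one)

lemma card_ge_2: "CARD('n) \<ge> 2" using dim_base dim_base_pos by linarith

lemma sphere_map_measurable: "(\<lambda>g. g *v e) \<in> measurable haar (borel_of sphere_top)"
  by (intro measurable_into_sphere) (auto simp: orthogonal_matrix_norm norm_e)

lemma grassmannian_map_measurable: "(\<lambda>g. (*v) g ` \<xi>\<^sub>0) \<in> measurable haar (borel_of (grassmannian (dim \<xi>\<^sub>0)))"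
proof (rule measurable_into_grassmannian)
  have "(\<lambda>g. g ** proj_matrix \<xi>\<^sub>0 ** transpose g) \<in> borel_measurable haar" by measurable
  then show "(\<lambda>g. proj_matrix ((*v) g ` \<xi>\<^sub>0)) \<in> borel_measurable haar"
    by (rule measurable_cong[THEN iffD1, rotated]) (simp add: proj_matrix_orthogonal_image subspace_base)
qed (auto simp: Gr_orthogonal_image base_Gr)

lemma householder_move: "orthogonal_matrix g \<Longrightarrow> norm \<theta> = 1 \<Longrightarrow> (householder (g *v e - \<theta>) ** g) *v e = \<theta>"
  using householder_swap(1)[of "g *v e" \<theta>]
  by (simp add: matrix_vector_mul_assoc[symmetric] orthogonal_matrix_norm norm_e)

lemma subspace_through_Gr: "orthogonal_matrix g \<Longrightarrow> subspace_through e \<xi>\<^sub>0 \<theta> g \<in> Gr (dim \<xi>\<^sub>0)"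
  unfolding subspace_through_def
  by (intro Gr_orthogonal_image orthogonal_matrix_mul orthogonal_householder base_Gr)

lemma in_subspace_through: "orthogonal_matrix g \<Longrightarrow> norm \<theta> = 1 \<Longrightarrow> \<theta> \<in> subspace_through e \<xi>\<^sub>0 \<theta> g"
  unfolding subspace_through_def using householder_move e_in by (metis image_eqI)

text \<open>For \<open>a \<theta> = \<theta>\<close> this says that left multiplication of \<open>g\<close> by \<open>a\<close> moves the subspace by \<open>a\<close>; this yields
  invariance under the stabilizer of \<open>\<theta>\<close>.\<close>

lemma subspace_through_equivariant:
  assumes "orthogonal_matrix a"
  shows "subspace_through e \<xi>\<^sub>0 (a *v \<theta>) (a ** g) = (*v) a ` subspace_through e \<xi>\<^sub>0 \<theta> g"
proof -
  have "(a ** g) *v e - a *v \<theta> = a *v (g *v e - \<theta>)"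
    by (simp add: matrix_vector_mult_diff_distrib matrix_vector_mul_assoc)
  then have "householder ((a ** g) *v e - a *v \<theta>) ** (a ** g) = a ** (householder (g *v e - \<theta>) ** g)"
    using householder_conj[OF assms, of "g *v e - \<theta>"] by (simp add: matrix_mul_assoc)
  then show ?thesis by (simp add: subspace_through_def image_matrix_mult)
qed

lemma subspace_through_measurable:
  assumes [measurable]: "f \<in> borel_measurable M" "h \<in> borel_measurable M"
    and h: "\<And>x. x \<in> space M \<Longrightarrow> orthogonal_matrix (h x)"
  shows "(\<lambda>x. subspace_through e \<xi>\<^sub>0 (f x) (h x)) \<in> measurable M (borel_of (grassmannian (dim \<xi>\<^sub>0)))"
proof (rule measurable_into_grassmannian)
  let ?B = "\<lambda>x. householder (h x *v e - f x) ** h x"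
  have "(\<lambda>x. ?B x ** proj_matrix \<xi>\<^sub>0 ** transpose (?B x)) \<in> borel_measurable M" by measurable
  then show "(\<lambda>x. proj_matrix (subspace_through e \<xi>\<^sub>0 (f x) (h x))) \<in> borel_measurable M"
    unfolding subspace_through_def
    by (rule measurable_cong[THEN iffD1, rotated])
      (simp add: proj_matrix_orthogonal_image subspace_base h orthogonal_matrix_mul orthogonal_householder)
qed (use h subspace_through_Gr in auto)

lemma sphere_measure_eq: "sphere_measure = distr haar (borel_of sphere_top) (\<lambda>g. g *v e)"
  unfolding sphere_measure_def sphere_top_eq_pullback
proof (rule invariant_prob_measure_eqI[OF invariant_measure_distr refl])
  show "(\<lambda>g. g *v e) \<in> measurable haar (borel_of (pullback_topology (sphere 0 1) (\<lambda>x. x) euclidean))"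
    using sphere_map_measurable by (simp add: sphere_top_eq_pullback)
  fix g :: "real^'n \<Rightarrow> real^'n" assume "g \<in> {(*v) A | A. rotation_matrix A}"
  then obtain A where "orthogonal_matrix A" "g = (*v) A" by (auto simp: rotation_matrix_def)
  then show "\<exists>a\<in>measurable haar haar. distr haar haar a = haar \<and> (AE x in haar. a x *v e = g (x *v e))"
    by (intro bexI[of _ "(**) A"]) (auto simp: haar_left haar_mult_measurable matrix_vector_mul_assoc)
qed (auto simp: isometric_transitive_sphere card_ge_2 haar.prob_space_axioms)

lemma grassmannian_measure_eq:
  "grassmannian_measure (dim \<xi>\<^sub>0) = distr haar (borel_of (grassmannian (dim \<xi>\<^sub>0))) (\<lambda>g. (*v) g ` \<xi>\<^sub>0)"
  unfolding grassmannian_measure_def grassmannian_eq_pullback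
proof (rule invariant_prob_measure_eqI[OF invariant_measure_distr refl])
  show "(\<lambda>g. (*v) g ` \<xi>\<^sub>0) \<in> measurable haar (borel_of (pullback_topology (Gr (dim \<xi>\<^sub>0)) proj_matrix euclidean))"
    using grassmannian_map_measurable by (simp add: grassmannian_eq_pullback)
  fix g :: "(real^'n) set \<Rightarrow> (real^'n) set" assume "g \<in> {(`) ((*v) A) | A. rotation_matrix A}"
  then obtain A where "orthogonal_matrix A" "g = (`) ((*v) A)" by (auto simp: rotation_matrix_def)
  then show "\<exists>a\<in>measurable haar haar. distr haar haar a = haar \<and> (AE x in haar. (*v) (a x) ` \<xi>\<^sub>0 = g ((*v) x ` \<xi>\<^sub>0))"
    by (intro bexI[of _ "(**) A"]) (auto simp: haar_left haar_mult_measurable image_matrix_mult)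
qed (auto simp: isometric_transitive_grassmannian dim_base haar.prob_space_axioms)

lemma subgrassmannian_measure_eq:
  assumes \<theta>: "norm \<theta> = 1"
  shows "subgrassmannian_measure (dim \<xi>\<^sub>0) \<theta> =
    distr haar (borel_of (subtopology (grassmannian (dim \<xi>\<^sub>0)) {\<xi>. \<theta> \<in> \<xi>})) (subspace_through e \<xi>\<^sub>0 \<theta>)"
  unfolding subgrassmannian_measure_def grassmannian_eq_pullback subtopology_pullback
proof (rule invariant_prob_measure_eqI[OF invariant_measure_distr refl])
  have "(\<lambda>g. subspace_through e \<xi>\<^sub>0 \<theta> g) \<in> measurable haar (borel_of (grassmannian (dim \<xi>\<^sub>0)))"
    by (rule subspace_through_measurable) auto
  from measurable_compose[OF this proj_matrix_borel]
  show "subspace_through e \<xi>\<^sub>0 \<theta> \<in> measurable haar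
      (borel_of (pullback_topology (Gr (dim \<xi>\<^sub>0) \<inter> {\<xi>. \<theta> \<in> \<xi>}) proj_matrix euclidean))"
    using subspace_through_Gr in_subspace_through \<theta> by (intro measurable_into_pullback) auto
  fix g :: "(real^'n) set \<Rightarrow> (real^'n) set" assume "g \<in> {(`) ((*v) A) | A. rotation_matrix A \<and> A *v \<theta> = \<theta>}"
  then obtain A where A: "orthogonal_matrix A" "A *v \<theta> = \<theta>" "g = (`) ((*v) A)" by (auto simp: rotation_matrix_def)
  have "subspace_through e \<xi>\<^sub>0 \<theta> (A ** x) = g (subspace_through e \<xi>\<^sub>0 \<theta> x)" for x
    using subspace_through_equivariant[OF A(1), of \<theta> x] A by simp
  then show "\<exists>a\<in>measurable haar haar. distr haar haar a = haar \<and>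
      (AE x in haar. subspace_through e \<xi>\<^sub>0 \<theta> (a x) = g (subspace_through e \<xi>\<^sub>0 \<theta> x))"
    using A by (intro bexI[of _ "(**) A"]) (auto simp: haar_left haar_mult_measurable)
qed (auto simp: isometric_transitive_subgrassmannian dim_base haar.prob_space_axioms)

lemma radon_dual_eq:
  assumes \<theta>: "norm \<theta> = 1" and \<phi>: "\<phi> \<in> borel_measurable (borel_of (grassmannian (dim \<xi>\<^sub>0)))"
  shows "radon_dual (dim \<xi>\<^sub>0) \<phi> \<theta> = (\<integral>g. \<phi> (subspace_through e \<xi>\<^sub>0 \<theta> g) \<partial>haar)"
proof -
  have "(\<lambda>g. subspace_through e \<xi>\<^sub>0 \<theta> g) \<in> measurable haar (borel_of (grassmannian (dim \<xi>\<^sub>0)))"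
    by (rule subspace_through_measurable) auto
  from measurable_compose[OF this proj_matrix_borel]
  have "subspace_through e \<xi>\<^sub>0 \<theta> \<in> measurable haar
      (borel_of (subtopology (grassmannian (dim \<xi>\<^sub>0)) {\<xi>. \<theta> \<in> \<xi>}))"
    unfolding grassmannian_eq_pullback subtopology_pullback
    using subspace_through_Gr in_subspace_through \<theta> by (intro measurable_into_pullback) auto
  moreover have "\<phi> \<in> borel_measurable (borel_of (subtopology (grassmannian (dim \<xi>\<^sub>0)) {\<xi>. \<theta> \<in> \<xi>}))"
    using \<phi> unfolding grassmannian_eq_pullback by (rule subtopology_measurable)
  ultimately show ?thesis
    unfolding radon_dual_def subgrassmannian_measure_eq[OF \<theta>] by (rule integral_distr)
qed

end

lemma flag_base_exists:
  assumes "0 < k" "k < CARD('n)"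
  shows "\<exists>e (\<xi>\<^sub>0 :: (real^'n) set). flag_base e \<xi>\<^sub>0 \<and> dim \<xi>\<^sub>0 = k"
proof -
  obtain \<xi> :: "(real^'n) set" where \<xi>: "subspace \<xi>" "dim \<xi> = k"
    using choose_subspace_of_subspace[of k "UNIV :: (real^'n) set"] assms by auto
  moreover obtain w where "w \<in> \<xi>" "norm w = 1"
    using unit_vector_in_subspace[of \<xi>] \<xi> assms by auto
  ultimately have "flag_base w \<xi>" using assms by unfold_locales auto
  then show ?thesis using \<xi> by blast
qed

subsection \<open>The invariant measure on a subsphere\<close>

definition unit_proj :: "real^'n^'n \<Rightarrow> real^'n \<Rightarrow> real^'n" where
  "unit_proj P x = (P *v x) /\<^sub>R norm (P *v x)"

lemma unit_proj_measurable [measurable (raw)]: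
  assumes [measurable]: "f \<in> borel_measurable M" "g \<in> borel_measurable M"
  shows "(\<lambda>x. unit_proj (f x) (g x)) \<in> borel_measurable M"
  unfolding unit_proj_def by measurable

lemma unit_proj_equivariant:
  assumes a: "orthogonal_matrix a" and \<xi>: "subspace \<xi>"
  shows "unit_proj (proj_matrix ((*v) a ` \<xi>)) (a *v x) = a *v unit_proj (proj_matrix \<xi>) x"
proof -
  have "proj_matrix ((*v) a ` \<xi>) *v (a *v x) = a *v (proj_matrix \<xi> *v x)"
    by (simp add: proj_matrix_orthogonal_image[OF a \<xi>] matrix_vector_mul_assoc[symmetric] orthogonal_matrix_cancel[OF a]
        del: transpose_matrix_vector)
  then show ?thesis by (simp add: unit_proj_def orthogonal_matrix_norm[OF a] matrix_vector_mult_scaleR)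
qed

lemma AE_unit_proj:
  fixes \<xi> :: "(real^'n) set"
  assumes \<xi>: "subspace \<xi>" "0 < dim \<xi>"
  shows "AE x in ball_measure. norm (unit_proj (proj_matrix \<xi>) x) = 1 \<and> unit_proj (proj_matrix \<xi>) x \<in> \<xi>"
proof -
  have sub: "subspace (\<xi>\<^sup>\<bottom>)" by (rule subspace_orthogonal_comp)
  have "dim \<xi> \<le> CARD('n)" using dim_subset_UNIV[of \<xi>] by simp
  then have "dim (\<xi>\<^sup>\<bottom>) < CARD('n)" using dim_orthogonal_comp[OF \<xi>(1)] \<xi>(2) by simp
  then have "negligible (\<xi>\<^sup>\<bottom>)" by (intro negligible_lowdim) simp
  moreover have "\<xi>\<^sup>\<bottom> \<in> sets borel" using closed_subspace[OF sub] by (rule borel_closed)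
  ultimately have "AE x in ball_measure. x \<notin> \<xi>\<^sup>\<bottom>" by (rule AE_ball_measure_negligible)
  then show ?thesis
  proof eventually_elim
    case (elim x)
    have "closest_point \<xi> x \<noteq> 0"
    proof
      assume "closest_point \<xi> x = 0"
      then have "z \<bullet> x = 0" if "z \<in> \<xi>" for z
        using inner_closest_point_subspace[OF \<xi>(1) that, of x] by (simp add: inner_commute)
      then show False using elim by (auto simp: orthogonal_comp_def orthogonal_def)
    qed
    then show ?case using \<xi> closest_point_in_subspace[OF \<xi>(1)]
      by (auto simp: unit_proj_def proj_matrix_mult subspace_scale)
  qed
qed

text \<open>Normalizing the projection of a uniform point of the ball gives the uniform distribution on the
  unit sphere of \<open>\<xi>\<close>.  The map \<open>T\<close> only replaces the value on the null set where the projection vanishes by a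
  point of that sphere.\<close>

lemma subsphere_measure_eq:
  fixes \<xi> :: "(real^'n) set"
  assumes \<xi>: "subspace \<xi>" "0 < dim \<xi>" "dim \<xi> < CARD('n)"
  defines "B \<equiv> borel_of (subtopology sphere_top \<xi>)"
  obtains T where "T \<in> measurable ball_measure B" "AE x in ball_measure. T x = unit_proj (proj_matrix \<xi>) x"
    "subsphere_measure \<xi> = distr ball_measure B T"
proof -
  define u where "u x = unit_proj (proj_matrix \<xi>) x" for x
  obtain y where y: "norm y = 1" "y \<in> \<xi>"
    using unit_vector_in_subspace[OF \<xi>(1,2)] by blast
  define T where "T x = (if norm (u x) = 1 \<and> u x \<in> \<xi> then u x else y)" for x
  have um [measurable]: "u \<in> borel_measurable borel" unfolding u_def[abs_def] by measurable
  have xi [measurable]: "\<xi> \<in> sets borel" using closed_subspace[OF \<xi>(1)] by (rule borel_closed)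
  have Tb: "T \<in> borel_measurable borel" unfolding T_def[abs_def] by measurable
  have B: "B = borel_of (pullback_topology (sphere 0 1 \<inter> \<xi>) (\<lambda>x. x) euclidean)"
    by (simp add: B_def sphere_top_eq_pullback subtopology_pullback)
  have T: "T \<in> measurable ball_measure B"
    unfolding B using y Tb by (intro measurable_into_pullback) (auto simp: T_def cong: measurable_cong_sets)
  have AET: "AE x in ball_measure. T x = unit_proj (proj_matrix \<xi>) x"
    using AE_unit_proj[OF \<xi>(1,2)] by eventually_elim (simp add: T_def u_def)
  have "subsphere_measure \<xi> = distr ball_measure B T"
    unfolding subsphere_measure_def B sphere_top_eq_pullback subtopology_pullback
  proof (rule invariant_prob_measure_eqI[OF invariant_measure_distr refl])
    show "T \<in> measurable ball_measure (borel_of (pullback_topology (sphere 0 1 \<inter> \<xi>) (\<lambda>x. x) euclidean))"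
      using T by (simp add: B)
    fix g :: "real^'n \<Rightarrow> real^'n" assume "g \<in> {(*v) A | A. rotation_matrix A \<and> (*v) A ` \<xi> = \<xi>}"
    then obtain A where A: "orthogonal_matrix A" "(*v) A ` \<xi> = \<xi>" "g = (*v) A" by (auto simp: rotation_matrix_def)
    have uA: "u (A *v x) = A *v u x" for x
      using unit_proj_equivariant[OF A(1) \<xi>(1), of x] A(2) by (simp add: u_def)
    have "AE x in ball_measure. T (A *v x) = g (T x)"
      using AE_unit_proj[OF \<xi>(1,2)]
    proof eventually_elim
      case (elim x)
      then have "norm (u x) = 1" "u x \<in> \<xi>" by (auto simp: u_def)
      moreover then have "A *v u x \<in> \<xi>" using A(2) by blast
      ultimately show ?case using A by (simp add: T_def uA orthogonal_matrix_norm)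
    qed
    moreover have m: "(*v) A \<in> measurable ball_measure ball_measure"
    proof -
      have "(*v) A \<in> borel_measurable borel" by measurable
      then show ?thesis by (simp cong: measurable_cong_sets)
    qed
    moreover have "distr ball_measure ball_measure ((*v) A) = ball_measure"
      using distr_ball_measure_orthogonal[OF A(1)] by (metis distr_cong sets_ball_measure)
    ultimately show "\<exists>a\<in>measurable ball_measure ball_measure. distr ball_measure ball_measure a = ball_measure \<and>
        (AE x in ball_measure. T (a x) = g (T x))" by blast
  qed (auto simp: isometric_transitive_subsphere \<xi> ball_measure.prob_space_axioms)
  then show thesis using that T AET by blast
qed

text \<open>Functions on the sphere are extended by \<open>0\<close>, so that they can be evaluated at
  \<open>unit_proj P x\<close>, which is the zero vector if the projection vanishes.\<close>

definition on_sphere :: "(real^'n \<Rightarrow> real) \<Rightarrow> real^'n \<Rightarrow> real" where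
  "on_sphere f y = (if norm y = 1 then f y else 0)"

lemma on_sphere_measurable:
  assumes "f \<in> borel_measurable (borel_of sphere_top)"
  shows "on_sphere f \<in> borel_measurable borel"
proof -
  have s: "sphere (0::real^'a) 1 = {x. norm x = 1}" by auto
  have "f \<in> borel_measurable (restrict_space borel {x. norm x = 1})"
    using assms unfolding measurable_cong_sets[OF sets_borel_of_sphere refl] s .
  then have "(\<lambda>y. if norm y = 1 then f y else 0) \<in> borel_measurable borel"
    by (subst measurable_If_restrict_space_iff) auto
  then show ?thesis by (simp add: on_sphere_def[abs_def])
qed

lemma radon_eq:
  fixes \<xi> :: "(real^'n) set"
  assumes \<xi>: "subspace \<xi>" "0 < dim \<xi>" "dim \<xi> < CARD('n)" and f: "f \<in> borel_measurable (borel_of sphere_top)"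
  shows "radon f \<xi> = (\<integral>x. on_sphere f (unit_proj (proj_matrix \<xi>) x) \<partial>ball_measure)"
proof -
  obtain T where T: "T \<in> measurable ball_measure (borel_of (subtopology sphere_top \<xi>))"
    "AE x in ball_measure. T x = unit_proj (proj_matrix \<xi>) x"
    "subsphere_measure \<xi> = distr ball_measure (borel_of (subtopology sphere_top \<xi>)) T"
    using subsphere_measure_eq[OF \<xi>] by blast
  have f': "f \<in> borel_measurable (borel_of (subtopology sphere_top \<xi>))"
    using f unfolding sphere_top_eq_pullback by (rule subtopology_measurable)
  have "radon f \<xi> = (\<integral>x. f (T x) \<partial>ball_measure)"
    unfolding radon_def T(3) using T(1) f' by (rule integral_distr)
  also have "\<dots> = (\<integral>x. on_sphere f (unit_proj (proj_matrix \<xi>) x) \<partial>ball_measure)"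
  proof (rule integral_cong_AE)
    show "(\<lambda>x. f (T x)) \<in> borel_measurable ball_measure" using measurable_compose[OF T(1) f'] .
    show "(\<lambda>x. on_sphere f (unit_proj (proj_matrix \<xi>) x)) \<in> borel_measurable ball_measure"
      by (rule measurable_compose[where g = "on_sphere f" and N = borel, OF _ on_sphere_measurable[OF f]]) measurable
    show "AE x in ball_measure. f (T x) = on_sphere f (unit_proj (proj_matrix \<xi>) x)"
      using T(2) AE_unit_proj[OF \<xi>(1,2)] by eventually_elim (simp add: on_sphere_def)
  qed
  finally show ?thesis .
qed

section \<open>Radon transforms of bounded Borel functions\<close>

text \<open>In dimensions strictly between \<open>0\<close> and \<open>n\<close> the transforms preserve this class, and its members are integrable over finite measures.
  It replaces the continuous functions because measurability of transforms is easier
  than continuity.\<close>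

definition bounded_borel :: "'a topology \<Rightarrow> ('a \<Rightarrow> real) \<Rightarrow> bool" where
  "bounded_borel T f \<longleftrightarrow> f \<in> borel_measurable (borel_of T) \<and> (\<exists>C. \<forall>x\<in>topspace T. \<bar>f x\<bar> \<le> C)"

lemma bounded_borel_measurable: "bounded_borel T f \<Longrightarrow> f \<in> borel_measurable (borel_of T)"
  by (simp add: bounded_borel_def)

lemma bounded_borel_bound:
  assumes "bounded_borel T f"
  obtains C where "0 \<le> C" "\<And>x. x \<in> topspace T \<Longrightarrow> \<bar>f x\<bar> \<le> C"
proof -
  obtain C where "\<And>x. x \<in> topspace T \<Longrightarrow> \<bar>f x\<bar> \<le> C" using assms by (auto simp: bounded_borel_def)
  then show thesis using that[of "max 0 C"] by fastforce
qed

lemma bounded_borel_mult: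
  assumes "bounded_borel T f" "bounded_borel T g"
  shows "bounded_borel T (\<lambda>x. f x * g x)"
proof -
  obtain C where C: "0 \<le> C" "\<And>x. x \<in> topspace T \<Longrightarrow> \<bar>f x\<bar> \<le> C" using bounded_borel_bound[OF assms(1)] by blast
  obtain D where D: "0 \<le> D" "\<And>x. x \<in> topspace T \<Longrightarrow> \<bar>g x\<bar> \<le> D" using bounded_borel_bound[OF assms(2)] by blast
  have "\<bar>f x * g x\<bar> \<le> C * D" if "x \<in> topspace T" for x
    using C D that by (simp add: abs_mult mult_mono)
  then show ?thesis using assms by (auto simp: bounded_borel_def)
qed

lemma bounded_borel_diff:
  assumes "bounded_borel T f" "bounded_borel T g"
  shows "bounded_borel T (\<lambda>x. f x - g x)"
proof -
  obtain C where C: "0 \<le> C" "\<And>x. x \<in> topspace T \<Longrightarrow> \<bar>f x\<bar> \<le> C" using bounded_borel_bound[OF assms(1)] by blast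
  obtain D where D: "0 \<le> D" "\<And>x. x \<in> topspace T \<Longrightarrow> \<bar>g x\<bar> \<le> D" using bounded_borel_bound[OF assms(2)] by blast
  have "\<bar>f x - g x\<bar> \<le> C + D" if "x \<in> topspace T" for x
    using C(2)[OF that] D(2)[OF that] by linarith
  then show ?thesis using assms by (auto simp: bounded_borel_def)
qed

lemma bounded_borel_compose:
  assumes \<phi>: "bounded_borel T \<phi>" and T: "f \<in> measurable (borel_of S) (borel_of T)"
  shows "bounded_borel S (\<lambda>x. \<phi> (f x))"
  using measurable_compose[OF T bounded_borel_measurable[OF \<phi>]] measurable_space[OF T] \<phi>
  by (auto simp: bounded_borel_def)

lemma (in finite_measure) integrable_bounded_compose:
  assumes \<phi>: "bounded_borel T \<phi>" and f: "f \<in> measurable M (borel_of T)"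
  shows "integrable M (\<lambda>x. \<phi> (f x))"
proof -
  obtain C where C: "\<And>x. x \<in> topspace T \<Longrightarrow> \<bar>\<phi> x\<bar> \<le> C" using \<phi> by (auto simp: bounded_borel_def)
  show ?thesis
  proof (rule integrable_const_bound[of _ C])
    show "AE x in M. norm (\<phi> (f x)) \<le> C" using C measurable_space[OF f] by (intro AE_I2) auto
    show "(\<lambda>x. \<phi> (f x)) \<in> borel_measurable M"
      using measurable_compose[OF f bounded_borel_measurable[OF \<phi>]] .
  qed
qed

lemma integrable_bounded_borel:
  assumes "M \<in> finite_borel_measures T" "bounded_borel T f"
  shows "integrable M f"
proof -
  interpret finite_measure M using assms by (simp add: finite_borel_measures_def)
  have "sets (borel_of T) = sets M" using assms by (simp add: finite_borel_measures_def)
  then have "(\<lambda>x. x) \<in> measurable M (borel_of T)" by (rule measurable_ident_sets[OF sym])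
  from integrable_bounded_compose[OF assms(2) this] show ?thesis .
qed

lemma space_finite_borel_measure: "M \<in> finite_borel_measures T \<Longrightarrow> space M = topspace T"
  using sets_eq_imp_space_eq[of M "borel_of T"] by (simp add: finite_borel_measures_def)

lemma bounded_borel_continuous:
  assumes "continuous_map T euclideanreal f" "compact_space T"
  shows "bounded_borel T f"
proof -
  have "compact (f ` topspace T)"
    using image_compactin[OF _ assms(1), of "topspace T"] assms(2) by (simp add: compact_space_def)
  then have "bounded (f ` topspace T)" by (rule compact_imp_bounded)
  then show ?thesis
    using continuous_map_borel_measurable[OF assms(1)] by (auto simp: bounded_borel_def bounded_iff)
qed

lemma integral_prob_bound:
  fixes f :: "'a \<Rightarrow> real"
  assumes "prob_space M" "\<And>x. x \<in> space M \<Longrightarrow> \<bar>f x\<bar> \<le> C" "0 \<le> C"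
  shows "\<bar>\<integral>x. f x \<partial>M\<bar> \<le> C"
proof (cases "integrable M f")
  case True
  interpret prob_space M by fact
  have "\<bar>\<integral>x. f x \<partial>M\<bar> \<le> (\<integral>x. \<bar>f x\<bar> \<partial>M)" by (rule integral_abs_bound)
  also have "\<dots> \<le> (\<integral>x. C \<partial>M)" using True assms by (intro integral_mono) auto
  finally show ?thesis by (simp add: prob_space)
qed (use assms in \<open>simp add: not_integrable_integral_eq\<close>)

lemma fubini_bounded:
  fixes f :: "'a \<Rightarrow> 'b \<Rightarrow> real"
  assumes "finite_measure M" "finite_measure N"
    and m: "(\<lambda>(x, y). f x y) \<in> borel_measurable (M \<Otimes>\<^sub>M N)"
    and b: "\<And>x y. x \<in> space M \<Longrightarrow> y \<in> space N \<Longrightarrow> \<bar>f x y\<bar> \<le> C"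
  shows "(\<integral>z. f (fst z) (snd z) \<partial>(M \<Otimes>\<^sub>M N)) = (\<integral>x. \<integral>y. f x y \<partial>N \<partial>M)"
    and "(\<integral>x. \<integral>y. f x y \<partial>N \<partial>M) = (\<integral>y. \<integral>x. f x y \<partial>M \<partial>N)"
proof -
  interpret M: finite_measure M by fact
  interpret N: finite_measure N by fact
  interpret P: pair_sigma_finite M N ..
  interpret P: finite_measure "M \<Otimes>\<^sub>M N" using assms(2,1) by (intro finite_measure_pair_measure)
  have i: "integrable (M \<Otimes>\<^sub>M N) (\<lambda>(x, y). f x y)"
    using m b by (intro P.integrable_const_bound[of _ C]) (auto simp: space_pair_measure intro!: AE_I2)
  then show "(\<integral>z. f (fst z) (snd z) \<partial>(M \<Otimes>\<^sub>M N)) = (\<integral>x. \<integral>y. f x y \<partial>N \<partial>M)"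
    using P.integral_fst'[OF i] by (simp add: case_prod_beta')
  show "(\<integral>x. \<integral>y. f x y \<partial>N \<partial>M) = (\<integral>y. \<integral>x. f x y \<partial>M \<partial>N)"
    using P.Fubini_integral[OF i] by simp
qed

subsection \<open>Compactness\<close>

lemma compact_orthogonal_group: "compact (orthogonal_group :: (real^'n^'n) set)"
proof -
  have "norm A = norm (mat 1 :: real^'n^'n)" if "orthogonal_matrix A" for A :: "real^'n^'n"
    using norm_orthogonal_matrix_mult_left[OF that, of "mat 1"] by simp
  then have "bounded (orthogonal_group :: (real^'n^'n) set)" by (auto simp: bounded_iff)
  then show ?thesis using closed_orthogonal_matrices by (simp add: compact_eq_bounded_closed)
qed

lemma continuous_map_grassmannian_orbit:
  assumes \<xi>: "\<xi> \<in> Gr k"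
  shows "continuous_map (top_of_set orthogonal_group) (grassmannian k) (\<lambda>g. (*v) g ` \<xi>)"
  unfolding grassmannian_eq_pullback
proof (rule continuous_map_pullback')
  have "continuous_on orthogonal_group (\<lambda>g. g ** proj_matrix \<xi> ** transpose g)"
    by (intro continuous_on_matrix_mult continuous_on_transpose continuous_intros)
  then have "continuous_on orthogonal_group (proj_matrix \<circ> (\<lambda>g. (*v) g ` \<xi>))"
    by (rule continuous_on_cong[THEN iffD1, rotated -1]) (use \<xi> in \<open>auto simp: proj_matrix_orthogonal_image Gr_def\<close>)
  then show "continuous_map (top_of_set orthogonal_group) euclidean (proj_matrix \<circ> (\<lambda>g. (*v) g ` \<xi>))" by simp
  show "topspace (top_of_set orthogonal_group) \<subseteq> (\<lambda>g. (*v) g ` \<xi>) -` Gr k"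
    using Gr_orthogonal_image[OF _ \<xi>] by auto
qed

lemma compact_space_sphere: "compact_space sphere_top"
  by (simp add: sphere_top_def compact_space_subtopology)

lemma compact_space_grassmannian:
  assumes "k < CARD('n)"
  shows "compact_space (grassmannian k :: (real^'n) set topology)"
proof (cases "(Gr k :: (real^'n) set set) = {}")
  case True
  then show ?thesis by (simp add: compact_space_def)
next
  case False
  then obtain \<xi> :: "(real^'n) set" where \<xi>: "\<xi> \<in> Gr k" by blast
  have "Gr k \<subseteq> (\<lambda>g. (*v) g ` \<xi>) ` orthogonal_group"
    using rotation_between_subspaces[OF \<xi> _ assms] by (force simp: rotation_matrix_def)
  then have "(\<lambda>g. (*v) g ` \<xi>) ` orthogonal_group = Gr k" using Gr_orthogonal_image[OF _ \<xi>] by auto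
  moreover have "compactin (top_of_set orthogonal_group) (orthogonal_group :: (real^'n^'n) set)"
    using compact_orthogonal_group by (simp add: compactin_subtopology)
  ultimately show ?thesis
    using image_compactin[OF _ continuous_map_grassmannian_orbit[OF \<xi>]] by (metis compact_space_def topspace_grassmannian)
qed

subsection \<open>The transforms preserve bounded Borel functions\<close>

lemma on_sphere_abs_le:
  assumes "\<And>x. x \<in> topspace sphere_top \<Longrightarrow> \<bar>f x\<bar> \<le> C" "0 \<le> C"
  shows "\<bar>on_sphere f y\<bar> \<le> C"
  using assms by (auto simp: on_sphere_def)

lemma radon_bounded_borel:
  assumes f: "bounded_borel sphere_top f" and k: "0 < k" "k < CARD('n)"
  shows "bounded_borel (grassmannian k :: (real^'n) set topology) (radon f)"
proof -
  let ?G = "grassmannian k :: (real^'n) set topology"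
  note fm = bounded_borel_measurable[OF f]
  have eq: "radon f \<xi> = (\<integral>x. on_sphere f (unit_proj (proj_matrix \<xi>) x) \<partial>ball_measure)" if "\<xi> \<in> Gr k" for \<xi>
    using radon_eq[OF _ _ _ fm] that k by (auto simp: Gr_def)
  have [measurable]: "on_sphere f \<in> borel_measurable borel" by (rule on_sphere_measurable[OF fm])
  have "(\<lambda>(\<xi>, x). on_sphere f (unit_proj (proj_matrix \<xi>) x)) \<in> borel_measurable (borel_of ?G \<Otimes>\<^sub>M ball_measure)"
    by measurable
  then have "(\<lambda>\<xi>. \<integral>x. on_sphere f (unit_proj (proj_matrix \<xi>) x) \<partial>ball_measure) \<in> borel_measurable (borel_of ?G)"
    using ball_measure.borel_measurable_lebesgue_integral by blast
  then have m: "radon f \<in> borel_measurable (borel_of ?G)"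
    by (rule measurable_cong[THEN iffD1, rotated]) (simp add: eq)
  obtain C where C: "0 \<le> C" "\<And>x. x \<in> topspace sphere_top \<Longrightarrow> \<bar>f x\<bar> \<le> C" using bounded_borel_bound[OF f] by blast
  have "\<bar>radon f \<xi>\<bar> \<le> C" if "\<xi> \<in> Gr k" for \<xi>
    unfolding eq[OF that]
    using on_sphere_abs_le[OF C(2) C(1)] C(1) by (intro integral_prob_bound ball_measure.prob_space_axioms) auto
  then show ?thesis unfolding bounded_borel_def using m by (intro conjI exI[of _ C]) auto
qed

lemma radon_dual_bounded_borel:
  assumes \<phi>: "bounded_borel (grassmannian k :: (real^'n) set topology) \<phi>" and k: "0 < k" "k < CARD('n)"
  shows "bounded_borel sphere_top (radon_dual k \<phi>)"
proof -
  obtain e and \<xi>\<^sub>0 :: "(real^'n) set" where "flag_base e \<xi>\<^sub>0" and d: "dim \<xi>\<^sub>0 = k" using flag_base_exists[OF k] by blast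
  interpret flag_base e \<xi>\<^sub>0 by fact
  note pm = bounded_borel_measurable[OF \<phi>]
  have eq: "radon_dual k \<phi> \<theta> = (\<integral>g. \<phi> (subspace_through e \<xi>\<^sub>0 \<theta> g) \<partial>haar)" if "norm \<theta> = 1" for \<theta>
    using radon_dual_eq[OF that] pm d by simp
  have sm: "(\<lambda>z. subspace_through e \<xi>\<^sub>0 (fst z) (snd z)) \<in> measurable (borel_of sphere_top \<Otimes>\<^sub>M haar) (borel_of (grassmannian k))"
    unfolding d[symmetric]
    by (rule subspace_through_measurable)
      (auto simp: space_pair_measure intro: measurable_compose[OF measurable_fst sphere_borel] measurable_compose[OF measurable_snd haar_borel])
  have "(\<lambda>(\<theta>, g). \<phi> (subspace_through e \<xi>\<^sub>0 \<theta> g)) \<in> borel_measurable (borel_of sphere_top \<Otimes>\<^sub>M haar)"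
    using measurable_compose[OF sm pm] by (simp add: split_beta)
  then have "(\<lambda>\<theta>. \<integral>g. \<phi> (subspace_through e \<xi>\<^sub>0 \<theta> g) \<partial>haar) \<in> borel_measurable (borel_of sphere_top)"
    using haar.borel_measurable_lebesgue_integral by blast
  then have m: "radon_dual k \<phi> \<in> borel_measurable (borel_of sphere_top)"
    by (rule measurable_cong[THEN iffD1, rotated]) (simp add: eq)
  obtain C where C: "0 \<le> C" "\<And>\<xi>. \<xi> \<in> topspace (grassmannian k) \<Longrightarrow> \<bar>\<phi> \<xi>\<bar> \<le> C" using bounded_borel_bound[OF \<phi>] by blast
  have "\<bar>radon_dual k \<phi> \<theta>\<bar> \<le> C" if "norm \<theta> = 1" for \<theta>
    unfolding eq[OF that]
    using C subspace_through_Gr d by (intro integral_prob_bound haar.prob_space_axioms) auto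
  then show ?thesis unfolding bounded_borel_def using m by (intro conjI exI[of _ C]) auto
qed

lemma perp_measurable:
  "orthogonal_comp \<in> measurable (borel_of (grassmannian k)) (borel_of (grassmannian (CARD('n) - k) :: (real^'n) set topology))"
proof (rule measurable_into_grassmannian)
  have "(\<lambda>\<xi>. mat 1 - proj_matrix \<xi>) \<in> borel_measurable (borel_of (grassmannian k :: (real^'n) set topology))" by measurable
  then show "(\<lambda>\<xi>. proj_matrix (\<xi>\<^sup>\<bottom>)) \<in> borel_measurable (borel_of (grassmannian k :: (real^'n) set topology))"
    by (rule measurable_cong[THEN iffD1, rotated]) (simp add: proj_matrix_orthogonal_comp Gr_def)
qed (simp add: Gr_orthogonal_comp)

lemma perp_measurable':
  assumes "i \<le> CARD('n)"
  shows "orthogonal_comp \<in> measurable (borel_of (grassmannian (CARD('n) - i))) (borel_of (grassmannian i :: (real^'n) set topology))"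
  using perp_measurable[where 'n='n and k="CARD('n) - i"] assms by simp

lemma image_measurable:
  assumes a: "orthogonal_matrix (a :: real^'n^'n)"
  shows "(`) ((*v) a) \<in> measurable (borel_of (grassmannian k)) (borel_of (grassmannian k))"
proof (rule measurable_into_grassmannian)
  have "(\<lambda>\<xi>. a ** proj_matrix \<xi> ** transpose a) \<in> borel_measurable (borel_of (grassmannian k))" by measurable
  then show "(\<lambda>\<xi>. proj_matrix ((*v) a ` \<xi>)) \<in> borel_measurable (borel_of (grassmannian k))"
    by (rule measurable_cong[THEN iffD1, rotated]) (simp add: proj_matrix_orthogonal_image a Gr_def)
qed (simp add: Gr_orthogonal_image a)

lemma orthogonal_sphere_measurable:
  assumes a: "orthogonal_matrix (a :: real^'n^'n)"
  shows "(*v) a \<in> measurable (borel_of sphere_top) (borel_of sphere_top)"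
proof (rule measurable_into_sphere)
  have "(\<lambda>x. a *v x) \<in> borel_measurable borel" by measurable
  then show "(*v) a \<in> borel_measurable (borel_of sphere_top)" by (rule measurable_compose[OF sphere_borel])
qed (simp add: orthogonal_matrix_norm a)

subsection \<open>Equivariance\<close>

lemma radon_dual_cong:
  assumes k: "0 < k" "k < CARD('n)"
    and \<phi>: "bounded_borel (grassmannian k :: (real^'n) set topology) \<phi>"
    and \<psi>: "bounded_borel (grassmannian k :: (real^'n) set topology) \<psi>"
    and eq: "\<And>\<xi>. \<xi> \<in> Gr k \<Longrightarrow> \<phi> \<xi> = \<psi> \<xi>" and \<theta>: "norm \<theta> = 1"
  shows "radon_dual k \<phi> \<theta> = radon_dual k \<psi> \<theta>"
proof -
  obtain e and \<xi>\<^sub>0 :: "(real^'n) set" where "flag_base e \<xi>\<^sub>0" and d: "dim \<xi>\<^sub>0 = k" using flag_base_exists[OF k] by blast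
  interpret flag_base e \<xi>\<^sub>0 by fact
  show ?thesis
    using radon_dual_eq[OF \<theta>] \<phi>[THEN bounded_borel_measurable] \<psi>[THEN bounded_borel_measurable] d eq subspace_through_Gr
    by (auto intro!: Bochner_Integration.integral_cong)
qed

lemma radon_cong:
  assumes \<xi>: "\<xi> \<in> Gr k" and k: "0 < k" "k < CARD('n)"
    and f: "bounded_borel sphere_top f" and g: "bounded_borel sphere_top g"
    and eq: "\<And>x :: real^'n. norm x = 1 \<Longrightarrow> f x = g x"
  shows "radon f \<xi> = radon g \<xi>"
proof -
  have "on_sphere f = on_sphere g" using eq by (auto simp: on_sphere_def)
  then show ?thesis
    using radon_eq[of \<xi> f] radon_eq[of \<xi> g] \<xi> k f g by (simp add: Gr_def bounded_borel_measurable)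
qed

lemma radon_equivariant:
  assumes a: "orthogonal_matrix (a :: real^'n^'n)" and \<xi>: "\<xi> \<in> Gr k" and k: "0 < k" "k < CARD('n)"
    and f: "bounded_borel sphere_top f"
  shows "radon f ((*v) a ` \<xi>) = radon (\<lambda>x. f (a *v x)) \<xi>"
proof -
  note fm = bounded_borel_measurable[OF f]
  have fa: "bounded_borel sphere_top (\<lambda>x. f (a *v x))"
    by (rule bounded_borel_compose[OF f orthogonal_sphere_measurable[OF a]])
  have \<xi>': "subspace \<xi>" "dim \<xi> = k" using \<xi> by (auto simp: Gr_def)
  let ?F = "\<lambda>x. on_sphere f (unit_proj (proj_matrix ((*v) a ` \<xi>)) x)"
  have [measurable]: "on_sphere f \<in> borel_measurable borel" by (rule on_sphere_measurable[OF fm])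
  have "radon f ((*v) a ` \<xi>) = (\<integral>x. ?F x \<partial>distr ball_measure borel ((*v) a))"
    unfolding distr_ball_measure_orthogonal[OF a]
    using a \<xi>' k by (intro radon_eq fm) (auto simp: subspace_orthogonal_image dim_orthogonal_image)
  also have "\<dots> = (\<integral>x. ?F (a *v x) \<partial>ball_measure)"
    by (rule integral_distr) measurable
  also have "\<dots> = (\<integral>x. on_sphere (\<lambda>x. f (a *v x)) (unit_proj (proj_matrix \<xi>) x) \<partial>ball_measure)"
    by (simp add: unit_proj_equivariant[OF a \<xi>'(1)] on_sphere_def orthogonal_matrix_norm[OF a])
  also have "\<dots> = radon (\<lambda>x. f (a *v x)) \<xi>"
    using radon_eq[OF \<xi>'(1) _ _ bounded_borel_measurable[OF fa]] \<xi>'(2) k by simp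
  finally show ?thesis .
qed

lemma radon_dual_equivariant:
  assumes a: "orthogonal_matrix (a :: real^'n^'n)" and k: "0 < k" "k < CARD('n)"
    and \<phi>: "bounded_borel (grassmannian k) \<phi>" and \<theta>: "norm \<theta> = 1"
  shows "radon_dual k \<phi> (a *v \<theta>) = radon_dual k (\<lambda>\<xi>. \<phi> ((*v) a ` \<xi>)) \<theta>"
proof -
  obtain e and \<xi>\<^sub>0 :: "(real^'n) set" where "flag_base e \<xi>\<^sub>0" and d: "dim \<xi>\<^sub>0 = k" using flag_base_exists[OF k] by blast
  interpret flag_base e \<xi>\<^sub>0 by fact
  note pm = bounded_borel_measurable[OF \<phi>]
  have \<phi>a: "bounded_borel (grassmannian k) (\<lambda>\<xi>. \<phi> ((*v) a ` \<xi>))"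
    by (rule bounded_borel_compose[OF \<phi> image_measurable[OF a]])
  have sm: "(\<lambda>g. subspace_through e \<xi>\<^sub>0 (a *v \<theta>) g) \<in> measurable haar (borel_of (grassmannian k))"
    unfolding d[symmetric] by (rule subspace_through_measurable) auto
  have "radon_dual k \<phi> (a *v \<theta>) = (\<integral>g. \<phi> (subspace_through e \<xi>\<^sub>0 (a *v \<theta>) g) \<partial>haar)"
    using radon_dual_eq[of "a *v \<theta>" \<phi>] pm d \<theta> by (simp add: orthogonal_matrix_norm[OF a])
  also have "\<dots> = (\<integral>g. \<phi> (subspace_through e \<xi>\<^sub>0 (a *v \<theta>) (a ** g)) \<partial>haar)"
    by (rule integral_haar_left[OF a measurable_compose[OF sm pm], symmetric])
  also have "\<dots> = radon_dual k (\<lambda>\<xi>. \<phi> ((*v) a ` \<xi>)) \<theta>"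
    using radon_dual_eq[OF \<theta>, of "\<lambda>\<xi>. \<phi> ((*v) a ` \<xi>)"] bounded_borel_measurable[OF \<phi>a] d
    by (simp add: subspace_through_equivariant[OF a])
  finally show ?thesis .
qed

lemma integral_sphere_measure:
  fixes f :: "real^'n \<Rightarrow> real"
  assumes "flag_base e (\<xi>\<^sub>0 :: (real^'n) set)" "f \<in> borel_measurable (borel_of sphere_top)"
  shows "(\<integral>\<theta>. f \<theta> \<partial>sphere_measure) = (\<integral>g. f (g *v e) \<partial>haar)"
  using flag_base.sphere_measure_eq[OF assms(1)]
    integral_distr[OF flag_base.sphere_map_measurable[OF assms(1)] assms(2)] by simp

lemma integral_grassmannian_measure:
  fixes \<phi> :: "(real^'n) set \<Rightarrow> real"
  assumes "flag_base e (\<xi>\<^sub>0 :: (real^'n) set)" "\<phi> \<in> borel_measurable (borel_of (grassmannian (dim \<xi>\<^sub>0)))"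
  shows "(\<integral>\<xi>. \<phi> \<xi> \<partial>grassmannian_measure (dim \<xi>\<^sub>0)) = (\<integral>g. \<phi> ((*v) g ` \<xi>\<^sub>0) \<partial>haar)"
  using flag_base.grassmannian_measure_eq[OF assms(1)]
    integral_distr[OF flag_base.grassmannian_map_measurable[OF assms(1)] assms(2)] by simp

lemma sphere_measure_finite_borel:
  assumes "CARD('n) \<ge> 2"
  shows "(sphere_measure :: (real^'n) measure) \<in> finite_borel_measures sphere_top"
proof -
  obtain e and \<xi>\<^sub>0 :: "(real^'n) set" where "flag_base e \<xi>\<^sub>0" using flag_base_exists[where 'n='n and k=1] assms by auto
  then interpret flag_base e \<xi>\<^sub>0 .
  show ?thesis
    unfolding sphere_measure_eq finite_borel_measures_def
    using haar.prob_space_distr[OF sphere_map_measurable] by (auto simp: prob_space_def)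
qed

lemma grassmannian_measure_finite_borel:
  assumes "0 < k" "k < CARD('n)"
  shows "(grassmannian_measure k :: (real^'n) set measure) \<in> finite_borel_measures (grassmannian k)"
proof -
  obtain e and \<xi>\<^sub>0 :: "(real^'n) set" where "flag_base e \<xi>\<^sub>0" and d: "dim \<xi>\<^sub>0 = k" using flag_base_exists[OF assms] by blast
  then interpret flag_base e \<xi>\<^sub>0 by simp
  show ?thesis
    unfolding grassmannian_measure_eq[unfolded d] finite_borel_measures_def
    using haar.prob_space_distr[OF grassmannian_map_measurable[unfolded d]] by (auto simp: prob_space_def)
qed

lemma integral_sphere_orthogonal:
  fixes f :: "real^'n \<Rightarrow> real"
  assumes a: "orthogonal_matrix (a :: real^'n^'n)" and n: "CARD('n) \<ge> 2" and f: "f \<in> borel_measurable (borel_of sphere_top)"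
  shows "(\<integral>\<theta>. f (a *v \<theta>) \<partial>sphere_measure) = (\<integral>\<theta>. f \<theta> \<partial>sphere_measure)"
proof -
  obtain e and \<xi>\<^sub>0 :: "(real^'n) set" where fb: "flag_base e \<xi>\<^sub>0" using flag_base_exists[where 'n='n and k=1] n by auto
  have "(\<integral>\<theta>. f (a *v \<theta>) \<partial>sphere_measure) = (\<integral>g. f ((a ** g) *v e) \<partial>haar)"
    using integral_sphere_measure[OF fb measurable_compose[OF orthogonal_sphere_measurable[OF a] f]]
    by (simp add: matrix_vector_mul_assoc)
  also have "\<dots> = (\<integral>g. f (g *v e) \<partial>haar)"
    by (rule integral_haar_left[OF a measurable_compose[OF flag_base.sphere_map_measurable[OF fb] f]])
  finally show ?thesis using integral_sphere_measure[OF fb f] by simp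
qed

subsection \<open>Duality\<close>

text \<open>Both sides equal the integral of \<open>\<phi> (h \<xi>\<^sub>0) * f (h e)\<close> over \<open>h\<close> with respect to Haar measure.  In each iterated
  integral the pair of a subspace and a unit vector in it has the form \<open>(h b \<xi>\<^sub>0, h b e)\<close> with \<open>h\<close>
  Haar distributed and \<open>b\<close> independent of \<open>h\<close>, and right invariance removes \<open>b\<close>.\<close>

theorem radon_duality:
  fixes f :: "real^'n \<Rightarrow> real"
  assumes k: "0 < k" "k < CARD('n)" and f: "bounded_borel sphere_top f" and \<phi>: "bounded_borel (grassmannian k) \<phi>"
  shows "(\<integral>\<xi>. \<phi> \<xi> * radon f \<xi> \<partial>grassmannian_measure k) = (\<integral>\<theta>. f \<theta> * radon_dual k \<phi> \<theta> \<partial>sphere_measure)"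
proof -
  obtain e and \<xi>\<^sub>0 :: "(real^'n) set" where fb: "flag_base e \<xi>\<^sub>0" and d: "dim \<xi>\<^sub>0 = k" using flag_base_exists[OF k] by blast
  interpret flag_base e \<xi>\<^sub>0 by (rule fb)
  have \<xi>\<^sub>0: "\<xi>\<^sub>0 \<in> Gr k" using base_Gr d by simp
  note fm = bounded_borel_measurable[OF f] and pm = bounded_borel_measurable[OF \<phi>]
  have ofm [measurable]: "on_sphere f \<in> borel_measurable borel" by (rule on_sphere_measurable[OF fm])
  obtain C where C: "0 \<le> C" "\<And>x. x \<in> topspace sphere_top \<Longrightarrow> \<bar>f x\<bar> \<le> C" using bounded_borel_bound[OF f] by blast
  obtain D where D: "0 \<le> D" "\<And>\<xi>. \<xi> \<in> topspace (grassmannian k) \<Longrightarrow> \<bar>\<phi> \<xi>\<bar> \<le> D" using bounded_borel_bound[OF \<phi>] by blast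
  have gm: "(\<lambda>h. (*v) h ` \<xi>\<^sub>0) \<in> measurable haar (borel_of (grassmannian k))"
    using grassmannian_map_measurable d by simp
  have phm [measurable]: "(\<lambda>h. \<phi> ((*v) h ` \<xi>\<^sub>0)) \<in> borel_measurable haar"
    by (rule measurable_compose[OF gm pm])
  define c where "c = (\<integral>h. \<phi> ((*v) h ` \<xi>\<^sub>0) * on_sphere f (h *v e) \<partial>haar)"
  have cm: "(\<lambda>h. \<phi> ((*v) h ` \<xi>\<^sub>0) * on_sphere f (h *v e)) \<in> borel_measurable haar" by measurable
  have c_right: "(\<integral>h. \<phi> ((*v) (h ** b) ` \<xi>\<^sub>0) * on_sphere f ((h ** b) *v e) \<partial>haar) = c"
    if "orthogonal_matrix b" for b
    unfolding c_def by (rule integral_haar_right[OF that cm])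
  have osC: "\<bar>on_sphere f y\<bar> \<le> C" for y by (rule on_sphere_abs_le) (use C in auto)
  have bound: "\<bar>\<phi> \<xi> * on_sphere f y\<bar> \<le> D * C" if "\<xi> \<in> Gr k" for \<xi> y
    using D(2)[of \<xi>] osC[of y] that D(1) C(1) by (simp add: abs_mult mult_mono)
  have fin: "finite_measure haar" "finite_measure ball_measure"
    by (rule haar.finite_measure_axioms, rule ball_measure.finite_measure_axioms)

  \<comment> \<open>left side: for fixed \<open>x\<close> the point \<open>?u x\<close> is \<open>b e\<close> for a reflection \<open>b\<close> that maps \<open>\<xi>\<^sub>0\<close> to itself\<close>
  let ?u = "unit_proj (proj_matrix \<xi>\<^sub>0)"
  have "(\<integral>\<xi>. \<phi> \<xi> * radon f \<xi> \<partial>grassmannian_measure k) = (\<integral>h. \<phi> ((*v) h ` \<xi>\<^sub>0) * radon f ((*v) h ` \<xi>\<^sub>0) \<partial>haar)"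
    using integral_grassmannian_measure[OF fb, of "\<lambda>\<xi>. \<phi> \<xi> * radon f \<xi>"]
      bounded_borel_measurable[OF bounded_borel_mult[OF \<phi> radon_bounded_borel[OF f k]]] d by simp
  also have "\<dots> = (\<integral>h. \<integral>x. \<phi> ((*v) h ` \<xi>\<^sub>0) * on_sphere f (h *v ?u x) \<partial>ball_measure \<partial>haar)"
  proof (rule Bochner_Integration.integral_cong[OF refl])
    fix h :: "real^'n^'n" assume "h \<in> space haar"
    then have h: "orthogonal_matrix h" by simp
    have fh: "bounded_borel sphere_top (\<lambda>x. f (h *v x))"
      by (rule bounded_borel_compose[OF f orthogonal_sphere_measurable[OF h]])
    have "radon f ((*v) h ` \<xi>\<^sub>0) = (\<integral>x. on_sphere f (h *v ?u x) \<partial>ball_measure)"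
      using radon_equivariant[OF h \<xi>\<^sub>0 k f] radon_eq[OF subspace_base _ _ bounded_borel_measurable[OF fh]] d k
      by (simp add: on_sphere_def orthogonal_matrix_norm[OF h])
    then show "\<phi> ((*v) h ` \<xi>\<^sub>0) * radon f ((*v) h ` \<xi>\<^sub>0) = (\<integral>x. \<phi> ((*v) h ` \<xi>\<^sub>0) * on_sphere f (h *v ?u x) \<partial>ball_measure)"
      by simp
  qed
  also have "\<dots> = (\<integral>x. \<integral>h. \<phi> ((*v) h ` \<xi>\<^sub>0) * on_sphere f (h *v ?u x) \<partial>haar \<partial>ball_measure)"
  proof (rule fubini_bounded(2)[OF fin, where C = "D * C"])
    show "(\<lambda>(h, x). \<phi> ((*v) h ` \<xi>\<^sub>0) * on_sphere f (h *v ?u x)) \<in> borel_measurable (haar \<Otimes>\<^sub>M ball_measure)"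
      by measurable
  qed (auto intro!: bound Gr_orthogonal_image \<xi>\<^sub>0)
  also have "\<dots> = (\<integral>x. c \<partial>(ball_measure :: (real^'n) measure))"
  proof (rule integral_cong_AE)
    show "AE x in ball_measure. (\<integral>h. \<phi> ((*v) h ` \<xi>\<^sub>0) * on_sphere f (h *v ?u x) \<partial>haar) = c"
      using AE_unit_proj[OF subspace_base dim_base_pos]
    proof eventually_elim
      case (elim x)
      define b where "b = householder (e - ?u x)"
      have b: "orthogonal_matrix b" by (simp add: b_def orthogonal_householder)
      have be: "b *v e = ?u x" using householder_swap(1)[of e "?u x"] elim norm_e by (simp add: b_def)
      have "(*v) b ` \<xi>\<^sub>0 = \<xi>\<^sub>0"
        using elim e_in subspace_base b
        by (intro orthogonal_image_eq_if_subset) (auto simp: b_def householder_mult subspace_diff subspace_scale)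
      then have "(*v) (h ** b) ` \<xi>\<^sub>0 = (*v) h ` \<xi>\<^sub>0" for h :: "real^'n^'n"
        by (simp add: image_matrix_mult)
      moreover have "(h ** b) *v e = h *v ?u x" for h :: "real^'n^'n"
        by (simp add: matrix_vector_mul_assoc[symmetric] be)
      ultimately show ?case using c_right[OF b] by simp
    qed
    have "(\<lambda>(x, h). \<phi> ((*v) h ` \<xi>\<^sub>0) * on_sphere f (h *v ?u x)) \<in> borel_measurable (ball_measure \<Otimes>\<^sub>M haar)"
      by measurable
    then show "(\<lambda>x. \<integral>h. \<phi> ((*v) h ` \<xi>\<^sub>0) * on_sphere f (h *v ?u x) \<partial>haar) \<in> borel_measurable ball_measure"
      using haar.borel_measurable_lebesgue_integral by blast
  qed simp
  also have "\<dots> = c" by (simp add: ball_measure.prob_space[unfolded space_ball_measure])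
  finally have lhs: "(\<integral>\<xi>. \<phi> \<xi> * radon f \<xi> \<partial>grassmannian_measure k) = c" .

  \<comment> \<open>right side: with \<open>\<theta> = h e\<close> and \<open>g\<close> replaced by \<open>h g\<close>, the subspace through \<open>\<theta>\<close> is \<open>h (?B g) \<xi>\<^sub>0\<close>, where \<open>?B g\<close> fixes \<open>e\<close>\<close>
  let ?B = "\<lambda>g. householder (g *v e - e) ** g"
  have st: "subspace_through e \<xi>\<^sub>0 (h *v e) (h ** g) = (*v) h ` subspace_through e \<xi>\<^sub>0 e g"
    if "orthogonal_matrix h" for h g
    using subspace_through_equivariant[OF that] .
  have "(\<integral>\<theta>. f \<theta> * radon_dual k \<phi> \<theta> \<partial>sphere_measure) = (\<integral>h. f (h *v e) * radon_dual k \<phi> (h *v e) \<partial>haar)"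
    using integral_sphere_measure[OF fb bounded_borel_measurable[OF bounded_borel_mult[OF f radon_dual_bounded_borel[OF \<phi> k]]]] .
  also have "\<dots> = (\<integral>h. \<integral>g. \<phi> ((*v) (h ** ?B g) ` \<xi>\<^sub>0) * on_sphere f (h *v e) \<partial>haar \<partial>haar)"
  proof (rule Bochner_Integration.integral_cong[OF refl])
    fix h :: "real^'n^'n" assume "h \<in> space haar"
    then have h: "orthogonal_matrix h" by simp
    have he: "norm (h *v e) = 1" using h by (simp add: orthogonal_matrix_norm norm_e)
    have sm: "(\<lambda>g. subspace_through e \<xi>\<^sub>0 (h *v e) g) \<in> measurable haar (borel_of (grassmannian k))"
      unfolding d[symmetric] by (rule subspace_through_measurable) auto
    have "radon_dual k \<phi> (h *v e) = (\<integral>g. \<phi> (subspace_through e \<xi>\<^sub>0 (h *v e) g) \<partial>haar)"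
      using radon_dual_eq[OF he, of \<phi>] pm d by simp
    also have "\<dots> = (\<integral>g. \<phi> (subspace_through e \<xi>\<^sub>0 (h *v e) (h ** g)) \<partial>haar)"
      by (rule integral_haar_left[OF h measurable_compose[OF sm pm], symmetric])
    also have "\<dots> = (\<integral>g. \<phi> ((*v) (h ** ?B g) ` \<xi>\<^sub>0) \<partial>haar)"
      unfolding st[OF h] by (simp add: subspace_through_def image_matrix_mult)
    finally show "f (h *v e) * radon_dual k \<phi> (h *v e) = (\<integral>g. \<phi> ((*v) (h ** ?B g) ` \<xi>\<^sub>0) * on_sphere f (h *v e) \<partial>haar)"
      using he by (simp add: on_sphere_def mult.commute)
  qed
  also have "\<dots> = (\<integral>g. \<integral>h. \<phi> ((*v) (h ** ?B g) ` \<xi>\<^sub>0) * on_sphere f (h *v e) \<partial>haar \<partial>haar)"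
  proof (rule fubini_bounded(2)[OF fin(1) fin(1), where C = "D * C"])
    have hB: "(\<lambda>z. fst z ** ?B (snd z)) \<in> measurable (haar \<Otimes>\<^sub>M haar) haar"
      by (rule measurable_into_haar)
        (auto simp: space_pair_measure intro!: orthogonal_matrix_mul orthogonal_householder)
    have [measurable]: "(\<lambda>z. \<phi> ((*v) (fst z ** ?B (snd z)) ` \<xi>\<^sub>0)) \<in> borel_measurable (haar \<Otimes>\<^sub>M haar)"
      using measurable_compose[OF hB phm] .
    show "(\<lambda>(h, g). \<phi> ((*v) (h ** ?B g) ` \<xi>\<^sub>0) * on_sphere f (h *v e)) \<in> borel_measurable (haar \<Otimes>\<^sub>M haar)"
      unfolding split_beta by measurable
  qed (auto intro!: bound Gr_orthogonal_image \<xi>\<^sub>0 orthogonal_matrix_mul orthogonal_householder)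
  also have "\<dots> = (\<integral>g. c \<partial>(haar :: (real^'n^'n) measure))"
  proof (rule Bochner_Integration.integral_cong[OF refl])
    fix g :: "real^'n^'n" assume "g \<in> space haar"
    then have g: "orthogonal_matrix g" by simp
    have "orthogonal_matrix (?B g)" using g by (intro orthogonal_matrix_mul orthogonal_householder)
    moreover have "?B g *v e = e" using householder_move[OF g norm_e] .
    then have "(h ** ?B g) *v e = h *v e" for h :: "real^'n^'n"
      by (metis matrix_vector_mul_assoc)
    ultimately show "(\<integral>h. \<phi> ((*v) (h ** ?B g) ` \<xi>\<^sub>0) * on_sphere f (h *v e) \<partial>haar) = c"
      using c_right[of "?B g"] by simp
  qed
  also have "\<dots> = c" by (simp add: haar.prob_space[unfolded space_haar])
  finally show ?thesis using lhs by simp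
qed

section \<open>Radon transforms of measures\<close>

lemma measure_of_functional_eqI:
  fixes e :: "'a \<Rightarrow> 'b::metric_space"
  assumes T: "T = pullback_topology S e euclidean" and M: "M \<in> finite_borel_measures T"
    and L: "\<And>f. continuous_map T euclideanreal f \<Longrightarrow> (\<integral>x. f x \<partial>M) = L f"
  shows "measure_of_functional T L = M"
  unfolding measure_of_functional_def
proof (rule the_equality)
  show "M \<in> finite_borel_measures T \<and> (\<forall>f. continuous_map T euclideanreal f \<longrightarrow> (\<integral>x. f x \<partial>M) = L f)"
    using M L by blast
  fix N assume N: "N \<in> finite_borel_measures T \<and> (\<forall>f. continuous_map T euclideanreal f \<longrightarrow> (\<integral>x. f x \<partial>N) = L f)"
  then show "N = M"
    using M L unfolding T by (intro finite_measure_eq_if_same_integrals) auto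
qed

lemma finite_borel_measures_distr:
  assumes "finite_measure M" "f \<in> measurable M (borel_of T)"
  shows "distr M (borel_of T) f \<in> finite_borel_measures T"
  using assms by (simp add: finite_borel_measures_def finite_measure.finite_measure_distr)

text \<open>The explicit measure is the law of the normalized projection of a uniform point of the ball to a
  subspace with law \<open>\<nu>\<close>.  The integral formula extends from continuous to
  bounded Borel functions, as needed for iterated transforms.\<close>

lemma radon_dual_measure_represented:
  fixes \<nu> :: "(real^'n) set measure"
  assumes \<nu>: "\<nu> \<in> finite_borel_measures (grassmannian k)" and k: "0 < k" "k < CARD('n)"
  shows "radon_dual_measure \<nu> \<in> finite_borel_measures sphere_top"
    and "\<And>f. bounded_borel sphere_top f \<Longrightarrow> (\<integral>\<theta>. f \<theta> \<partial>radon_dual_measure \<nu>) = (\<integral>\<xi>. radon f \<xi> \<partial>\<nu>)"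
proof -
  have fn: "finite_measure \<nu>" and s\<nu>: "sets \<nu> = sets (borel_of (grassmannian k))"
    using \<nu> by (auto simp: finite_borel_measures_def)
  have sp\<nu>: "space \<nu> = Gr k" using space_finite_borel_measure[OF \<nu>] by simp
  have fb: "finite_measure (ball_measure :: (real^'n) measure)" by (rule ball_measure.finite_measure_axioms)
  define u where "u z = unit_proj (proj_matrix (fst z)) (snd z)" for z :: "(real^'n) set \<times> (real^'n)"
  have pm [measurable]: "proj_matrix \<in> borel_measurable \<nu>"
    using proj_matrix_borel by (simp add: measurable_cong_sets[OF s\<nu> refl])
  have um [measurable]: "u \<in> borel_measurable (\<nu> \<Otimes>\<^sub>M ball_measure)" unfolding u_def[abs_def] by measurable
  define M where "M = restrict_space (distr (\<nu> \<Otimes>\<^sub>M ball_measure) borel u) (sphere 0 1)"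
  have S: "sphere 0 1 \<in> sets (borel :: (real^'n) measure)" by (simp add: borel_closed)
  have M: "M \<in> finite_borel_measures sphere_top"
  proof -
    have "finite_measure (distr (\<nu> \<Otimes>\<^sub>M ball_measure) borel u)"
      using finite_measure_pair_measure[OF fb fn] um by (simp add: finite_measure.finite_measure_distr)
    then have "finite_measure M" unfolding M_def using S by (intro finite_measure_restrict_space) auto
    moreover have "sets M = sets (borel_of sphere_top)"
      unfolding M_def sets_borel_of_sphere by (rule sets_restrict_space_cong) simp
    ultimately show ?thesis by (simp add: finite_borel_measures_def)
  qed
  have int: "(\<integral>\<theta>. f \<theta> \<partial>M) = (\<integral>\<xi>. radon f \<xi> \<partial>\<nu>)" if f: "bounded_borel sphere_top f" for f
  proof -
    note fm = bounded_borel_measurable[OF f]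
    have ofm [measurable]: "on_sphere f \<in> borel_measurable borel" by (rule on_sphere_measurable[OF fm])
    obtain C where C: "0 \<le> C" "\<And>x. x \<in> topspace sphere_top \<Longrightarrow> \<bar>f x\<bar> \<le> C" using bounded_borel_bound[OF f] by blast
    have osC: "\<bar>on_sphere f y\<bar> \<le> C" for y by (rule on_sphere_abs_le) (use C in auto)
    have "(\<integral>\<theta>. f \<theta> \<partial>M) = (\<integral>\<theta>. indicator (sphere 0 1) \<theta> *\<^sub>R f \<theta> \<partial>distr (\<nu> \<Otimes>\<^sub>M ball_measure) borel u)"
      unfolding M_def using S by (intro integral_restrict_space) auto
    also have "\<dots> = (\<integral>\<theta>. on_sphere f \<theta> \<partial>distr (\<nu> \<Otimes>\<^sub>M ball_measure) borel u)"
      by (rule Bochner_Integration.integral_cong) (auto simp: on_sphere_def indicator_def)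
    also have "\<dots> = (\<integral>z. on_sphere f (unit_proj (proj_matrix (fst z)) (snd z)) \<partial>(\<nu> \<Otimes>\<^sub>M ball_measure))"
      using integral_distr[OF um ofm] by (simp add: u_def)
    also have "\<dots> = (\<integral>\<xi>. \<integral>x. on_sphere f (unit_proj (proj_matrix \<xi>) x) \<partial>ball_measure \<partial>\<nu>)"
    proof (rule fubini_bounded(1)[OF fn fb, where C = C])
      show "(\<lambda>(\<xi>, x). on_sphere f (unit_proj (proj_matrix \<xi>) x)) \<in> borel_measurable (\<nu> \<Otimes>\<^sub>M ball_measure)"
        by measurable
    qed (rule osC)
    also have "\<dots> = (\<integral>\<xi>. radon f \<xi> \<partial>\<nu>)"
      using radon_eq[OF _ _ _ fm] k by (intro Bochner_Integration.integral_cong refl) (auto simp: sp\<nu> Gr_def)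
    finally show ?thesis .
  qed
  have "radon_dual_measure \<nu> = M"
    unfolding radon_dual_measure_def
    by (rule measure_of_functional_eqI[OF sphere_top_eq_pullback M])
      (simp add: int bounded_borel_continuous compact_space_sphere)
  then show "radon_dual_measure \<nu> \<in> finite_borel_measures sphere_top"
    "\<And>f. bounded_borel sphere_top f \<Longrightarrow> (\<integral>\<theta>. f \<theta> \<partial>radon_dual_measure \<nu>) = (\<integral>\<xi>. radon f \<xi> \<partial>\<nu>)"
    using M int by auto
qed

lemma perp_measure_represented:
  fixes \<nu> :: "(real^'n) set measure"
  assumes \<nu>: "\<nu> \<in> finite_borel_measures (grassmannian (CARD('n) - i))" and i: "0 < i" "i < CARD('n)"
  shows "perp_measure i \<nu> \<in> finite_borel_measures (grassmannian i)"
    and "\<And>\<phi>. bounded_borel (grassmannian i) \<phi> \<Longrightarrow> (\<integral>\<xi>. \<phi> \<xi> \<partial>perp_measure i \<nu>) = (\<integral>\<eta>. \<phi> (\<eta>\<^sup>\<bottom>) \<partial>\<nu>)"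
proof -
  have fn: "finite_measure \<nu>" and s\<nu>: "sets \<nu> = sets (borel_of (grassmannian (CARD('n) - i)))"
    using \<nu> by (auto simp: finite_borel_measures_def)
  have pm: "orthogonal_comp \<in> measurable \<nu> (borel_of (grassmannian i))"
    using perp_measurable'[where 'n='n and i=i] i by (simp add: measurable_cong_sets[OF s\<nu> refl])
  define M where "M = distr \<nu> (borel_of (grassmannian i)) orthogonal_comp"
  have M: "M \<in> finite_borel_measures (grassmannian i)"
    unfolding M_def using fn pm by (rule finite_borel_measures_distr)
  have int: "(\<integral>\<xi>. \<phi> \<xi> \<partial>M) = (\<integral>\<eta>. \<phi> (\<eta>\<^sup>\<bottom>) \<partial>\<nu>)" if "bounded_borel (grassmannian i) \<phi>" for \<phi>
    unfolding M_def using integral_distr[OF pm bounded_borel_measurable[OF that]] .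
  have "perp_measure i \<nu> = M"
    unfolding perp_measure_def
    by (rule measure_of_functional_eqI[OF grassmannian_eq_pullback M])
      (simp add: int bounded_borel_continuous compact_space_grassmannian i)
  then show "perp_measure i \<nu> \<in> finite_borel_measures (grassmannian i)"
    "\<And>\<phi>. bounded_borel (grassmannian i) \<phi> \<Longrightarrow> (\<integral>\<xi>. \<phi> \<xi> \<partial>perp_measure i \<nu>) = (\<integral>\<eta>. \<phi> (\<eta>\<^sup>\<bottom>) \<partial>\<nu>)"
    using M int by auto
qed

lemma bounded_borel_perp:
  fixes \<phi> :: "(real^'n) set \<Rightarrow> real"
  assumes "bounded_borel (grassmannian i) \<phi>" "i \<le> CARD('n)"
  shows "bounded_borel (grassmannian (CARD('n) - i)) (\<lambda>\<eta>. \<phi> (\<eta>\<^sup>\<bottom>))"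
  by (rule bounded_borel_compose[OF assms(1) perp_measurable'[OF assms(2)]])

text \<open>The explicit measure is the law of the orthogonal complement of a random subspace through a random
  unit vector with law \<open>\<mu>\<close>.\<close>

lemma radon_perp_measure_represented:
  fixes \<mu> :: "(real^'n) measure"
  assumes \<mu>: "\<mu> \<in> finite_borel_measures sphere_top" and i: "0 < i" "i < CARD('n)"
  shows "radon_perp_measure i \<mu> \<in> finite_borel_measures (grassmannian i)"
    and "\<And>\<phi>. bounded_borel (grassmannian i) \<phi> \<Longrightarrow>
      (\<integral>\<xi>. \<phi> \<xi> \<partial>radon_perp_measure i \<mu>) = (\<integral>\<theta>. radon_dual (CARD('n) - i) (\<lambda>\<eta>. \<phi> (\<eta>\<^sup>\<bottom>)) \<theta> \<partial>\<mu>)"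
proof -
  have k: "0 < CARD('n) - i" "CARD('n) - i < CARD('n)" using i by auto
  obtain e and \<eta>\<^sub>0 :: "(real^'n) set" where "flag_base e \<eta>\<^sub>0" and d: "dim \<eta>\<^sub>0 = CARD('n) - i"
    using flag_base_exists[OF k] by blast
  then interpret flag_base e \<eta>\<^sub>0 by simp
  have fn: "finite_measure \<mu>" and s\<mu>: "sets \<mu> = sets (borel_of sphere_top)"
    using \<mu> by (auto simp: finite_borel_measures_def)
  have sp\<mu>: "space \<mu> = sphere 0 1" using space_finite_borel_measure[OF \<mu>] by simp
  have fh: "finite_measure (haar :: (real^'n^'n) measure)" by (rule haar.finite_measure_axioms)
  have idm: "(\<lambda>x. x) \<in> borel_measurable \<mu>"
    using sphere_borel by (simp add: measurable_cong_sets[OF s\<mu> refl])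
  define u where "u z = (subspace_through e \<eta>\<^sub>0 (fst z) (snd z))\<^sup>\<bottom>" for z
  have sm: "(\<lambda>z. subspace_through e \<eta>\<^sub>0 (fst z) (snd z)) \<in> measurable (\<mu> \<Otimes>\<^sub>M haar) (borel_of (grassmannian (CARD('n) - i)))"
    unfolding d[symmetric]
    by (rule subspace_through_measurable)
      (auto simp: space_pair_measure intro: measurable_compose[OF measurable_fst idm] measurable_compose[OF measurable_snd haar_borel])
  have um: "u \<in> measurable (\<mu> \<Otimes>\<^sub>M haar) (borel_of (grassmannian i))"
    unfolding u_def[abs_def] using measurable_compose[OF sm perp_measurable'] i by simp
  define M where "M = distr (\<mu> \<Otimes>\<^sub>M haar) (borel_of (grassmannian i)) u"
  have M: "M \<in> finite_borel_measures (grassmannian i)"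
    unfolding M_def using finite_measure_pair_measure[OF fh fn] um by (rule finite_borel_measures_distr)
  have int: "(\<integral>\<xi>. \<phi> \<xi> \<partial>M) = (\<integral>\<theta>. radon_dual (CARD('n) - i) (\<lambda>\<eta>. \<phi> (\<eta>\<^sup>\<bottom>)) \<theta> \<partial>\<mu>)"
    if \<phi>: "bounded_borel (grassmannian i) \<phi>" for \<phi>
  proof -
    note pm = bounded_borel_measurable[OF \<phi>]
    obtain C where C: "0 \<le> C" "\<And>\<xi>. \<xi> \<in> topspace (grassmannian i) \<Longrightarrow> \<bar>\<phi> \<xi>\<bar> \<le> C" using bounded_borel_bound[OF \<phi>] by blast
    have \<phi>p: "(\<lambda>\<eta>. \<phi> (\<eta>\<^sup>\<bottom>)) \<in> borel_measurable (borel_of (grassmannian (CARD('n) - i)))"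
      using bounded_borel_measurable[OF bounded_borel_perp[OF \<phi>]] i by simp
    have "(\<integral>\<xi>. \<phi> \<xi> \<partial>M) = (\<integral>z. \<phi> ((subspace_through e \<eta>\<^sub>0 (fst z) (snd z))\<^sup>\<bottom>) \<partial>(\<mu> \<Otimes>\<^sub>M haar))"
      unfolding M_def using integral_distr[OF um pm] by (simp add: u_def)
    also have "\<dots> = (\<integral>\<theta>. \<integral>g. \<phi> ((subspace_through e \<eta>\<^sub>0 \<theta> g)\<^sup>\<bottom>) \<partial>haar \<partial>\<mu>)"
    proof (rule fubini_bounded(1)[OF fn fh, where C = C])
      show "(\<lambda>(\<theta>, g). \<phi> ((subspace_through e \<eta>\<^sub>0 \<theta> g)\<^sup>\<bottom>)) \<in> borel_measurable (\<mu> \<Otimes>\<^sub>M haar)"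
        using measurable_compose[OF um pm] by (simp add: u_def split_beta)
      fix \<theta> and g :: "real^'n^'n" assume "\<theta> \<in> space \<mu>" "g \<in> space haar"
      then have "(subspace_through e \<eta>\<^sub>0 \<theta> g)\<^sup>\<bottom> \<in> Gr (CARD('n) - (CARD('n) - i))"
        using subspace_through_Gr[of g \<theta>] d by (intro Gr_orthogonal_comp) simp
      then show "\<bar>\<phi> ((subspace_through e \<eta>\<^sub>0 \<theta> g)\<^sup>\<bottom>)\<bar> \<le> C" using C(2) i by simp
    qed
    also have "\<dots> = (\<integral>\<theta>. radon_dual (CARD('n) - i) (\<lambda>\<eta>. \<phi> (\<eta>\<^sup>\<bottom>)) \<theta> \<partial>\<mu>)"
      using radon_dual_eq[of _ "\<lambda>\<eta>. \<phi> (\<eta>\<^sup>\<bottom>)"] \<phi>p d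
      by (intro Bochner_Integration.integral_cong refl) (simp add: sp\<mu>)
    finally show ?thesis .
  qed
  have "radon_perp_measure i \<mu> = M"
    unfolding radon_perp_measure_def
    by (rule measure_of_functional_eqI[OF grassmannian_eq_pullback M])
      (simp add: int bounded_borel_continuous compact_space_grassmannian i)
  then show "radon_perp_measure i \<mu> \<in> finite_borel_measures (grassmannian i)"
    "\<And>\<phi>. bounded_borel (grassmannian i) \<phi> \<Longrightarrow>
      (\<integral>\<xi>. \<phi> \<xi> \<partial>radon_perp_measure i \<mu>) = (\<integral>\<theta>. radon_dual (CARD('n) - i) (\<lambda>\<eta>. \<phi> (\<eta>\<^sup>\<bottom>)) \<theta> \<partial>\<mu>)"
    using M int by auto
qed

section \<open>Intertwining of the transforms with the orthogonal complement\<close>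

text \<open>Averaging over the group yields an invariant function of the pair \<open>(\<xi>, \<zeta>)\<close>, and the pair
  \<open>(\<zeta>, \<xi>)\<close> lies in the same orbit.  The transposed matrix, that is the inverse, makes left invariance
  applicable.\<close>

lemma integral_haar_exchange:
  fixes \<phi> \<psi> :: "(real^'n) set \<Rightarrow> real"
  assumes \<phi>: "bounded_borel (grassmannian i) \<phi>" and \<psi>: "bounded_borel (grassmannian i) \<psi>"
    and \<xi>: "\<xi> \<in> Gr i" and \<zeta>: "\<zeta> \<in> Gr i"
  shows "(\<integral>g. \<phi> ((*v) (transpose g) ` \<xi>) * \<psi> ((*v) (transpose g) ` \<zeta>) \<partial>haar) =
         (\<integral>g. \<phi> ((*v) (transpose g) ` \<zeta>) * \<psi> ((*v) (transpose g) ` \<xi>) \<partial>haar)"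
proof -
  obtain a where a: "orthogonal_matrix a" "(*v) a ` \<xi> = \<zeta>" "(*v) a ` \<zeta> = \<xi>"
    using subspaces_exchangeable[of \<xi> \<zeta> i] \<xi> \<zeta> by (auto simp: Gr_def)
  have tm: "(\<lambda>g. (*v) (transpose g) ` \<eta>) \<in> measurable haar (borel_of (grassmannian i))" if \<eta>: "\<eta> \<in> Gr i" for \<eta> :: "(real^'n) set"
  proof (rule measurable_into_grassmannian)
    have "(\<lambda>g. transpose g ** proj_matrix \<eta> ** g) \<in> borel_measurable haar" by measurable
    then show "(\<lambda>g. proj_matrix ((*v) (transpose g) ` \<eta>)) \<in> borel_measurable haar"
      by (rule measurable_cong[THEN iffD1, rotated]) (use \<eta> in \<open>simp add: proj_matrix_orthogonal_image Gr_def del: transpose_matrix_vector\<close>)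
  qed (use \<eta> in \<open>simp add: Gr_orthogonal_image del: transpose_matrix_vector\<close>)
  let ?F = "\<lambda>g. \<phi> ((*v) (transpose g) ` \<xi>) * \<psi> ((*v) (transpose g) ` \<zeta>)"
  have [measurable]: "(\<lambda>g. \<phi> ((*v) (transpose g) ` \<xi>)) \<in> borel_measurable haar"
    "(\<lambda>g. \<psi> ((*v) (transpose g) ` \<zeta>)) \<in> borel_measurable haar"
    using measurable_compose[OF tm bounded_borel_measurable] \<phi> \<psi> \<xi> \<zeta> by auto
  have "(\<integral>g. ?F g \<partial>haar) = (\<integral>g. ?F (transpose a ** g) \<partial>haar)"
    by (rule integral_haar_left[symmetric]) (simp add: a, measurable)
  also have "\<dots> = (\<integral>g. \<phi> ((*v) (transpose g) ` \<zeta>) * \<psi> ((*v) (transpose g) ` \<xi>) \<partial>haar)"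
    by (simp add: matrix_transpose_mul image_matrix_mult a del: transpose_matrix_vector)
  finally show ?thesis .
qed

text \<open>The pairing is the expectation of \<open>\<phi> (x \<omega>) * \<psi> (z \<omega>)\<close> over a random unit vector \<open>\<theta>\<close>, a random
  subspace \<open>x\<close> through \<open>\<theta>\<close> and, independently, a random subspace \<open>z\<close> orthogonal to \<open>\<theta>\<close>.  The joint law of \<open>(x, z)\<close> is
  invariant, hence may be averaged over the group, and the average is symmetric in \<open>x\<close> and \<open>z\<close>.\<close>

lemma radon_dual_pairing_symmetric:
  fixes \<phi> \<psi> :: "(real^'n) set \<Rightarrow> real"
  assumes i: "0 < i" "i < CARD('n)"
    and \<phi>: "bounded_borel (grassmannian i) \<phi>" and \<psi>: "bounded_borel (grassmannian i) \<psi>"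
  shows "(\<integral>\<theta>. radon_dual i \<phi> \<theta> * radon_dual (CARD('n) - i) (\<lambda>\<eta>. \<psi> (\<eta>\<^sup>\<bottom>)) \<theta> \<partial>sphere_measure) =
         (\<integral>\<theta>. radon_dual i \<psi> \<theta> * radon_dual (CARD('n) - i) (\<lambda>\<eta>. \<phi> (\<eta>\<^sup>\<bottom>)) \<theta> \<partial>sphere_measure)"
proof -
  have k: "0 < CARD('n) - i" "CARD('n) - i < CARD('n)" using i by auto
  have n2: "CARD('n) \<ge> 2" using i by linarith
  obtain e1 and \<xi>\<^sub>0 :: "(real^'n) set" where "flag_base e1 \<xi>\<^sub>0" and d1: "dim \<xi>\<^sub>0 = i"
    using flag_base_exists[OF i] by blast
  then interpret X: flag_base e1 \<xi>\<^sub>0 by simp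
  obtain e2 and \<eta>\<^sub>0 :: "(real^'n) set" where "flag_base e2 \<eta>\<^sub>0" and d2: "dim \<eta>\<^sub>0 = CARD('n) - i"
    using flag_base_exists[OF k] by blast
  then interpret Y: flag_base e2 \<eta>\<^sub>0 by simp
  define \<sigma> where "\<sigma> = (sphere_measure :: (real^'n) measure)"
  have \<sigma>: "\<sigma> \<in> finite_borel_measures sphere_top" using sphere_measure_finite_borel[OF n2] by (simp add: \<sigma>_def)
  have s\<sigma>: "sets \<sigma> = sets (borel_of sphere_top)" and fs: "finite_measure \<sigma>" using \<sigma> by (auto simp: finite_borel_measures_def)
  have sp\<sigma>: "space \<sigma> = sphere 0 1" using space_finite_borel_measure[OF \<sigma>] by simp
  have fh: "finite_measure (haar :: (real^'n^'n) measure)" by (rule haar.finite_measure_axioms)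
  define \<Omega> where "\<Omega> = \<sigma> \<Otimes>\<^sub>M ((haar :: (real^'n^'n) measure) \<Otimes>\<^sub>M (haar :: (real^'n^'n) measure))"
  have fhh: "finite_measure ((haar :: (real^'n^'n) measure) \<Otimes>\<^sub>M (haar :: (real^'n^'n) measure))"
    by (rule finite_measure_pair_measure[OF fh fh])
  have f\<Omega>: "finite_measure \<Omega>" unfolding \<Omega>_def by (rule finite_measure_pair_measure[OF fhh fs])
  define x where "x \<omega> = subspace_through e1 \<xi>\<^sub>0 (fst \<omega>) (fst (snd \<omega>))" for \<omega> :: "(real^'n) \<times> (real^'n^'n) \<times> (real^'n^'n)"
  define z where "z \<omega> = (subspace_through e2 \<eta>\<^sub>0 (fst \<omega>) (snd (snd \<omega>)))\<^sup>\<bottom>" for \<omega> :: "(real^'n) \<times> (real^'n^'n) \<times> (real^'n^'n)"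
  have idm: "(\<lambda>x. x) \<in> borel_measurable \<sigma>"
    using sphere_borel by (simp add: measurable_cong_sets[OF s\<sigma> refl])
  have m1: "fst \<in> borel_measurable \<Omega>" unfolding \<Omega>_def by (rule measurable_compose[OF measurable_fst idm])
  have m2: "(\<lambda>\<omega>. fst (snd \<omega>)) \<in> borel_measurable \<Omega>" "(\<lambda>\<omega>. snd (snd \<omega>)) \<in> borel_measurable \<Omega>"
    unfolding \<Omega>_def
    by (rule measurable_compose[OF measurable_snd measurable_compose[OF measurable_fst haar_borel]],
        rule measurable_compose[OF measurable_snd measurable_compose[OF measurable_snd haar_borel]])
  have o: "orthogonal_matrix (fst (snd \<omega>))" "orthogonal_matrix (snd (snd \<omega>))" if "\<omega> \<in> space \<Omega>" for \<omega>
    using that by (auto simp: \<Omega>_def space_pair_measure)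
  have xm: "x \<in> measurable \<Omega> (borel_of (grassmannian i))"
    unfolding x_def[abs_def] using X.subspace_through_measurable[OF m1 m2(1) o(1)] d1 by simp
  have zm: "z \<in> measurable \<Omega> (borel_of (grassmannian i))"
    unfolding z_def[abs_def]
    using measurable_compose[OF Y.subspace_through_measurable[OF m1 m2(2) o(2), unfolded d2] perp_measurable'[of i]] i by simp
  have xG: "x \<omega> \<in> Gr i" and zG: "z \<omega> \<in> Gr i" if "\<omega> \<in> space \<Omega>" for \<omega>
    using measurable_space[OF xm that] measurable_space[OF zm that] by auto
  have pairing: "(\<integral>\<theta>. radon_dual i \<alpha> \<theta> * radon_dual (CARD('n) - i) (\<lambda>\<eta>. \<beta> (\<eta>\<^sup>\<bottom>)) \<theta> \<partial>\<sigma>) = (\<integral>\<omega>. \<alpha> (x \<omega>) * \<beta> (z \<omega>) \<partial>\<Omega>)"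
    if \<alpha>: "bounded_borel (grassmannian i) \<alpha>" and \<beta>: "bounded_borel (grassmannian i) \<beta>" for \<alpha> \<beta>
  proof -
    obtain C where C: "0 \<le> C" "\<And>\<xi>. \<xi> \<in> topspace (grassmannian i) \<Longrightarrow> \<bar>\<alpha> \<xi>\<bar> \<le> C" using bounded_borel_bound[OF \<alpha>] by blast
    obtain D where D: "0 \<le> D" "\<And>\<xi>. \<xi> \<in> topspace (grassmannian i) \<Longrightarrow> \<bar>\<beta> \<xi>\<bar> \<le> D" using bounded_borel_bound[OF \<beta>] by blast
    have am: "(\<lambda>\<omega>. \<alpha> (x \<omega>)) \<in> borel_measurable \<Omega>" and bm: "(\<lambda>\<omega>. \<beta> (z \<omega>)) \<in> borel_measurable \<Omega>"
      using measurable_compose[OF xm bounded_borel_measurable[OF \<alpha>]] measurable_compose[OF zm bounded_borel_measurable[OF \<beta>]] by auto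
    have bd: "\<bar>\<alpha> (x \<omega>) * \<beta> (z \<omega>)\<bar> \<le> C * D" if "\<omega> \<in> space \<Omega>" for \<omega>
      using C D xG[OF that] zG[OF that] by (simp add: abs_mult mult_mono)
    have "(\<integral>\<omega>. \<alpha> (x \<omega>) * \<beta> (z \<omega>) \<partial>\<Omega>) = (\<integral>\<theta>. \<integral>p. \<alpha> (x (\<theta>, p)) * \<beta> (z (\<theta>, p)) \<partial>(haar \<Otimes>\<^sub>M haar) \<partial>\<sigma>)"
      unfolding \<Omega>_def
      using fubini_bounded(1)[OF fs fhh, of "\<lambda>\<theta> p. \<alpha> (x (\<theta>, p)) * \<beta> (z (\<theta>, p))" "C * D"] bd am bm
      by (simp add: \<Omega>_def space_pair_measure split_beta)
    also have "\<dots> = (\<integral>\<theta>. radon_dual i \<alpha> \<theta> * radon_dual (CARD('n) - i) (\<lambda>\<eta>. \<beta> (\<eta>\<^sup>\<bottom>)) \<theta> \<partial>\<sigma>)"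
    proof (rule Bochner_Integration.integral_cong[OF refl])
      fix \<theta> assume "\<theta> \<in> space \<sigma>"
      then have \<theta>: "norm \<theta> = 1" by (simp add: sp\<sigma>)
      have pm: "(\<lambda>p. (\<theta>, p)) \<in> measurable (haar \<Otimes>\<^sub>M haar) \<Omega>" unfolding \<Omega>_def using \<open>\<theta> \<in> space \<sigma>\<close> by measurable
      have "(\<integral>p. \<alpha> (x (\<theta>, p)) * \<beta> (z (\<theta>, p)) \<partial>(haar \<Otimes>\<^sub>M haar))
          = (\<integral>g. \<integral>h. \<alpha> (x (\<theta>, g, h)) * \<beta> (z (\<theta>, g, h)) \<partial>haar \<partial>haar)"
        using fubini_bounded(1)[OF fh fh, of "\<lambda>g h. \<alpha> (x (\<theta>, g, h)) * \<beta> (z (\<theta>, g, h))" "C * D"] bd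
          measurable_compose[OF pm am] measurable_compose[OF pm bm] \<open>\<theta> \<in> space \<sigma>\<close>
        by (simp add: \<Omega>_def space_pair_measure split_beta)
      also have "\<dots> = (\<integral>g. \<alpha> (subspace_through e1 \<xi>\<^sub>0 \<theta> g) \<partial>haar) * (\<integral>h. \<beta> ((subspace_through e2 \<eta>\<^sub>0 \<theta> h)\<^sup>\<bottom>) \<partial>haar)"
        by (simp add: x_def z_def)
      also have "\<dots> = radon_dual i \<alpha> \<theta> * radon_dual (CARD('n) - i) (\<lambda>\<eta>. \<beta> (\<eta>\<^sup>\<bottom>)) \<theta>"
        using X.radon_dual_eq[OF \<theta>, of \<alpha>] Y.radon_dual_eq[OF \<theta>, of "\<lambda>\<eta>. \<beta> (\<eta>\<^sup>\<bottom>)"]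
          bounded_borel_measurable[OF \<alpha>] bounded_borel_measurable[OF bounded_borel_perp[OF \<beta>]] i d1 d2 by simp
      finally show "(\<integral>p. \<alpha> (x (\<theta>, p)) * \<beta> (z (\<theta>, p)) \<partial>(haar \<Otimes>\<^sub>M haar)) =
        radon_dual i \<alpha> \<theta> * radon_dual (CARD('n) - i) (\<lambda>\<eta>. \<beta> (\<eta>\<^sup>\<bottom>)) \<theta>" .
    qed
    finally show ?thesis ..
  qed
  \<comment> \<open>invariance of the joint law of \<open>(x, z)\<close>\<close>
  have rot: "(\<integral>\<omega>. \<alpha> ((*v) a ` x \<omega>) * \<beta> ((*v) a ` z \<omega>) \<partial>\<Omega>) = (\<integral>\<omega>. \<alpha> (x \<omega>) * \<beta> (z \<omega>) \<partial>\<Omega>)"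
    if \<alpha>: "bounded_borel (grassmannian i) \<alpha>" and \<beta>: "bounded_borel (grassmannian i) \<beta>" and a: "orthogonal_matrix a" for \<alpha> \<beta> a
  proof -
    have \<alpha>a: "bounded_borel (grassmannian i) (\<lambda>\<xi>. \<alpha> ((*v) a ` \<xi>))" and \<beta>a: "bounded_borel (grassmannian i) (\<lambda>\<xi>. \<beta> ((*v) a ` \<xi>))"
      using bounded_borel_compose[OF \<alpha> image_measurable[OF a]] bounded_borel_compose[OF \<beta> image_measurable[OF a]] by auto
    have \<beta>p: "bounded_borel (grassmannian (CARD('n) - i)) (\<lambda>\<eta>. \<beta> (\<eta>\<^sup>\<bottom>))" using bounded_borel_perp[OF \<beta>] i by simp
    let ?H = "\<lambda>\<theta>. radon_dual i \<alpha> \<theta> * radon_dual (CARD('n) - i) (\<lambda>\<eta>. \<beta> (\<eta>\<^sup>\<bottom>)) \<theta>"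
    have "(\<integral>\<omega>. \<alpha> ((*v) a ` x \<omega>) * \<beta> ((*v) a ` z \<omega>) \<partial>\<Omega>) =
      (\<integral>\<theta>. radon_dual i (\<lambda>\<xi>. \<alpha> ((*v) a ` \<xi>)) \<theta> * radon_dual (CARD('n) - i) (\<lambda>\<eta>. \<beta> ((*v) a ` (\<eta>\<^sup>\<bottom>))) \<theta> \<partial>\<sigma>)"
      using pairing[OF \<alpha>a \<beta>a] by simp
    also have "\<dots> = (\<integral>\<theta>. ?H (a *v \<theta>) \<partial>\<sigma>)"
      using radon_dual_equivariant[OF a i \<alpha>] radon_dual_equivariant[OF a k \<beta>p]
      by (intro Bochner_Integration.integral_cong refl) (simp add: sp\<sigma> orthogonal_comp_orthogonal_image[OF a])
    also have "\<dots> = (\<integral>\<theta>. ?H \<theta> \<partial>\<sigma>)"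
      unfolding \<sigma>_def
      by (rule integral_sphere_orthogonal[OF a n2 bounded_borel_measurable[OF bounded_borel_mult]])
        (rule radon_dual_bounded_borel \<alpha> \<beta>p i k)+
    also have "\<dots> = (\<integral>\<omega>. \<alpha> (x \<omega>) * \<beta> (z \<omega>) \<partial>\<Omega>)" by (rule pairing[OF \<alpha> \<beta>])
    finally show ?thesis .
  qed
  \<comment> \<open>the invariant law is replaced by its average over the group\<close>
  have average: "(\<integral>\<omega>. \<alpha> (x \<omega>) * \<beta> (z \<omega>) \<partial>\<Omega>) =
      (\<integral>\<omega>. \<integral>g. \<alpha> ((*v) (transpose g) ` x \<omega>) * \<beta> ((*v) (transpose g) ` z \<omega>) \<partial>haar \<partial>\<Omega>)"
    if \<alpha>: "bounded_borel (grassmannian i) \<alpha>" and \<beta>: "bounded_borel (grassmannian i) \<beta>" for \<alpha> \<beta>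
  proof -
    obtain C where C: "0 \<le> C" "\<And>\<xi>. \<xi> \<in> topspace (grassmannian i) \<Longrightarrow> \<bar>\<alpha> \<xi>\<bar> \<le> C" using bounded_borel_bound[OF \<alpha>] by blast
    obtain D where D: "0 \<le> D" "\<And>\<xi>. \<xi> \<in> topspace (grassmannian i) \<Longrightarrow> \<bar>\<beta> \<xi>\<bar> \<le> D" using bounded_borel_bound[OF \<beta>] by blast
    have act: "(\<lambda>(\<omega>, g). (*v) (transpose g) ` y \<omega>) \<in> measurable (\<Omega> \<Otimes>\<^sub>M haar) (borel_of (grassmannian i))"
      if y: "y \<in> measurable \<Omega> (borel_of (grassmannian i))" for y
    proof (rule measurable_into_grassmannian)
      have yG: "y \<omega> \<in> Gr i" if "\<omega> \<in> space \<Omega>" for \<omega> using measurable_space[OF y that] by simp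
      show "(case p of (\<omega>, g) \<Rightarrow> (*v) (transpose g) ` y \<omega>) \<in> Gr i" if "p \<in> space (\<Omega> \<Otimes>\<^sub>M haar)" for p
        using that yG by (auto simp: space_pair_measure Gr_orthogonal_image simp del: transpose_matrix_vector)
      have [measurable]: "(\<lambda>\<omega>. proj_matrix (y \<omega>)) \<in> borel_measurable \<Omega>" by (rule measurable_compose[OF y proj_matrix_borel])
      have "(\<lambda>p. transpose (snd p) ** proj_matrix (y (fst p)) ** snd p) \<in> borel_measurable (\<Omega> \<Otimes>\<^sub>M haar)" by measurable
      then show "(\<lambda>p. proj_matrix (case p of (\<omega>, g) \<Rightarrow> (*v) (transpose g) ` y \<omega>)) \<in> borel_measurable (\<Omega> \<Otimes>\<^sub>M haar)"
        by (rule measurable_cong[THEN iffD1, rotated])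
          (use yG in \<open>auto simp: space_pair_measure Gr_def proj_matrix_orthogonal_image simp del: transpose_matrix_vector\<close>)
    qed
    have "(\<integral>\<omega>. \<alpha> (x \<omega>) * \<beta> (z \<omega>) \<partial>\<Omega>) = (\<integral>g. (\<integral>\<omega>. \<alpha> (x \<omega>) * \<beta> (z \<omega>) \<partial>\<Omega>) \<partial>(haar :: (real^'n^'n) measure))"
      by (simp add: haar.prob_space[unfolded space_haar])
    also have "\<dots> = (\<integral>g. \<integral>\<omega>. \<alpha> ((*v) (transpose g) ` x \<omega>) * \<beta> ((*v) (transpose g) ` z \<omega>) \<partial>\<Omega> \<partial>haar)"
    proof (rule Bochner_Integration.integral_cong[OF refl])
      fix g :: "real^'n^'n" assume "g \<in> space haar"
      then have "orthogonal_matrix (transpose g)" by simp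
      from rot[OF \<alpha> \<beta> this]
      show "(\<integral>\<omega>. \<alpha> (x \<omega>) * \<beta> (z \<omega>) \<partial>\<Omega>) =
        (\<integral>\<omega>. \<alpha> ((*v) (transpose g) ` x \<omega>) * \<beta> ((*v) (transpose g) ` z \<omega>) \<partial>\<Omega>)" ..
    qed
    also have "\<dots> = (\<integral>\<omega>. \<integral>g. \<alpha> ((*v) (transpose g) ` x \<omega>) * \<beta> ((*v) (transpose g) ` z \<omega>) \<partial>haar \<partial>\<Omega>)"
    proof (rule fubini_bounded(2)[OF f\<Omega> fh, symmetric, where C = "C * D"])
      show "(\<lambda>(\<omega>, g). \<alpha> ((*v) (transpose g) ` x \<omega>) * \<beta> ((*v) (transpose g) ` z \<omega>)) \<in> borel_measurable (\<Omega> \<Otimes>\<^sub>M haar)"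
        using borel_measurable_times[OF measurable_compose[OF act[OF xm] bounded_borel_measurable[OF \<alpha>]]
            measurable_compose[OF act[OF zm] bounded_borel_measurable[OF \<beta>]]]
        by (simp add: split_beta del: transpose_matrix_vector)
      fix \<omega> and g :: "real^'n^'n" assume \<omega>: "\<omega> \<in> space \<Omega>" and "g \<in> space haar"
      then have "(*v) (transpose g) ` x \<omega> \<in> Gr i" "(*v) (transpose g) ` z \<omega> \<in> Gr i"
        using xG[OF \<omega>] zG[OF \<omega>] by (auto intro!: Gr_orthogonal_image simp del: transpose_matrix_vector)
      then show "\<bar>\<alpha> ((*v) (transpose g) ` x \<omega>) * \<beta> ((*v) (transpose g) ` z \<omega>)\<bar> \<le> C * D"
        using C D by (simp add: abs_mult mult_mono del: transpose_matrix_vector)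
    qed
    finally show ?thesis .
  qed
  have "(\<integral>\<omega>. \<phi> (x \<omega>) * \<psi> (z \<omega>) \<partial>\<Omega>) = (\<integral>\<omega>. \<psi> (x \<omega>) * \<phi> (z \<omega>) \<partial>\<Omega>)"
    unfolding average[OF \<phi> \<psi>] average[OF \<psi> \<phi>]
  proof (rule Bochner_Integration.integral_cong[OF refl])
    fix \<omega> assume \<omega>: "\<omega> \<in> space \<Omega>"
    show "(\<integral>g. \<phi> ((*v) (transpose g) ` x \<omega>) * \<psi> ((*v) (transpose g) ` z \<omega>) \<partial>haar) =
      (\<integral>g. \<psi> ((*v) (transpose g) ` x \<omega>) * \<phi> ((*v) (transpose g) ` z \<omega>) \<partial>haar)"
      unfolding integral_haar_exchange[OF \<phi> \<psi> xG[OF \<omega>] zG[OF \<omega>]] by (simp only: mult.commute)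
  qed
  then show ?thesis using pairing[OF \<phi> \<psi>] pairing[OF \<psi> \<phi>] by (simp add: \<sigma>_def)
qed

subsection \<open>The pointwise identity\<close>

lemma radon_dual_tendsto:
  fixes \<phi> :: "(real^'n) set \<Rightarrow> real"
  assumes k: "0 < k" "k < CARD('n)" and \<theta>: "norm \<theta> = 1"
    and F: "\<And>j::nat. bounded_borel (grassmannian k) (F j)" and \<phi>: "bounded_borel (grassmannian k) \<phi>"
    and C: "\<And>j \<xi>. \<xi> \<in> Gr k \<Longrightarrow> \<bar>F j \<xi>\<bar> \<le> C"
    and lim: "\<And>\<xi>. \<xi> \<in> Gr k \<Longrightarrow> (\<lambda>j. F j \<xi>) \<longlonglongrightarrow> \<phi> \<xi>"
  shows "(\<lambda>j. radon_dual k (F j) \<theta>) \<longlonglongrightarrow> radon_dual k \<phi> \<theta>"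
proof -
  obtain e and \<xi>\<^sub>0 :: "(real^'n) set" where "flag_base e \<xi>\<^sub>0" and d: "dim \<xi>\<^sub>0 = k" using flag_base_exists[OF k] by blast
  then interpret flag_base e \<xi>\<^sub>0 by simp
  have sm: "(\<lambda>g. subspace_through e \<xi>\<^sub>0 \<theta> g) \<in> measurable haar (borel_of (grassmannian k))"
    unfolding d[symmetric] by (rule subspace_through_measurable) auto
  have "(\<lambda>j. \<integral>g. F j (subspace_through e \<xi>\<^sub>0 \<theta> g) \<partial>haar) \<longlonglongrightarrow> (\<integral>g. \<phi> (subspace_through e \<xi>\<^sub>0 \<theta> g) \<partial>haar)"
  proof (rule integral_dominated_convergence[where w = "\<lambda>_. C"])
    show "(\<lambda>g. \<phi> (subspace_through e \<xi>\<^sub>0 \<theta> g)) \<in> borel_measurable haar"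
      by (rule measurable_compose[OF sm bounded_borel_measurable[OF \<phi>]])
    show "(\<lambda>g. F j (subspace_through e \<xi>\<^sub>0 \<theta> g)) \<in> borel_measurable haar" for j
      by (rule measurable_compose[OF sm bounded_borel_measurable[OF F]])
    show "AE g in haar. (\<lambda>j. F j (subspace_through e \<xi>\<^sub>0 \<theta> g)) \<longlonglongrightarrow> \<phi> (subspace_through e \<xi>\<^sub>0 \<theta> g)"
      using lim subspace_through_Gr d by (intro AE_I2) simp
    show "AE g in haar. norm (F j (subspace_through e \<xi>\<^sub>0 \<theta> g)) \<le> C" for j
      using C subspace_through_Gr d by (intro AE_I2) simp
  qed simp
  then show ?thesis
    using radon_dual_eq[OF \<theta>] F[THEN bounded_borel_measurable] \<phi>[THEN bounded_borel_measurable] d by simp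
qed

lemma radon_tendsto:
  fixes f :: "real^'n \<Rightarrow> real"
  assumes \<xi>: "\<xi> \<in> Gr k" and k: "0 < k" "k < CARD('n)"
    and F: "\<And>j::nat. bounded_borel sphere_top (F j)" and f: "bounded_borel sphere_top f"
    and C: "\<And>j \<theta>. norm \<theta> = 1 \<Longrightarrow> \<bar>F j \<theta>\<bar> \<le> C" "0 \<le> C"
    and lim: "\<And>\<theta>. norm \<theta> = 1 \<Longrightarrow> (\<lambda>j. F j \<theta>) \<longlonglongrightarrow> f \<theta>"
  shows "(\<lambda>j. radon (F j) \<xi>) \<longlonglongrightarrow> radon f \<xi>"
proof -
  let ?u = "unit_proj (proj_matrix \<xi>)"
  have m: "(\<lambda>x. on_sphere h (?u x)) \<in> borel_measurable ball_measure" if "bounded_borel sphere_top h" for h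
  proof -
    have [measurable]: "on_sphere h \<in> borel_measurable borel"
      by (rule on_sphere_measurable[OF bounded_borel_measurable[OF that]])
    show ?thesis by measurable
  qed
  have "(\<lambda>j. \<integral>x. on_sphere (F j) (?u x) \<partial>ball_measure) \<longlonglongrightarrow> (\<integral>x. on_sphere f (?u x) \<partial>ball_measure)"
  proof (rule integral_dominated_convergence[where w = "\<lambda>_. C"])
    show "AE x in ball_measure. (\<lambda>j. on_sphere (F j) (?u x)) \<longlonglongrightarrow> on_sphere f (?u x)"
      using lim by (intro AE_I2) (simp add: on_sphere_def)
    show "AE x in ball_measure. norm (on_sphere (F j) (?u x)) \<le> C" for j
      using C by (intro AE_I2) (simp add: on_sphere_def)
  qed (simp_all add: m F f)
  then show ?thesis
    using radon_eq[of \<xi>] F[THEN bounded_borel_measurable] f[THEN bounded_borel_measurable] \<xi> k by (simp add: Gr_def)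
qed

text \<open>Let \<open>D\<close> be the difference of the two sides as a function of \<open>\<zeta> = \<eta>\<^sup>\<bottom>\<close>.  Duality expresses the integral of \<open>D\<close>
  against any \<open>\<psi>\<close> as the difference of two values of the symmetric pairing, so it vanishes; with \<open>\<psi> = D\<close>
  the square of \<open>D\<close> integrates to \<open>0\<close>.  Continuity of \<open>g \<mapsto> D (g \<zeta>\<^sub>0)\<close> turns this into \<open>D = 0\<close> everywhere.\<close>

theorem radon_intertwining:
  fixes \<phi> :: "(real^'n) set \<Rightarrow> real"
  assumes i: "0 < i" "i < CARD('n)" and \<phi>: "continuous_map (grassmannian i) euclideanreal \<phi>"
    and \<eta>: "\<eta> \<in> Gr (CARD('n) - i)"
  shows "radon (radon_dual (CARD('n) - i) (\<lambda>\<eta>. \<phi> (\<eta>\<^sup>\<bottom>))) (\<eta>\<^sup>\<bottom>) = radon (radon_dual i \<phi>) \<eta>"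
proof -
  have k: "0 < CARD('n) - i" "CARD('n) - i < CARD('n)" using i by auto
  define A where "A \<alpha> \<zeta> = radon (radon_dual i \<alpha>) (\<zeta>\<^sup>\<bottom>)" for \<alpha> and \<zeta> :: "(real^'n) set"
  define B where "B \<alpha> \<zeta> = radon (radon_dual (CARD('n) - i) (\<lambda>\<eta>. \<alpha> (\<eta>\<^sup>\<bottom>))) \<zeta>" for \<alpha> and \<zeta> :: "(real^'n) set"
  have perp: "bounded_borel (grassmannian (CARD('n) - i)) (\<lambda>\<eta>. \<alpha> (\<eta>\<^sup>\<bottom>))" if "bounded_borel (grassmannian i) \<alpha>" for \<alpha> :: "(real^'n) set \<Rightarrow> real"
    using bounded_borel_perp[OF that] i by simp
  have bA: "bounded_borel (grassmannian i) (A \<alpha>)" if "bounded_borel (grassmannian i) \<alpha>" for \<alpha>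
    unfolding A_def
    by (rule bounded_borel_compose[OF radon_bounded_borel[OF radon_dual_bounded_borel[OF that i] k] perp_measurable])
  have bB: "bounded_borel (grassmannian i) (B \<alpha>)" if "bounded_borel (grassmannian i) \<alpha>" for \<alpha>
    unfolding B_def by (rule radon_bounded_borel[OF radon_dual_bounded_borel[OF perp[OF that] k] i])
  have b\<phi>: "bounded_borel (grassmannian i) \<phi>"
    using bounded_borel_continuous[OF \<phi>] compact_space_grassmannian[OF i(2)] by simp

  \<comment> \<open>duality on \<open>G\<^sub>n\<^sub>,\<^sub>n\<^sub>-\<^sub>i\<close>; the complement of a uniform subspace is uniform, because \<open>g\<close> commutes with taking complements\<close>
  have weakA: "(\<integral>\<zeta>. \<psi> \<zeta> * A \<phi> \<zeta> \<partial>grassmannian_measure i) =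
      (\<integral>\<theta>. radon_dual i \<phi> \<theta> * radon_dual (CARD('n) - i) (\<lambda>\<eta>. \<psi> (\<eta>\<^sup>\<bottom>)) \<theta> \<partial>sphere_measure)"
    if \<psi>: "bounded_borel (grassmannian i) \<psi>" for \<psi>
  proof -
    obtain e1 and \<eta>\<^sub>0 :: "(real^'n) set" where fb1: "flag_base e1 \<eta>\<^sub>0" and d1: "dim \<eta>\<^sub>0 = CARD('n) - i"
      using flag_base_exists[OF k] by blast
    have s0: "subspace \<eta>\<^sub>0" using flag_base.subspace_base[OF fb1] .
    have d2: "dim (\<eta>\<^sub>0\<^sup>\<bottom>) = i" using dim_orthogonal_comp[OF s0] d1 i by simp
    obtain e2 where "e2 \<in> \<eta>\<^sub>0\<^sup>\<bottom>" "norm e2 = 1"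
      using unit_vector_in_subspace[OF subspace_orthogonal_comp[of \<eta>\<^sub>0]] d2 i by auto
    then have fb2: "flag_base e2 (\<eta>\<^sub>0\<^sup>\<bottom>)"
      using d2 i by unfold_locales (auto simp: subspace_orthogonal_comp)
    let ?R = "radon (radon_dual i \<phi>)"
    have m1: "(\<lambda>\<zeta>. \<psi> \<zeta> * A \<phi> \<zeta>) \<in> borel_measurable (borel_of (grassmannian i))"
      by (rule bounded_borel_measurable[OF bounded_borel_mult[OF \<psi> bA[OF b\<phi>]]])
    have m2: "(\<lambda>\<eta>. \<psi> (\<eta>\<^sup>\<bottom>) * ?R \<eta>) \<in> borel_measurable (borel_of (grassmannian (CARD('n) - i)))"
      by (rule bounded_borel_measurable[OF bounded_borel_mult[OF perp[OF \<psi>] radon_bounded_borel[OF radon_dual_bounded_borel[OF b\<phi> i] k]]])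
    have "(\<integral>\<zeta>. \<psi> \<zeta> * A \<phi> \<zeta> \<partial>grassmannian_measure i) = (\<integral>g. \<psi> ((*v) g ` (\<eta>\<^sub>0\<^sup>\<bottom>)) * A \<phi> ((*v) g ` (\<eta>\<^sub>0\<^sup>\<bottom>)) \<partial>haar)"
      using integral_grassmannian_measure[OF fb2] m1 d2 by simp
    also have "\<dots> = (\<integral>g. \<psi> (((*v) g ` \<eta>\<^sub>0)\<^sup>\<bottom>) * ?R ((*v) g ` \<eta>\<^sub>0) \<partial>haar)"
    proof (rule Bochner_Integration.integral_cong[OF refl])
      fix g :: "real^'n^'n" assume "g \<in> space haar"
      then have g: "orthogonal_matrix g" by simp
      have "(*v) g ` (\<eta>\<^sub>0\<^sup>\<bottom>) = ((*v) g ` \<eta>\<^sub>0)\<^sup>\<bottom>" by (rule orthogonal_comp_orthogonal_image[OF g, symmetric])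
      moreover have "((*v) g ` \<eta>\<^sub>0)\<^sup>\<bottom>\<^sup>\<bottom> = (*v) g ` \<eta>\<^sub>0" by (rule orthogonal_comp_self[OF subspace_orthogonal_image[OF s0]])
      ultimately show "\<psi> ((*v) g ` (\<eta>\<^sub>0\<^sup>\<bottom>)) * A \<phi> ((*v) g ` (\<eta>\<^sub>0\<^sup>\<bottom>)) = \<psi> (((*v) g ` \<eta>\<^sub>0)\<^sup>\<bottom>) * ?R ((*v) g ` \<eta>\<^sub>0)"
        by (simp add: A_def)
    qed
    also have "\<dots> = (\<integral>\<eta>. \<psi> (\<eta>\<^sup>\<bottom>) * ?R \<eta> \<partial>grassmannian_measure (CARD('n) - i))"
      using integral_grassmannian_measure[OF fb1] m2 d1 by simp
    also have "\<dots> = (\<integral>\<theta>. radon_dual i \<phi> \<theta> * radon_dual (CARD('n) - i) (\<lambda>\<eta>. \<psi> (\<eta>\<^sup>\<bottom>)) \<theta> \<partial>sphere_measure)"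
      by (rule radon_duality[OF k radon_dual_bounded_borel[OF b\<phi> i] perp[OF \<psi>]])
    finally show ?thesis .
  qed
  have weakB: "(\<integral>\<zeta>. \<psi> \<zeta> * B \<phi> \<zeta> \<partial>grassmannian_measure i) =
      (\<integral>\<theta>. radon_dual i \<psi> \<theta> * radon_dual (CARD('n) - i) (\<lambda>\<eta>. \<phi> (\<eta>\<^sup>\<bottom>)) \<theta> \<partial>sphere_measure)"
    if \<psi>: "bounded_borel (grassmannian i) \<psi>" for \<psi>
    using radon_duality[OF i radon_dual_bounded_borel[OF perp[OF b\<phi>] k] \<psi>] by (simp add: B_def mult.commute)

  define D where "D \<zeta> = A \<phi> \<zeta> - B \<phi> \<zeta>" for \<zeta>
  have bD: "bounded_borel (grassmannian i) D" unfolding D_def by (rule bounded_borel_diff[OF bA[OF b\<phi>] bB[OF b\<phi>]])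
  have \<sigma>: "grassmannian_measure i \<in> finite_borel_measures (grassmannian i :: (real^'n) set topology)"
    by (rule grassmannian_measure_finite_borel[OF i])
  have "(\<integral>\<zeta>. D \<zeta> * D \<zeta> \<partial>grassmannian_measure i) =
      (\<integral>\<zeta>. D \<zeta> * A \<phi> \<zeta> \<partial>grassmannian_measure i) - (\<integral>\<zeta>. D \<zeta> * B \<phi> \<zeta> \<partial>grassmannian_measure i)"
    using integrable_bounded_borel[OF \<sigma> bounded_borel_mult[OF bD bA[OF b\<phi>]]]
      integrable_bounded_borel[OF \<sigma> bounded_borel_mult[OF bD bB[OF b\<phi>]]]
    by (subst Bochner_Integration.integral_diff[symmetric]) (auto simp: D_def right_diff_distrib)
  also have "\<dots> = 0"
    using radon_dual_pairing_symmetric[OF i b\<phi> bD] by (simp add: weakA[OF bD] weakB[OF bD])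
  finally have zero: "(\<integral>\<zeta>. D \<zeta> * D \<zeta> \<partial>grassmannian_measure i) = 0" .

  \<comment> \<open>moving \<open>\<zeta>\<close> by \<open>g\<close> amounts to composing \<open>\<phi>\<close> with \<open>g\<close>, so dominated convergence applies for fixed laws\<close>
  have conv: "(\<lambda>j. A \<phi> ((*v) (g j) ` \<zeta>)) \<longlonglongrightarrow> A \<phi> ((*v) h ` \<zeta>) \<and> (\<lambda>j. B \<phi> ((*v) (g j) ` \<zeta>)) \<longlonglongrightarrow> B \<phi> ((*v) h ` \<zeta>)"
    if \<zeta>: "\<zeta> \<in> Gr i" and g: "\<And>j::nat. orthogonal_matrix (g j)" and h: "orthogonal_matrix h" and gh: "g \<longlonglongrightarrow> h" for \<zeta> g h
  proof -
    have ba: "bounded_borel (grassmannian i) (\<lambda>\<xi>. \<phi> ((*v) a ` \<xi>))" if "orthogonal_matrix a" for a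
      by (rule bounded_borel_compose[OF b\<phi> image_measurable[OF that]])
    obtain C where C: "0 \<le> C" "\<And>\<xi>. \<xi> \<in> topspace (grassmannian i) \<Longrightarrow> \<bar>\<phi> \<xi>\<bar> \<le> C" using bounded_borel_bound[OF b\<phi>] by blast
    have Ca: "\<bar>\<phi> ((*v) a ` \<xi>)\<bar> \<le> C" if "orthogonal_matrix a" "\<xi> \<in> Gr i" for a \<xi>
      using C(2)[of "(*v) a ` \<xi>"] Gr_orthogonal_image[OF that] by simp
    have lim: "(\<lambda>j. \<phi> ((*v) (g j) ` \<xi>)) \<longlonglongrightarrow> \<phi> ((*v) h ` \<xi>)" if "\<xi> \<in> Gr i" for \<xi>
    proof -
      have "continuous_on orthogonal_group (\<lambda>a. \<phi> ((*v) a ` \<xi>))"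
        using continuous_map_compose[OF continuous_map_grassmannian_orbit[OF that] \<phi>] by (simp add: o_def)
      then show ?thesis using g h gh unfolding continuous_on_sequentially by (auto simp: o_def)
    qed
    have \<zeta>p: "\<zeta>\<^sup>\<bottom> \<in> Gr (CARD('n) - i)" by (rule Gr_orthogonal_comp[OF \<zeta>])
    have dual_bound: "\<bar>radon_dual l \<alpha> \<theta>\<bar> \<le> C"
      if l: "0 < l" "l < CARD('n)" and \<alpha>: "bounded_borel (grassmannian l) \<alpha>" "\<And>\<xi>. \<xi> \<in> Gr l \<Longrightarrow> \<bar>\<alpha> \<xi>\<bar> \<le> C" and \<theta>: "norm \<theta> = 1"
      for l \<alpha> and \<theta> :: "real^'n"
    proof -
      obtain e and \<xi>\<^sub>0 :: "(real^'n) set" where fb: "flag_base e \<xi>\<^sub>0" and d: "dim \<xi>\<^sub>0 = l" using flag_base_exists[OF l] by blast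
      show ?thesis
        using flag_base.radon_dual_eq[OF fb \<theta>, of \<alpha>] bounded_borel_measurable[OF \<alpha>(1)] d
          \<alpha>(2) flag_base.subspace_through_Gr[OF fb] C(1)
        by (auto intro!: integral_prob_bound haar.prob_space_axioms)
    qed
    have eqA: "A \<phi> ((*v) a ` \<zeta>) = radon (radon_dual i (\<lambda>\<xi>. \<phi> ((*v) a ` \<xi>))) (\<zeta>\<^sup>\<bottom>)" if a: "orthogonal_matrix a" for a
    proof -
      have "A \<phi> ((*v) a ` \<zeta>) = radon (\<lambda>x. radon_dual i \<phi> (a *v x)) (\<zeta>\<^sup>\<bottom>)"
        unfolding A_def orthogonal_comp_orthogonal_image[OF a]
        by (rule radon_equivariant[OF a \<zeta>p k radon_dual_bounded_borel[OF b\<phi> i]])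
      also have "\<dots> = radon (radon_dual i (\<lambda>\<xi>. \<phi> ((*v) a ` \<xi>))) (\<zeta>\<^sup>\<bottom>)"
        by (rule radon_cong[OF \<zeta>p k bounded_borel_compose[OF radon_dual_bounded_borel[OF b\<phi> i] orthogonal_sphere_measurable[OF a]]
              radon_dual_bounded_borel[OF ba[OF a] i]])
          (rule radon_dual_equivariant[OF a i b\<phi>])
      finally show ?thesis .
    qed
    have bap: "bounded_borel (grassmannian (CARD('n) - i)) (\<lambda>\<eta>. \<phi> ((*v) a ` (\<eta>\<^sup>\<bottom>)))" if "orthogonal_matrix a" for a
      using perp[OF ba[OF that]] .
    have eqB: "B \<phi> ((*v) a ` \<zeta>) = radon (radon_dual (CARD('n) - i) (\<lambda>\<eta>. \<phi> ((*v) a ` (\<eta>\<^sup>\<bottom>)))) \<zeta>" if a: "orthogonal_matrix a" for a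
    proof -
      have "B \<phi> ((*v) a ` \<zeta>) = radon (\<lambda>x. radon_dual (CARD('n) - i) (\<lambda>\<eta>. \<phi> (\<eta>\<^sup>\<bottom>)) (a *v x)) \<zeta>"
        unfolding B_def by (rule radon_equivariant[OF a \<zeta> i radon_dual_bounded_borel[OF perp[OF b\<phi>] k]])
      also have "\<dots> = radon (radon_dual (CARD('n) - i) (\<lambda>\<eta>. \<phi> ((*v) a ` (\<eta>\<^sup>\<bottom>)))) \<zeta>"
      proof (rule radon_cong[OF \<zeta> i bounded_borel_compose[OF radon_dual_bounded_borel[OF perp[OF b\<phi>] k] orthogonal_sphere_measurable[OF a]]
              radon_dual_bounded_borel[OF bap[OF a] k]])
        fix x :: "real^'n" assume "norm x = 1"
        then show "radon_dual (CARD('n) - i) (\<lambda>\<eta>. \<phi> (\<eta>\<^sup>\<bottom>)) (a *v x) = radon_dual (CARD('n) - i) (\<lambda>\<eta>. \<phi> ((*v) a ` (\<eta>\<^sup>\<bottom>))) x"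
          using radon_dual_equivariant[OF a k perp[OF b\<phi>]] by (simp add: orthogonal_comp_orthogonal_image[OF a])
      qed
      finally show ?thesis .
    qed
    have perpG: "\<eta>\<^sup>\<bottom> \<in> Gr i" if "\<eta> \<in> Gr (CARD('n) - i)" for \<eta> :: "(real^'n) set"
      using Gr_orthogonal_comp[OF that] i by simp
    have "(\<lambda>j. radon (radon_dual i (\<lambda>\<xi>. \<phi> ((*v) (g j) ` \<xi>))) (\<zeta>\<^sup>\<bottom>)) \<longlonglongrightarrow> radon (radon_dual i (\<lambda>\<xi>. \<phi> ((*v) h ` \<xi>))) (\<zeta>\<^sup>\<bottom>)"
      by (rule radon_tendsto[OF \<zeta>p k radon_dual_bounded_borel[OF ba[OF g] i] radon_dual_bounded_borel[OF ba[OF h] i], where C = C])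
        (auto intro!: dual_bound radon_dual_tendsto[where C = C] i ba g h Ca lim C(1))
    moreover have "(\<lambda>j. radon (radon_dual (CARD('n) - i) (\<lambda>\<eta>. \<phi> ((*v) (g j) ` (\<eta>\<^sup>\<bottom>)))) \<zeta>)
        \<longlonglongrightarrow> radon (radon_dual (CARD('n) - i) (\<lambda>\<eta>. \<phi> ((*v) h ` (\<eta>\<^sup>\<bottom>)))) \<zeta>"
      by (rule radon_tendsto[OF \<zeta> i radon_dual_bounded_borel[OF bap[OF g] k] radon_dual_bounded_borel[OF bap[OF h] k], where C = C])
        (auto intro!: dual_bound radon_dual_tendsto[where C = C] k bap g h Ca lim C(1) perpG)
    ultimately show ?thesis by (simp add: eqA eqB g h)
  qed
  obtain e and \<zeta>\<^sub>0 :: "(real^'n) set" where fb: "flag_base e \<zeta>\<^sub>0" and d: "dim \<zeta>\<^sub>0 = i" using flag_base_exists[OF i] by blast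
  have \<zeta>\<^sub>0: "\<zeta>\<^sub>0 \<in> Gr i" using flag_base.base_Gr[OF fb] d by simp
  have cont: "continuous_on orthogonal_group (\<lambda>g. D ((*v) g ` \<zeta>\<^sub>0) * D ((*v) g ` \<zeta>\<^sub>0))"
    unfolding continuous_on_sequentially D_def o_def
    using conv[OF \<zeta>\<^sub>0] by (auto intro!: tendsto_mult tendsto_diff)
  have "integrable haar (\<lambda>g. D ((*v) g ` \<zeta>\<^sub>0) * D ((*v) g ` \<zeta>\<^sub>0))"
    using haar.integrable_bounded_compose[OF bounded_borel_mult[OF bD bD]] flag_base.grassmannian_map_measurable[OF fb] d by simp
  moreover have "(\<integral>g. D ((*v) g ` \<zeta>\<^sub>0) * D ((*v) g ` \<zeta>\<^sub>0) \<partial>haar) = 0"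
    using integral_grassmannian_measure[OF fb, of "\<lambda>\<zeta>. D \<zeta> * D \<zeta>"] bounded_borel_measurable[OF bounded_borel_mult[OF bD bD]] d zero by simp
  ultimately have D0: "D ((*v) g ` \<zeta>\<^sub>0) = 0" if "orthogonal_matrix g" for g
    using haar_integral_0_continuous[OF cont _ _ _ that] by simp
  have "\<eta>\<^sup>\<bottom> \<in> Gr i" using Gr_orthogonal_comp[OF \<eta>] i by simp
  then obtain g where "rotation_matrix g" "(*v) g ` \<zeta>\<^sub>0 = \<eta>\<^sup>\<bottom>"
    using rotation_between_subspaces[OF \<zeta>\<^sub>0 _ i(2)] by blast
  then have "D (\<eta>\<^sup>\<bottom>) = 0" using D0[of g] by (simp add: rotation_matrix_def)
  then show ?thesis using \<eta> by (simp add: D_def A_def B_def Gr_def orthogonal_comp_self)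
qed

section \<open>Injectivity of the Radon transform on even measures\<close>

text \<open>The power \<open>dist(x, \<xi>)\<^sup>2\<^sup>m\<close> of the distance from \<open>x\<close> to \<open>\<xi>\<close>.\<close>

definition dist_power :: "real^'n \<Rightarrow> nat \<Rightarrow> (real^'n) set \<Rightarrow> real" where
  "dist_power x m \<xi> = norm (x - proj_matrix \<xi> *v x) ^ (2 * m)"

lemma continuous_dist_power:
  fixes x :: "real^'n"
  shows "continuous_map (grassmannian k) euclideanreal (dist_power x m)"
proof -
  have "continuous_on UNIV (\<lambda>P::real^'n^'n. norm (x - P *v x) ^ (2 * m))"
    by (intro continuous_intros continuous_on_matrix_vector_mult)
  then show ?thesis
    unfolding grassmannian_eq_pullback dist_power_def[abs_def] by (rule continuous_map_from_pullback)
qed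

lemma bounded_borel_dist_power: "k < CARD('n) \<Longrightarrow> bounded_borel (grassmannian k) (dist_power (x :: real^'n) m)"
  by (intro bounded_borel_continuous continuous_dist_power compact_space_grassmannian)

lemma dist_power_orthogonal:
  fixes a :: "real^'n^'n"
  assumes a: "orthogonal_matrix a" and \<xi>: "\<xi> \<in> Gr k"
  shows "dist_power (a *v x) m ((*v) a ` \<xi>) = dist_power x m \<xi>"
proof -
  have "a *v x - proj_matrix ((*v) a ` \<xi>) *v (a *v x) = a *v (x - proj_matrix \<xi> *v x)"
    using \<xi> by (simp add: Gr_def proj_matrix_orthogonal_image[OF a] matrix_vector_mul_assoc[symmetric]
        orthogonal_matrix_cancel[OF a] matrix_vector_mult_diff_distrib del: transpose_matrix_vector)
  then show ?thesis by (simp add: dist_power_def orthogonal_matrix_norm[OF a])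
qed

lemma orthogonal_pair_transitive:
  fixes \<theta> \<theta>' w w' :: "real^'n"
  assumes "norm \<theta> = 1" "norm \<theta>' = 1" "norm w = 1" "norm w' = 1" "\<theta> \<bullet> w = 0" "\<theta>' \<bullet> w' = 0"
  shows "\<exists>a. orthogonal_matrix a \<and> a *v \<theta> = \<theta>' \<and> a *v w = w'"
proof -
  define b where "b = householder (\<theta> - \<theta>')"
  have b: "orthogonal_matrix b" "b *v \<theta> = \<theta>'"
    using householder_swap(1)[of \<theta> \<theta>'] assms by (simp_all add: b_def orthogonal_householder)
  define c where "c = householder (b *v w - w')"
  have "\<theta>' \<bullet> (b *v w) = 0" using orthogonal_matrix_inner[OF b(1), of \<theta> w] b(2) assms by simp
  then have "\<theta>' \<bullet> (b *v w - w') = 0" using assms by (simp add: inner_diff_right)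
  then have "(b *v w - w') \<bullet> \<theta>' = 0" by (metis inner_commute)
  then have "c *v \<theta>' = \<theta>'" unfolding c_def by (rule householder_fix)
  moreover have "c *v (b *v w) = w'"
    using householder_swap(1)[of "b *v w" w'] assms by (simp add: c_def orthogonal_matrix_norm[OF b(1)])
  moreover have "orthogonal_matrix (c ** b)" using b by (simp add: c_def orthogonal_matrix_mul orthogonal_householder)
  ultimately show ?thesis using b(2) by (intro exI[of _ "c ** b"]) (simp add: matrix_vector_mul_assoc[symmetric])
qed

lemma radon_dual_dist_power_const:
  fixes \<theta> \<theta>' w w' :: "real^'n"
  assumes k: "0 < k" "k < CARD('n)"
    and "norm \<theta> = 1" "norm \<theta>' = 1" "norm w = 1" "norm w' = 1" "\<theta> \<bullet> w = 0" "\<theta>' \<bullet> w' = 0"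
  shows "radon_dual k (dist_power w m) \<theta> = radon_dual k (dist_power w' m) \<theta>'"
proof -
  obtain a where a: "orthogonal_matrix a" "a *v \<theta> = \<theta>'" "a *v w = w'"
    using orthogonal_pair_transitive[of \<theta> \<theta>' w w'] assms by blast
  have "radon_dual k (dist_power w' m) \<theta>' = radon_dual k (\<lambda>\<xi>. dist_power w' m ((*v) a ` \<xi>)) \<theta>"
    using radon_dual_equivariant[OF a(1) k bounded_borel_dist_power[OF k(2)], of \<theta> w' m] a assms by simp
  also have "\<dots> = radon_dual k (dist_power w m) \<theta>"
  proof (rule radon_dual_cong[OF k bounded_borel_compose[OF bounded_borel_dist_power[OF k(2)] image_measurable[OF a(1)]]
        bounded_borel_dist_power[OF k(2)]])
    fix \<xi> :: "(real^'n) set" assume "\<xi> \<in> Gr k"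
    then show "dist_power w' m ((*v) a ` \<xi>) = dist_power w m \<xi>" using dist_power_orthogonal[OF a(1)] a(3) by metis
  qed fact
  finally show ?thesis ..
qed

text \<open>The value does not depend on the orthonormal pair \<open>(\<theta>, w)\<close>.  If it were \<open>0\<close>, then almost every
  subspace through an axis vector \<open>\<theta>\<close> would contain all the other axis vectors, hence be the whole space.\<close>

lemma radon_dual_dist_power_pos:
  assumes k: "0 < k" "k < CARD('n)"
  shows "\<exists>c>0. \<forall>\<theta> w :: real^'n. norm \<theta> = 1 \<longrightarrow> norm w = 1 \<longrightarrow> \<theta> \<bullet> w = 0 \<longrightarrow> radon_dual k (dist_power w m) \<theta> = c"
proof -
  obtain e and \<xi>\<^sub>0 :: "(real^'n) set" where "flag_base e \<xi>\<^sub>0" and d: "dim \<xi>\<^sub>0 = k" using flag_base_exists[OF k] by blast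
  then interpret flag_base e \<xi>\<^sub>0 by simp
  obtain j l0 :: 'n where jl: "j \<noteq> l0"
  proof -
    have "\<not> CARD('n) \<le> Suc 0" using k by linarith
    then show thesis using that card_le_Suc0_iff_eq[of "UNIV :: 'n set"] by auto
  qed
  let ?\<theta> = "axis j 1 :: real^'n"
  let ?S = "\<lambda>g. subspace_through e \<xi>\<^sub>0 ?\<theta> g"
  define c where "c = radon_dual k (dist_power (axis l0 1) m) ?\<theta>"
  have const: "radon_dual k (dist_power w m) \<theta> = c" if "norm \<theta> = 1" "norm w = 1" "\<theta> \<bullet> w = 0" for \<theta> w :: "real^'n"
    unfolding c_def using that jl by (intro radon_dual_dist_power_const[OF k]) (auto simp: inner_axis_axis)
  have eq: "radon_dual k (dist_power w m) ?\<theta> = (\<integral>g. dist_power w m (?S g) \<partial>haar)" for w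
    using radon_dual_eq[of ?\<theta> "dist_power w m"] bounded_borel_measurable[OF bounded_borel_dist_power[OF k(2)]] d by simp
  have sm: "?S \<in> measurable haar (borel_of (grassmannian k))"
    unfolding d[symmetric] by (rule subspace_through_measurable) auto
  have "c \<ge> 0" unfolding c_def eq by (simp add: dist_power_def)
  moreover have "c \<noteq> 0"
  proof
    assume "c = 0"
    have "AE g in haar. axis l 1 \<in> ?S g" for l :: 'n
    proof (cases "l = j")
      case True
      then show ?thesis using in_subspace_through[of _ ?\<theta>] by (intro AE_I2) simp
    next
      case False
      then have "(\<integral>g. dist_power (axis l 1) m (?S g) \<partial>haar) = 0"
        using const[of ?\<theta> "axis l 1"] \<open>c = 0\<close> by (simp add: eq inner_axis_axis)
      moreover have "integrable haar (\<lambda>g. dist_power (axis l 1) m (?S g))"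
        by (rule haar.integrable_bounded_compose[OF bounded_borel_dist_power[OF k(2)] sm])
      ultimately have "AE g in haar. dist_power (axis l 1) m (?S g) = 0"
        by (subst (asm) integral_nonneg_eq_0_iff_AE) (auto simp: dist_power_def)
      moreover have "AE g in haar. ?S g \<in> Gr k" using subspace_through_Gr d by (intro AE_I2) simp
      ultimately show ?thesis
      proof eventually_elim
        case (elim g)
        then have s: "subspace (?S g)" by (simp add: Gr_def)
        have "closest_point (?S g) (axis l 1) = axis l 1"
          using elim by (simp add: dist_power_def proj_matrix_mult[OF s])
        then show ?case using closest_point_subspace_self_iff[OF s] by blast
      qed
    qed
    then have "AE g in haar. \<forall>l\<in>UNIV. axis l 1 \<in> ?S g" by (intro AE_finite_allI) auto
    then have "AE g in (haar :: (real^'n^'n) measure). False"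
      using AE_space
    proof eventually_elim
      case (elim g)
      then have G: "?S g \<in> Gr k" using subspace_through_Gr d by simp
      have "x \<in> ?S g" for x :: "real^'n"
      proof -
        have "x = (\<Sum>l\<in>UNIV. x $ l *\<^sub>R axis l 1)" using basis_expansion[of x] by (simp add: scalar_mult_eq_scaleR)
        also have "\<dots> \<in> ?S g" using G elim by (intro subspace_sum subspace_scale) (auto simp: Gr_def)
        finally show ?thesis .
      qed
      then have "?S g = UNIV" by blast
      then show ?case using G k(2) by (simp add: Gr_def)
    qed
    then show False by (simp add: haar.AE_False)
  qed
  ultimately show ?thesis using const by (intro exI[of _ c]) auto
qed

text \<open>For \<open>\<theta> \<in> \<xi>\<close> the distance from \<open>x\<close> to \<open>\<xi>\<close> depends only on the component \<open>y\<close> of \<open>x\<close> orthogonal to \<open>\<theta>\<close>, and it is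
  homogeneous in \<open>y\<close>.\<close>

lemma radon_dual_dist_power:
  assumes k: "0 < k" "k < CARD('n)"
  shows "\<exists>c>0. \<forall>x \<theta> :: real^'n. norm \<theta> = 1 \<longrightarrow>
           radon_dual k (dist_power x m) \<theta> = c * ((norm x)\<^sup>2 - (x \<bullet> \<theta>)\<^sup>2) ^ m"
proof -
  obtain c where c: "c > 0"
    and cw: "\<And>\<theta> w :: real^'n. norm \<theta> = 1 \<Longrightarrow> norm w = 1 \<Longrightarrow> \<theta> \<bullet> w = 0 \<Longrightarrow> radon_dual k (dist_power w m) \<theta> = c"
    using radon_dual_dist_power_pos[OF k] by blast
  obtain e and \<xi>\<^sub>0 :: "(real^'n) set" where "flag_base e \<xi>\<^sub>0" and d: "dim \<xi>\<^sub>0 = k" using flag_base_exists[OF k] by blast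
  then interpret flag_base e \<xi>\<^sub>0 by simp
  have eq: "radon_dual k (dist_power w m) \<theta> = (\<integral>g. dist_power w m (subspace_through e \<xi>\<^sub>0 \<theta> g) \<partial>haar)"
    if "norm \<theta> = 1" for w \<theta>
    using radon_dual_eq[OF that, of "dist_power w m"] bounded_borel_measurable[OF bounded_borel_dist_power[OF k(2)]] d by simp
  \<comment> \<open>covers vectors \<open>x\<close> parallel to \<open>\<theta>\<close>, where \<open>0 ^ 0 = 1\<close> appears for \<open>m = 0\<close>\<close>
  have c1: "c = 1" if "m = 0"
  proof -
    obtain u :: "real^'n" where u: "norm u = 1" using norm_e by blast
    have "dim {u} < DIM(real^'n)" using card_ge_2 by (simp add: dim_singleton)
    from orthogonal_to_subspace_exists[OF this]
    obtain v where v: "v \<noteq> 0" "\<And>y. y \<in> span {u} \<Longrightarrow> orthogonal v y" by blast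
    have "radon_dual k (dist_power (v /\<^sub>R norm v) m) u = c"
      using v(2)[of u] u v(1) by (intro cw) (auto simp: span_base orthogonal_def inner_commute)
    then show ?thesis using eq[OF u] that by (simp add: dist_power_def haar.prob_space[unfolded space_haar])
  qed
  have "radon_dual k (dist_power x m) \<theta> = c * ((norm x)\<^sup>2 - (x \<bullet> \<theta>)\<^sup>2) ^ m" if \<theta>: "norm \<theta> = 1" for x \<theta> :: "real^'n"
  proof -
    define y where "y = x - (x \<bullet> \<theta>) *\<^sub>R \<theta>"
    have \<theta>\<theta>: "\<theta> \<bullet> \<theta> = 1" using \<theta> by (simp add: dot_square_norm)
    have y\<theta>: "\<theta> \<bullet> y = 0" by (simp add: y_def inner_diff_right \<theta>\<theta> inner_commute)
    have ny: "(norm y)\<^sup>2 = (norm x)\<^sup>2 - (x \<bullet> \<theta>)\<^sup>2"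
      unfolding power2_norm_eq_inner
      by (simp add: y_def inner_diff_left inner_diff_right \<theta>\<theta> inner_commute power2_eq_square)
    have red: "dist_power x m \<xi> = dist_power y m \<xi>" if "\<xi> \<in> Gr k" "\<theta> \<in> \<xi>" for \<xi>
    proof -
      have "proj_matrix \<xi> *v \<theta> = \<theta>"
        using that closest_point_subspace_self_iff[of \<xi> \<theta>] by (simp add: Gr_def proj_matrix_mult)
      then have "x - proj_matrix \<xi> *v x = y - proj_matrix \<xi> *v y"
        by (simp add: y_def matrix_vector_mult_diff_distrib matrix_vector_mult_scaleR)
      then show ?thesis by (simp add: dist_power_def)
    qed
    have "radon_dual k (dist_power x m) \<theta> = (\<integral>g. dist_power y m (subspace_through e \<xi>\<^sub>0 \<theta> g) \<partial>haar)"
      unfolding eq[OF \<theta>]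
      using red subspace_through_Gr in_subspace_through \<theta> d by (intro Bochner_Integration.integral_cong refl) auto
    also have "\<dots> = c * (norm y) ^ (2 * m)"
    proof (cases "y = 0")
      case True
      then show ?thesis using c1 by (cases "m = 0") (auto simp: dist_power_def haar.prob_space[unfolded space_haar])
    next
      case False
      define w where "w = y /\<^sub>R norm y"
      have w: "norm w = 1" "\<theta> \<bullet> w = 0" "y = norm y *\<^sub>R w" using False y\<theta> by (auto simp: w_def)
      have "dist_power y m \<xi> = norm y ^ (2 * m) * dist_power w m \<xi>" for \<xi>
      proof -
        have "y - proj_matrix \<xi> *v y = norm y *\<^sub>R (w - proj_matrix \<xi> *v w)"
          using w(3) by (metis matrix_vector_mult_scaleR scaleR_diff_right)
        then show ?thesis by (simp add: dist_power_def power_mult_distrib)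
      qed
      then show ?thesis using cw[OF \<theta> w(1,2)] eq[OF \<theta>, of w] by simp
    qed
    finally show ?thesis using ny by (simp add: power_mult)
  qed
  then show ?thesis using c by blast
qed

text \<open>Since \<open>exp (x \<bullet> \<theta>) * exp (y \<bullet> \<theta>) = exp ((x + y) \<bullet> \<theta>)\<close>, this linear span is an algebra.\<close>

inductive_set exp_span :: "(real^'n \<Rightarrow> real) set" where
  base: "(\<lambda>\<theta>. c * exp (x \<bullet> \<theta>)) \<in> exp_span"
| sum: "f \<in> exp_span \<Longrightarrow> g \<in> exp_span \<Longrightarrow> (\<lambda>\<theta>. f \<theta> + g \<theta>) \<in> exp_span"

lemma exp_span_mult:
  assumes "f \<in> exp_span" "g \<in> exp_span"
  shows "(\<lambda>\<theta>. f \<theta> * g \<theta>) \<in> exp_span"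
  using assms(1)
proof induction
  case (base c x)
  show ?case using assms(2)
  proof induction
    case (base c' x')
    have "(\<lambda>\<theta>. c * exp (x \<bullet> \<theta>) * (c' * exp (x' \<bullet> \<theta>))) = (\<lambda>\<theta>. (c * c') * exp ((x + x') \<bullet> \<theta>))"
      by (simp add: inner_add_left exp_add mult_ac)
    then show ?case using exp_span.base[of "c * c'" "x + x'"] by simp
  next
    case (sum f g)
    then show ?case using exp_span.sum by (fastforce simp: distrib_left)
  qed
next
  case (sum f h)
  then show ?case using exp_span.sum by (fastforce simp: distrib_right)
qed

lemma function_ring_exp_span: "function_ring_on exp_span (sphere (0::real^'n) 1)"
proof
  show "continuous_on (sphere 0 1) f" if "f \<in> exp_span" for f :: "real^'n \<Rightarrow> real"
    using that by induction (auto intro!: continuous_intros)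
  show "(\<lambda>_. c) \<in> exp_span" for c using exp_span.base[of c 0] by simp
  show "\<exists>f\<in>exp_span. f x \<noteq> f y" if "x \<noteq> y" for x y :: "real^'n"
  proof (rule bexI[of _ "\<lambda>\<theta>. 1 * exp ((x - y) \<bullet> \<theta>)"])
    have "(x - y) \<bullet> (x - y) \<noteq> 0" using that by simp
    then have "(x - y) \<bullet> x \<noteq> (x - y) \<bullet> y" by (simp add: inner_diff_right)
    then show "1 * exp ((x - y) \<bullet> x) \<noteq> 1 * exp ((x - y) \<bullet> y)" by simp
  qed (rule exp_span.base)
qed (auto intro: exp_span_mult exp_span.sum)

lemma bounded_borel_sphere_continuous:
  fixes f :: "real^'n \<Rightarrow> real"
  assumes "continuous_on (sphere 0 1) f"
  shows "bounded_borel sphere_top f"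
  using assms by (intro bounded_borel_continuous compact_space_sphere) (simp add: sphere_top_def)

lemma sphere_measure_eq_if_same_exp_integrals:
  fixes M N :: "(real^'n) measure"
  assumes M: "M \<in> finite_borel_measures sphere_top" and N: "N \<in> finite_borel_measures sphere_top"
    and eq: "\<And>x. (\<integral>\<theta>. exp (x \<bullet> \<theta>) \<partial>M) = (\<integral>\<theta>. exp (x \<bullet> \<theta>) \<partial>N)"
  shows "M = N"
proof -
  interpret R: function_ring_on exp_span "sphere (0::real^'n) 1" by (rule function_ring_exp_span)
  have bb: "bounded_borel sphere_top h" if "h \<in> exp_span" for h :: "real^'n \<Rightarrow> real"
    by (rule bounded_borel_sphere_continuous[OF R.continuous[OF that]])
  have span_eq: "(\<integral>\<theta>. h \<theta> \<partial>M) = (\<integral>\<theta>. h \<theta> \<partial>N)" if "h \<in> exp_span" for h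
    using that
  proof induction
    case (base c x)
    then show ?case using eq by simp
  next
    case (sum f g)
    then show ?case
      using integrable_bounded_borel[OF M bb[OF sum.hyps(1)]] integrable_bounded_borel[OF M bb[OF sum.hyps(2)]]
        integrable_bounded_borel[OF N bb[OF sum.hyps(1)]] integrable_bounded_borel[OF N bb[OF sum.hyps(2)]] by simp
  qed
  show ?thesis
  proof (rule finite_measure_eq_if_same_integrals[of M "sphere 0 1" "\<lambda>x. x" N, folded sphere_top_eq_pullback, OF M N])
    fix f :: "real^'n \<Rightarrow> real" assume "continuous_map sphere_top euclideanreal f"
    then have f: "continuous_on (sphere 0 1) f" by (simp add: sphere_top_def)
    have bf: "bounded_borel sphere_top f" by (rule bounded_borel_sphere_continuous[OF f])
    obtain C where C: "0 \<le> C" "\<And>x. x \<in> topspace sphere_top \<Longrightarrow> \<bar>f x\<bar> \<le> C" using bounded_borel_bound[OF bf] by blast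
    have "\<forall>j. \<exists>h\<in>exp_span. \<forall>x\<in>sphere 0 1. \<bar>f x - h x\<bar> < inverse (real (Suc j))"
      using R.Stone_Weierstrass_basic[OF f] by simp
    then obtain h where h: "\<And>j. h j \<in> exp_span"
      and hd: "\<And>j x. x \<in> sphere 0 1 \<Longrightarrow> \<bar>f x - h j x\<bar> < inverse (real (Suc j))" by metis
    have lim: "(\<lambda>j. \<integral>\<theta>. h j \<theta> \<partial>L) \<longlonglongrightarrow> (\<integral>\<theta>. f \<theta> \<partial>L)" if L: "L \<in> finite_borel_measures sphere_top" for L
    proof (rule integral_dominated_convergence[where w = "\<lambda>_. C + 1"])
      interpret finite_measure L using L by (simp add: finite_borel_measures_def)
      have sp: "space L = sphere 0 1" using space_finite_borel_measure[OF L] by simp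
      show "integrable L (\<lambda>_. C + 1)" by simp
      show "f \<in> borel_measurable L" "h j \<in> borel_measurable L" for j
        using integrable_bounded_borel[OF L bf] integrable_bounded_borel[OF L bb[OF h]] by (auto simp: integrable_iff_bounded)
      show "AE \<theta> in L. norm (h j \<theta>) \<le> C + 1" for j
      proof (rule AE_I2)
        fix \<theta> assume "\<theta> \<in> space L"
        moreover have "inverse (real (Suc j)) \<le> 1" by (simp add: inverse_le_1_iff)
        ultimately show "norm (h j \<theta>) \<le> C + 1" using hd[of \<theta> j] C(2)[of \<theta>] by (auto simp: sp)
      qed
      show "AE \<theta> in L. (\<lambda>j. h j \<theta>) \<longlonglongrightarrow> f \<theta>"
      proof (rule AE_I2)
        fix \<theta> assume "\<theta> \<in> space L"
        then have "\<bar>h j \<theta> - f \<theta>\<bar> \<le> inverse (real (Suc j))" for j using hd[of \<theta> j] by (auto simp: sp)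
        then have "(\<lambda>j. h j \<theta> - f \<theta>) \<longlonglongrightarrow> 0"
          by (intro Lim_null_comparison[OF _ LIMSEQ_inverse_real_of_nat]) auto
        then show "(\<lambda>j. h j \<theta>) \<longlonglongrightarrow> f \<theta>" by (rule LIM_zero_cancel)
      qed
    qed
    show "(\<integral>x. f x \<partial>M) = (\<integral>x. f x \<partial>N)"
      using LIMSEQ_unique[OF lim[OF M]] lim[OF N] span_eq[OF h] by simp
  qed
qed

text \<open>The test functions \<open>dist_power x m\<close> give the integrals of \<open>(\<bar>x\<bar>\<^sup>2 - (x \<bullet> \<theta>)\<^sup>2)\<^sup>m\<close>, the binomial theorem those of
  \<open>(x \<bullet> \<theta>)\<^sup>2\<^sup>m\<close>, evenness those of the odd powers, and the exponential series those of \<open>exp (x \<bullet> \<theta>)\<close>.\<close>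

theorem even_measure_eq_if_same_radon_dual_integrals:
  fixes M N :: "(real^'n) measure"
  assumes i: "0 < i" "i < CARD('n)"
    and M: "M \<in> finite_borel_measures sphere_top" and N: "N \<in> finite_borel_measures sphere_top"
    and evM: "\<And>f. bounded_borel sphere_top f \<Longrightarrow> (\<integral>\<theta>. f (- \<theta>) \<partial>M) = (\<integral>\<theta>. f \<theta> \<partial>M)"
    and evN: "\<And>f. bounded_borel sphere_top f \<Longrightarrow> (\<integral>\<theta>. f (- \<theta>) \<partial>N) = (\<integral>\<theta>. f \<theta> \<partial>N)"
    and eq: "\<And>\<phi>. continuous_map (grassmannian i) euclideanreal \<phi> \<Longrightarrow>
      (\<integral>\<theta>. radon_dual i \<phi> \<theta> \<partial>M) = (\<integral>\<theta>. radon_dual i \<phi> \<theta> \<partial>N)"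
  shows "M = N"
proof -
  have cont: "bounded_borel sphere_top (\<lambda>\<theta>. F (x \<bullet> \<theta>))" if "continuous_on UNIV F" for F :: "real \<Rightarrow> real" and x :: "real^'n"
    by (intro bounded_borel_sphere_continuous continuous_on_compose2[OF that] continuous_intros) auto
  have int: "integrable L (\<lambda>\<theta>. F (x \<bullet> \<theta>))"
    if "L \<in> finite_borel_measures sphere_top" "continuous_on UNIV F" for L and F :: "real \<Rightarrow> real" and x :: "real^'n"
    using integrable_bounded_borel[OF that(1) cont[OF that(2)]] .
  have zonal: "(\<integral>\<theta>. ((norm x)\<^sup>2 - (x \<bullet> \<theta>)\<^sup>2) ^ m \<partial>M) = (\<integral>\<theta>. ((norm x)\<^sup>2 - (x \<bullet> \<theta>)\<^sup>2) ^ m \<partial>N)" for x m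
  proof -
    obtain c where c: "c > 0" and e: "\<And>x \<theta> :: real^'n. norm \<theta> = 1 \<Longrightarrow>
        radon_dual i (dist_power x m) \<theta> = c * ((norm x)\<^sup>2 - (x \<bullet> \<theta>)\<^sup>2) ^ m"
      using radon_dual_dist_power[OF i] by blast
    have "(\<integral>\<theta>. radon_dual i (dist_power x m) \<theta> \<partial>L) = c * (\<integral>\<theta>. ((norm x)\<^sup>2 - (x \<bullet> \<theta>)\<^sup>2) ^ m \<partial>L)"
      if "L \<in> finite_borel_measures sphere_top" for L
    proof -
      have "(\<integral>\<theta>. radon_dual i (dist_power x m) \<theta> \<partial>L) = (\<integral>\<theta>. c * ((norm x)\<^sup>2 - (x \<bullet> \<theta>)\<^sup>2) ^ m \<partial>L)"
        using e space_finite_borel_measure[OF that] by (intro Bochner_Integration.integral_cong refl) simp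
      then show ?thesis by simp
    qed
    then show ?thesis using eq[OF continuous_dist_power[of i x m]] M N c by simp
  qed
  have even_power: "(\<integral>\<theta>. (x \<bullet> \<theta>) ^ (2 * m) \<partial>M) = (\<integral>\<theta>. (x \<bullet> \<theta>) ^ (2 * m) \<partial>N)" for x m
  proof -
    let ?t = "\<lambda>\<theta>. (norm x)\<^sup>2 - (x \<bullet> \<theta>)\<^sup>2"
    let ?a = "\<lambda>k. real (m choose k) * (- 1) ^ k * ((norm x)\<^sup>2) ^ (m - k)"
    \<comment> \<open>\<open>(x \<bullet> \<theta>)\<^sup>2 = \<bar>x\<bar>\<^sup>2 - t\<close>, expanded by the binomial theorem\<close>
    have expand: "(x \<bullet> \<theta>) ^ (2 * m) = (\<Sum>k\<le>m. ?a k * ?t \<theta> ^ k)" for \<theta>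
    proof -
      have "(x \<bullet> \<theta>) ^ (2 * m) = (- ?t \<theta> + (norm x)\<^sup>2) ^ m" by (simp add: power_mult)
      also have "\<dots> = (\<Sum>k\<le>m. real (m choose k) * (- ?t \<theta>) ^ k * ((norm x)\<^sup>2) ^ (m - k))" by (rule binomial_ring)
      also have "\<dots> = (\<Sum>k\<le>m. ?a k * ?t \<theta> ^ k)"
        by (intro sum.cong refl) (subst power_minus, simp add: mult_ac)
      finally show ?thesis .
    qed
    have "(\<integral>\<theta>. (x \<bullet> \<theta>) ^ (2 * m) \<partial>L) = (\<Sum>k\<le>m. ?a k * (\<integral>\<theta>. ?t \<theta> ^ k \<partial>L))"
      if "L \<in> finite_borel_measures sphere_top" for L
    proof -
      have "integrable L (\<lambda>\<theta>. ?t \<theta> ^ k)" for k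
        by (rule int[OF that, of "\<lambda>s. ((norm x)\<^sup>2 - s\<^sup>2) ^ k"]) (intro continuous_intros)
      then show ?thesis unfolding expand by (subst Bochner_Integration.integral_sum) auto
    qed
    then show ?thesis using zonal M N by simp
  qed
  have odd_power: "(\<integral>\<theta>. (x \<bullet> \<theta>) ^ m \<partial>L) = 0"
    if "odd m" and ev: "\<And>f. bounded_borel sphere_top f \<Longrightarrow> (\<integral>\<theta>. f (- \<theta>) \<partial>L) = (\<integral>\<theta>. f \<theta> \<partial>L)" for L and x :: "real^'n" and m
    using ev[OF cont[of "\<lambda>s. s ^ m" x]] \<open>odd m\<close> by (simp add: power_minus_odd continuous_intros)
  have power: "(\<integral>\<theta>. (x \<bullet> \<theta>) ^ m \<partial>M) = (\<integral>\<theta>. (x \<bullet> \<theta>) ^ m \<partial>N)" for x m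
    using even_power[of x] odd_power[OF _ evM] odd_power[OF _ evN] by (cases "even m") (auto elim!: evenE)
  show ?thesis
  proof (rule sphere_measure_eq_if_same_exp_integrals[OF M N])
    fix x :: "real^'n"
    let ?p = "\<lambda>n \<theta>. \<Sum>m<n. (x \<bullet> \<theta>) ^ m /\<^sub>R fact m"
    have pint: "(\<integral>\<theta>. ?p n \<theta> \<partial>L) = (\<Sum>m<n. (\<integral>\<theta>. (x \<bullet> \<theta>) ^ m \<partial>L) /\<^sub>R fact m)"
      if "L \<in> finite_borel_measures sphere_top" for L n
      using int[OF that, of "\<lambda>s. s ^ m" x for m] by (subst Bochner_Integration.integral_sum) (auto simp: continuous_intros)
    have lim: "(\<lambda>n. \<integral>\<theta>. ?p n \<theta> \<partial>L) \<longlonglongrightarrow> (\<integral>\<theta>. exp (x \<bullet> \<theta>) \<partial>L)" if L: "L \<in> finite_borel_measures sphere_top" for L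
    proof (rule integral_dominated_convergence[where w = "\<lambda>_. exp (norm x)"])
      interpret finite_measure L using L by (simp add: finite_borel_measures_def)
      have sp: "space L = sphere 0 1" using space_finite_borel_measure[OF L] by simp
      show "integrable L (\<lambda>_. exp (norm x))" by simp
      show "(\<lambda>\<theta>. exp (x \<bullet> \<theta>)) \<in> borel_measurable L" "?p n \<in> borel_measurable L" for n
        using int[OF L, of exp x] int[OF L, of "\<lambda>s. \<Sum>m<n. s ^ m /\<^sub>R fact m" x]
        by (auto simp: integrable_iff_bounded continuous_intros)
      show "AE \<theta> in L. (\<lambda>n. ?p n \<theta>) \<longlonglongrightarrow> exp (x \<bullet> \<theta>)"
        using exp_converges[of "x \<bullet> \<theta>" for \<theta>] by (intro AE_I2) (simp add: sums_def)
      show "AE \<theta> in L. norm (?p n \<theta>) \<le> exp (norm x)" for n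
      proof (rule AE_I2)
        fix \<theta> assume "\<theta> \<in> space L"
        then have "\<bar>x \<bullet> \<theta>\<bar> \<le> norm x" using Cauchy_Schwarz_ineq2[of x \<theta>] by (simp add: sp)
        have "norm (?p n \<theta>) \<le> (\<Sum>m<n. \<bar>x \<bullet> \<theta>\<bar> ^ m /\<^sub>R fact m)"
          by (rule order_trans[OF norm_sum]) (simp add: power_abs abs_mult)
        also have "\<dots> \<le> (\<Sum>m. \<bar>x \<bullet> \<theta>\<bar> ^ m /\<^sub>R fact m)"
          using exp_converges[of "\<bar>x \<bullet> \<theta>\<bar>"] by (intro sum_le_suminf) (auto simp: sums_iff)
        also have "\<dots> = exp \<bar>x \<bullet> \<theta>\<bar>" by (simp add: exp_def)
        also have "\<dots> \<le> exp (norm x)" using \<open>\<bar>x \<bullet> \<theta>\<bar> \<le> norm x\<close> by simp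
        finally show "norm (?p n \<theta>) \<le> exp (norm x)" .
      qed
    qed
    show "(\<integral>\<theta>. exp (x \<bullet> \<theta>) \<partial>M) = (\<integral>\<theta>. exp (x \<bullet> \<theta>) \<partial>N)"
      using LIMSEQ_unique[OF lim[OF M]] lim[OF N] by (simp only: pint[OF M] pint[OF N] power)
  qed
qed

section \<open>Intersection bodies\<close>

lemma minus_one_orthogonal: "orthogonal_matrix (- mat 1 :: real^'n^'n)" "(- mat 1 :: real^'n^'n) *v x = - x"
proof -
  show m: "(- mat 1 :: real^'n^'n) *v x = - x" for x using matrix_vector_mult_diff_rdistrib[of 0 "mat 1" x] by simp
  show "orthogonal_matrix (- mat 1 :: real^'n^'n)" by (rule orthogonal_matrixI_norm) (simp add: m)
qed

text \<open>Every subspace, and hence its unit sphere with the invariant measure, is symmetric under \<open>- 1\<close>.\<close>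

lemma radon_dual_measure_even:
  fixes \<nu> :: "(real^'n) set measure"
  assumes \<nu>: "\<nu> \<in> finite_borel_measures (grassmannian k)" and k: "0 < k" "k < CARD('n)"
    and f: "bounded_borel sphere_top f"
  shows "(\<integral>\<theta>. f (- \<theta>) \<partial>radon_dual_measure \<nu>) = (\<integral>\<theta>. f \<theta> \<partial>radon_dual_measure \<nu>)"
proof -
  have fm: "bounded_borel sphere_top (\<lambda>\<theta>. f (- \<theta>))"
    using bounded_borel_compose[OF f orthogonal_sphere_measurable[OF minus_one_orthogonal(1)]] by (simp add: minus_one_orthogonal(2))
  have "radon (\<lambda>\<theta>. f (- \<theta>)) \<xi> = radon f \<xi>" if \<xi>: "\<xi> \<in> Gr k" for \<xi>
  proof -
    have "(*v) (- mat 1) ` \<xi> = \<xi>"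
      using \<xi> by (intro orthogonal_image_eq_if_subset minus_one_orthogonal(1)) (auto simp: Gr_def minus_one_orthogonal(2) subspace_neg)
    then show ?thesis
      using radon_equivariant[OF minus_one_orthogonal(1) \<xi> k f] by (simp add: minus_one_orthogonal(2))
  qed
  then show ?thesis
    unfolding radon_dual_measure_represented(2)[OF \<nu> k fm] radon_dual_measure_represented(2)[OF \<nu> k f]
    by (intro Bochner_Integration.integral_cong refl) (simp add: space_finite_borel_measure[OF \<nu>])
qed

lemma fun_measure_represented:
  assumes M: "M \<in> finite_borel_measures T" and f: "bounded_borel T f" and nn: "\<And>x. x \<in> topspace T \<Longrightarrow> 0 \<le> f x"
  shows "fun_measure M f \<in> finite_borel_measures T"
    and "\<And>g. bounded_borel T g \<Longrightarrow> (\<integral>x. g x \<partial>fun_measure M f) = (\<integral>x. g x * f x \<partial>M)"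
proof -
  have sM: "sets M = sets (borel_of T)" using M by (simp add: finite_borel_measures_def)
  have sp: "space M = topspace T" by (rule space_finite_borel_measure[OF M])
  have fM: "integrable M f" by (rule integrable_bounded_borel[OF M f])
  have AE: "AE x in M. 0 \<le> f x" using nn sp by (intro AE_I2) simp
  have "emeasure (fun_measure M f) (space (fun_measure M f)) = (\<integral>\<^sup>+x. ennreal (f x) \<partial>M)"
    using fM unfolding fun_measure_def by (subst emeasure_density) (auto intro!: nn_integral_cong)
  also have "\<dots> = ennreal (\<integral>x. f x \<partial>M)" by (rule nn_integral_eq_integral[OF fM AE])
  finally have "finite_measure (fun_measure M f)" by (intro finite_measureI) simp
  then show "fun_measure M f \<in> finite_borel_measures T" by (simp add: finite_borel_measures_def fun_measure_def sM)
  show "(\<integral>x. g x \<partial>fun_measure M f) = (\<integral>x. g x * f x \<partial>M)" if g: "bounded_borel T g" for g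
    using integral_density[of g M f] integrable_bounded_borel[OF M g] fM AE
    by (simp add: fun_measure_def mult.commute)
qed

theorem theorem4p11:
  fixes K :: "(real^'n) set" and i :: nat
  assumes "CARD('n) \<ge> 2" and "0 < i" and "i < CARD('n)" and "sym_star_body K"
  shows
    "(star_intersection_body (CARD('n) - i) K \<longrightarrow> intersection_body i K) \<and>
     (\<forall>\<nu>\<in>finite_borel_measures (grassmannian (CARD('n) - i)).
        radial_power_measure i K = radon_dual_measure \<nu> \<longrightarrow>
          radon_dual_measure (perp_measure i \<nu>) \<in> finite_borel_measures sphere_top \<and>
          radon_radial_power_measure i K =
            radon_perp_measure i (radon_dual_measure (perp_measure i \<nu>))) \<and>
     (\<forall>\<mu>\<in>finite_borel_measures sphere_top.
        radon_radial_power_measure i K = radon_perp_measure i \<mu> \<longrightarrow>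
          (\<forall>\<nu>\<in>finite_borel_measures (grassmannian (CARD('n) - i)).
             \<mu> = radon_dual_measure (perp_measure i \<nu>) \<longrightarrow>
               star_intersection_body (CARD('n) - i) K \<and>
               radial_power_measure i K = radon_dual_measure \<nu>))"
proof -
  note n2 = assms(1) and i = assms(2,3) and K = assms(4)
  have k: "0 < CARD('n) - i" "CARD('n) - i < CARD('n)" using i by auto
  have nni: "CARD('n) - (CARD('n) - i) = i" using i by simp
  define \<rho> where "\<rho> \<theta> = radial_function K \<theta> ^ i" for \<theta>
  have b\<rho>: "bounded_borel sphere_top \<rho>"
    using K unfolding \<rho>_def[abs_def] by (intro bounded_borel_sphere_continuous continuous_intros) (simp add: sym_star_body_def)
  have \<rho>_nn: "0 \<le> \<rho> \<theta>" if "norm \<theta> = 1" for \<theta>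
    using K that unfolding \<rho>_def sym_star_body_def by (intro zero_le_power less_imp_le) auto
  have \<rho>_even: "\<rho> (- \<theta>) = \<rho> \<theta>" for \<theta>
  proof -
    have "- x \<in> K \<longleftrightarrow> x \<in> K" for x using K unfolding sym_star_body_def by (metis minus_minus)
    then show ?thesis by (simp add: \<rho>_def radial_function_def)
  qed
  have R: "radon \<rho> \<xi> \<ge> 0" if "\<xi> \<in> Gr i" for \<xi>
    using radon_eq[OF _ _ _ bounded_borel_measurable[OF b\<rho>], of \<xi>] that i \<rho>_nn by (simp add: Gr_def on_sphere_def)
  have bR: "bounded_borel (grassmannian i) (radon \<rho>)" by (rule radon_bounded_borel[OF b\<rho> i])
  note \<sigma> = sphere_measure_finite_borel[OF n2] and \<gamma> = grassmannian_measure_finite_borel[OF i]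
  have rp: "radial_power_measure i K = fun_measure sphere_measure \<rho>"
    by (simp add: radial_power_measure_def \<rho>_def[abs_def])
  have rr: "radon_radial_power_measure i K = fun_measure (grassmannian_measure i) (radon \<rho>)"
    by (simp add: radon_radial_power_measure_def \<rho>_def[abs_def])
  have rp_fin: "radial_power_measure i K \<in> finite_borel_measures sphere_top"
    unfolding rp by (rule fun_measure_represented(1)[OF \<sigma> b\<rho>]) (simp add: \<rho>_nn)
  have rp_int: "(\<integral>\<theta>. f \<theta> \<partial>radial_power_measure i K) = (\<integral>\<theta>. f \<theta> * \<rho> \<theta> \<partial>sphere_measure)"
    if "bounded_borel sphere_top f" for f
    unfolding rp by (rule fun_measure_represented(2)[OF \<sigma> b\<rho> _ that]) (simp add: \<rho>_nn)
  have rr_fin: "radon_radial_power_measure i K \<in> finite_borel_measures (grassmannian i)"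
    unfolding rr by (rule fun_measure_represented(1)[OF \<gamma> bR]) (simp add: R)
  have rr_int: "(\<integral>\<xi>. \<phi> \<xi> \<partial>radon_radial_power_measure i K) = (\<integral>\<theta>. radon_dual i \<phi> \<theta> \<partial>radial_power_measure i K)"
    if \<phi>: "bounded_borel (grassmannian i) \<phi>" for \<phi>
  proof -
    have "(\<integral>\<xi>. \<phi> \<xi> \<partial>radon_radial_power_measure i K) = (\<integral>\<xi>. \<phi> \<xi> * radon \<rho> \<xi> \<partial>grassmannian_measure i)"
      unfolding rr by (rule fun_measure_represented(2)[OF \<gamma> bR _ \<phi>]) (simp add: R)
    also have "\<dots> = (\<integral>\<theta>. radon_dual i \<phi> \<theta> \<partial>radial_power_measure i K)"
      unfolding radon_duality[OF i b\<rho> \<phi>] rp_int[OF radon_dual_bounded_borel[OF \<phi> i]] by (simp add: mult.commute)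
    finally show ?thesis .
  qed
  have bc: "bounded_borel (grassmannian i) \<phi>" if "continuous_map (grassmannian i) euclideanreal \<phi>" for \<phi> :: "(real^'n) set \<Rightarrow> real"
    using bounded_borel_continuous[OF that] compact_space_grassmannian[OF i(2)] by simp
  have main: "radon_dual_measure (perp_measure i \<nu>) \<in> finite_borel_measures sphere_top \<and>
      (\<forall>\<phi>. continuous_map (grassmannian i) euclideanreal \<phi> \<longrightarrow>
        (\<integral>\<xi>. \<phi> \<xi> \<partial>radon_perp_measure i (radon_dual_measure (perp_measure i \<nu>))) =
        (\<integral>\<theta>. radon_dual i \<phi> \<theta> \<partial>radon_dual_measure \<nu>))"
    if \<nu>: "\<nu> \<in> finite_borel_measures (grassmannian (CARD('n) - i))" for \<nu> :: "(real^'n) set measure"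
  proof (intro conjI allI impI)
    note p = perp_measure_represented[OF \<nu> i]
    note r = radon_dual_measure_represented[OF p(1) i]
    show "radon_dual_measure (perp_measure i \<nu>) \<in> finite_borel_measures sphere_top" by (rule r(1))
    fix \<phi> :: "(real^'n) set \<Rightarrow> real" assume c: "continuous_map (grassmannian i) euclideanreal \<phi>"
    note \<phi> = bc[OF c]
    let ?d = "radon_dual (CARD('n) - i) (\<lambda>\<eta>. \<phi> (\<eta>\<^sup>\<bottom>))"
    have bp: "bounded_borel (grassmannian (CARD('n) - i)) (\<lambda>\<eta>. \<phi> (\<eta>\<^sup>\<bottom>))" using bounded_borel_perp[OF \<phi>] i by simp
    have bd: "bounded_borel sphere_top ?d" by (rule radon_dual_bounded_borel[OF bp k])
    have "(\<integral>\<xi>. \<phi> \<xi> \<partial>radon_perp_measure i (radon_dual_measure (perp_measure i \<nu>))) = (\<integral>\<eta>. radon ?d (\<eta>\<^sup>\<bottom>) \<partial>\<nu>)"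
      unfolding radon_perp_measure_represented(2)[OF r(1) i \<phi>] r(2)[OF bd]
      by (rule p(2)[OF radon_bounded_borel[OF bd i]])
    also have "\<dots> = (\<integral>\<eta>. radon (radon_dual i \<phi>) \<eta> \<partial>\<nu>)"
      using radon_intertwining[OF i c]
      by (intro Bochner_Integration.integral_cong refl) (simp add: space_finite_borel_measure[OF \<nu>])
    also have "\<dots> = (\<integral>\<theta>. radon_dual i \<phi> \<theta> \<partial>radon_dual_measure \<nu>)"
      by (rule radon_dual_measure_represented(2)[OF \<nu> k radon_dual_bounded_borel[OF \<phi> i], symmetric])
    finally show "(\<integral>\<xi>. \<phi> \<xi> \<partial>radon_perp_measure i (radon_dual_measure (perp_measure i \<nu>))) =
        (\<integral>\<theta>. radon_dual i \<phi> \<theta> \<partial>radon_dual_measure \<nu>)" .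
  qed
  have direct: "radon_dual_measure (perp_measure i \<nu>) \<in> finite_borel_measures sphere_top \<and>
      radon_radial_power_measure i K = radon_perp_measure i (radon_dual_measure (perp_measure i \<nu>))"
    if \<nu>: "\<nu> \<in> finite_borel_measures (grassmannian (CARD('n) - i))" and eq: "radial_power_measure i K = radon_dual_measure \<nu>"
    for \<nu> :: "(real^'n) set measure"
  proof
    show \<mu>: "radon_dual_measure (perp_measure i \<nu>) \<in> finite_borel_measures sphere_top" using main[OF \<nu>] by blast
    show "radon_radial_power_measure i K = radon_perp_measure i (radon_dual_measure (perp_measure i \<nu>))"
      using rr_fin radon_perp_measure_represented(1)[OF \<mu> i] main[OF \<nu>] rr_int[OF bc] eq
      unfolding grassmannian_eq_pullback by (intro finite_measure_eq_if_same_integrals) auto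
  qed
  have converse: "radial_power_measure i K = radon_dual_measure \<nu>"
    if \<nu>: "\<nu> \<in> finite_borel_measures (grassmannian (CARD('n) - i))"
      and eq: "radon_radial_power_measure i K = radon_perp_measure i (radon_dual_measure (perp_measure i \<nu>))"
    for \<nu> :: "(real^'n) set measure"
  proof (rule even_measure_eq_if_same_radon_dual_integrals[OF i rp_fin radon_dual_measure_represented(1)[OF \<nu> k] _ radon_dual_measure_even[OF \<nu> k]])
    fix f :: "real^'n \<Rightarrow> real" assume f: "bounded_borel sphere_top f"
    have fm: "bounded_borel sphere_top (\<lambda>\<theta>. f (- \<theta>))"
      using bounded_borel_compose[OF f orthogonal_sphere_measurable[OF minus_one_orthogonal(1)]] by (simp add: minus_one_orthogonal(2))
    show "(\<integral>\<theta>. f (- \<theta>) \<partial>radial_power_measure i K) = (\<integral>\<theta>. f \<theta> \<partial>radial_power_measure i K)"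
      using integral_sphere_orthogonal[OF minus_one_orthogonal(1) n2 bounded_borel_measurable[OF bounded_borel_mult[OF f b\<rho>]]]
      by (simp add: rp_int[OF f] rp_int[OF fm] minus_one_orthogonal(2) \<rho>_even)
  next
    fix \<phi> :: "(real^'n) set \<Rightarrow> real" assume c: "continuous_map (grassmannian i) euclideanreal \<phi>"
    show "(\<integral>\<theta>. radon_dual i \<phi> \<theta> \<partial>radial_power_measure i K) = (\<integral>\<theta>. radon_dual i \<phi> \<theta> \<partial>radon_dual_measure \<nu>)"
      using main[OF \<nu>] c rr_int[OF bc[OF c]] eq by simp
  qed
  show ?thesis
    unfolding star_intersection_body_def intersection_body_def nni using direct converse K by blast
qed

end
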